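(* Let $R\in(0,\infty)$, $\gamma\in\mathbb{R}$, $N,n\in\mathbb{N}$ with $n\geq 2$, $\eta\in[e_N R,\infty)$, and $f\in C_0^\infty(B_n(0;R)\backslash\{0\})$. Then $$ \begin{aligned} \int_{B_n(0;R)} |x|^\gamma |(-\Delta f)(x)|^2\, d^n x \geq{}& A_{n,\gamma} \int_{B_n(0;R)} |x|^{\gamma-2} |(\nabla f)(x)|^2\, d^n x \\ & + \frac14\int_{B_n(0;R)} |x|^{\gamma-2} \Bigg(\sum_{k=1}^{N} \prod_{p=1}^{k} [\ln_{p}(\eta/|x|)]^{-2} \Bigg)|(\nabla f)(x)|^2\, d^n x \\ & + \frac14\int_{B_n(0;R)}|x|^{\gamma-4}\Bigg(\sum_{k=1}^{N} \prod_{p=1}^{k} [\ln_{p}(\eta/|x|)]^{-2} \Bigg)|(\nabla_{\mathbb{S}^{n-1}} f)(x)|^2\, d^n x, \end{aligned} $$ where $$ A_{n,\gamma}=\min_{j \in \mathbb{N}_0}\{\alpha_{n,\gamma,\lambda_j}\}, $$ with $\lambda_j=j(j+n-2)$, $j\in\mathbb{N}_0$, and $$ \alpha_{n,\gamma,\lambda_0}=\alpha_{n,\gamma,0}=\frac{(n-\gamma)^2}{4},\qquad \alpha_{n,\gamma,\lambda_j}=\frac{\big[4^{-1}(n+\gamma-4)(n-\gamma)+\lambda_j\big]^2}{4^{-1}(n+\gamma-4)^2+\lambda_j},\quad j\in\mathbb{N}. $$ Moreover, excluding the cases $(\alpha)$ $n=2$, $\gamma=2$ and $(\beta)$ $n=3$,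 $\gamma=1$, the constant $A_{n,\gamma}$ on the right-hand side of the inequality $$ \begin{aligned} \int_{B_n(0;R)} |x|^\gamma |(-\Delta f)(x)|^2\, d^n x \geq{}& A_{n,\gamma} \int_{B_n(0;R)} |x|^{\gamma-2} |(\nabla f)(x)|^2\, d^n x \\ & + \frac14\int_{B_n(0;R)} |x|^{\gamma-2} \Bigg(\sum_{k=1}^{N} \prod_{p=1}^{k} [\ln_{p}(\eta/|x|)]^{-2} \Bigg)|(\nabla f)(x)|^2\, d^n x \\ & + \frac14\int_{B_n(0;R)}|x|^{\gamma-4}\Bigg(\sum_{k=1}^{N} \prod_{p=1}^{k} [\ln_{p}(\eta/|x|)]^{-2} \Bigg)|(\nabla_{\mathbb{S}^{n-1}} f)(x)|^2\, d^n x \end{aligned} $$ is optimal.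
   Context: Notation: $\mathbb{N}=\{1,2,\dots\}$, $\mathbb{N}_0=\mathbb{N}\cup\{0\}$. $B_n(0;R)$ is the open ball in $\mathbb{R}^n$ centered at the origin with radius $R$. $C_0^\infty(U)$ denotes the (complex-valued) infinitely differentiable functions with compact support contained in the open set $U$; in particular functions in $C_0^\infty(B_n(0;R)\backslash\{0\})$ vanish near $0$ and near the boundary of the ball. Iterated logarithms: $\ln_1(\cdot)=\ln(\cdot)$, $\ln_{k+1}(\cdot)=\ln(\ln_k(\cdot))$, $k\in\mathbb{N}$. Iterated exponentials: $e_0=0$, $e_{j+1}=e^{e_j}$, $j\in\mathbb{N}_0$ (so $e_1=1$, $e_2=e$, etc.). $\mathbb{S}^{n-1}$ is the unit sphere in $\mathbb{R}^n$, and $\nabla_{\mathbb{S}^{n-1}}$ is the gradient operator on $\mathbb{S}^{n-1}$. In polar coordinates $x=r\theta$, $r=|x|>0$, $\theta=x/|x|\in\mathbb{S}^{n-1}$, one writes $f(x)=f(r,\theta)$, and $(\nabla_{\mathbb{S}^{n-1}} f)(x)$ means $(\nabla_{\mathbb{S}^{n-1}} f(r,\cdot))(\theta)$, so that $|(\nabla f)(x)|^2=|(\partial f/\partial r)(r,\theta)|^2+r^{-2}|(\nabla_{\mathbb{S}^{n-1}} f(r,\cdot))(\theta)|^2$. The numbers $\lambda_j=j(j+n-2)$, $j\in\mathbb{N}_0$, are the eigenvalues of the nonnegative Laplace--Beltrami operator $-\Delta_{\mathbb{S}^{n-1}}$ in $L^2(\mathbb{S}^{n-1})$. Optimality of $A_{n,\gamma}$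 means that (for the given $R,\gamma,N,n,\eta$) it cannot be replaced by any strictly larger constant such that the inequality continues to hold for all $f\in C_0^\infty(B_n(0;R)\backslash\{0\})$. *)

theory Defs
  imports "HOL-Analysis.Analysis" "HOL-Real_Asymp.Real_Asymp"
begin

primrec k_times_cont_diff ::
    "nat \<Rightarrow> ('a::real_normed_vector \<Rightarrow> 'b::real_normed_vector) \<Rightarrow> bool" where
  "k_times_cont_diff 0 f \<longleftrightarrow> continuous_on UNIV f"
| "k_times_cont_diff (Suc k) f \<longleftrightarrow> (\<forall>x. f differentiable (at x)) \<and>
     (\<forall>v. k_times_cont_diff k (\<lambda>x. frechet_derivative f (at x) v))"

definition smooth :: "('a::real_normed_vector \<Rightarrow> 'b::real_normed_vector) \<Rightarrow> bool" where
  "smooth f \<longleftrightarrow> (\<forall>k. k_times_cont_diff k f)"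

text \<open>Elements of \<open>C\<^sub>0\<^sup>\<infinity>(U)\<close> are identified with their extensions by zero to the whole space.\<close>

definition C0_infty :: "'a::real_normed_vector set \<Rightarrow> ('a \<Rightarrow> complex) set" where
  "C0_infty U = {f. smooth f \<and> compact (closure {x. f x \<noteq> 0}) \<and> closure {x. f x \<noteq> 0} \<subseteq> U}"

definition partial :: "'n::finite \<Rightarrow> (real^'n \<Rightarrow> complex) \<Rightarrow> real^'n \<Rightarrow> complex" where
  "partial i f x = frechet_derivative f (at x) (axis i 1)"

definition grad :: "(real^'n::finite \<Rightarrow> complex) \<Rightarrow> real^'n \<Rightarrow> complex^'n" where
  "grad f x = (\<chi> i. partial i f x)"

definition laplacian :: "(real^'n::finite \<Rightarrow> complex) \<Rightarrow> real^'n \<Rightarrow> complex" where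
  "laplacian f x = (\<Sum>i\<in>UNIV. partial i (partial i f) x)"

text \<open>
  The gradient at \<open>\<theta>\<close> of a function \<open>g\<close> on the unit sphere is the Euclidean gradient of its
  extension \<open>y \<mapsto> g (y / \<bar>y\<bar>)\<close>, which is constant along rays.  Only the values of \<open>g\<close> on the sphere
  enter, and the resulting vector is tangential and represents the differential of \<open>g\<close> on the
  tangent space at \<open>\<theta>\<close> (see \<open>grad_polar\<close> below for the relation with \<open>grad\<close>).
\<close>

definition grad_on_sphere :: "(real^'n::finite \<Rightarrow> complex) \<Rightarrow> real^'n \<Rightarrow> complex^'n" where
  "grad_on_sphere g \<theta> = grad (\<lambda>y. g (y /\<^sub>R norm y)) \<theta>"

definition sph_grad :: "(real^'n::finite \<Rightarrow> complex) \<Rightarrow> real^'n \<Rightarrow> complex^'n" where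
  "sph_grad f x = grad_on_sphere (\<lambda>\<omega>. f (norm x *\<^sub>R \<omega>)) (x /\<^sub>R norm x)"

text \<open>\<open>iter_ln p\<close> is the iterated logarithm \<open>ln\<^sub>p\<close> for \<open>p \<ge> 1\<close>, so \<open>iter_ln 1 = ln\<close>;
  \<open>iter_exp j\<close> is \<open>e\<^sub>j\<close>, which starts at \<open>e\<^sub>0 = 0\<close>.\<close>

definition iter_ln :: "nat \<Rightarrow> real \<Rightarrow> real" where
  "iter_ln p = ln ^^ p"

definition iter_exp :: "nat \<Rightarrow> real" where
  "iter_exp j = (exp ^^ j) 0"

definition log_weight :: "nat \<Rightarrow> real \<Rightarrow> real \<Rightarrow> real" where
  "log_weight N \<eta> r = (\<Sum>k=1..N. \<Prod>p=1..k. (iter_ln p (\<eta> / r)) powi (-2))"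

definition sph_eigenvalue :: "nat \<Rightarrow> nat \<Rightarrow> real" where
  "sph_eigenvalue n j = real j * (real j + real n - 2)"

definition alpha :: "nat \<Rightarrow> real \<Rightarrow> nat \<Rightarrow> real" where
  "alpha n \<gamma> j =
     (if j = 0 then (real n - \<gamma>)\<^sup>2 / 4
      else ((real n + \<gamma> - 4) * (real n - \<gamma>) / 4 + sph_eigenvalue n j)\<^sup>2
             / ((real n + \<gamma> - 4)\<^sup>2 / 4 + sph_eigenvalue n j))"

text \<open>The minimum over all \<open>j\<close>; it is attained, see \<open>A_const_attained\<close> and \<open>A_const_le\<close>.\<close>

definition A_const :: "nat \<Rightarrow> real \<Rightarrow> real" where
  "A_const n \<gamma> = (LEAST a. a \<in> range (alpha n \<gamma>))"

definition hardy_rellich ::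
    "real \<Rightarrow> real \<Rightarrow> real \<Rightarrow> nat \<Rightarrow> real \<Rightarrow> (real^'n::finite \<Rightarrow> complex) \<Rightarrow> bool" where
  "hardy_rellich C R \<gamma> N \<eta> f \<longleftrightarrow>
     (LINT x:ball 0 R|lborel. norm x powr \<gamma> * (norm (- laplacian f x))\<^sup>2)
     \<ge> C * (LINT x:ball 0 R|lborel. norm x powr (\<gamma> - 2) * (norm (grad f x))\<^sup>2)
       + 1/4 * (LINT x:ball 0 R|lborel.
           norm x powr (\<gamma> - 2) * log_weight N \<eta> (norm x) * (norm (grad f x))\<^sup>2)
       + 1/4 * (LINT x:ball 0 R|lborel.
           norm x powr (\<gamma> - 4) * log_weight N \<eta> (norm x) * (norm (sph_grad f x))\<^sup>2)"

lemma alpha_at_top: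
  assumes "n \<ge> 2"
  shows "filterlim (alpha n \<gamma>) at_top sequentially"
proof -
  define c where "c = (real n + \<gamma> - 4) * (real n - \<gamma>) / 4"
  define d where "d = (real n + \<gamma> - 4)\<^sup>2 / 4"
  define m where "m = real n - 2"
  have "filterlim (\<lambda>j::nat. (c + real j * (real j + m))\<^sup>2 / (d + real j * (real j + m)))
          at_top sequentially"
    by real_asymp
  moreover have "eventually (\<lambda>j. (c + real j * (real j + m))\<^sup>2 / (d + real j * (real j + m))
                   = alpha n \<gamma> j) sequentially"
    using eventually_gt_at_top[of 0]
    by eventually_elim (simp add: alpha_def sph_eigenvalue_def c_def d_def m_def algebra_simps)
  ultimately show ?thesis
    by (rule filterlim_mono_eventually[OF _ order_refl order_refl])
qed

lemma alpha_min_exists: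
  assumes "n \<ge> 2"
  shows "\<exists>j. \<forall>i. alpha n \<gamma> j \<le> alpha n \<gamma> i"
proof -
  obtain J where J: "\<And>j. j \<ge> J \<Longrightarrow> alpha n \<gamma> j \<ge> alpha n \<gamma> 0"
    using alpha_at_top[OF assms, of \<gamma>]
    unfolding filterlim_at_top eventually_sequentially by blast
  obtain j where j: "j \<in> {..J}" "\<And>i. i \<in> {..J} \<Longrightarrow> alpha n \<gamma> j \<le> alpha n \<gamma> i"
    using ex_min_if_finite[of "alpha n \<gamma> ` {..J}"] by (force simp: not_less)
  have "alpha n \<gamma> j \<le> alpha n \<gamma> i" for i
    using j(2)[of i] j(2)[of 0] J[of i] by (cases "i \<le> J") auto
  then show ?thesis by blast
qed

lemma A_const_attained_and_le:
  assumes "n \<ge> 2"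
  shows "A_const n \<gamma> \<in> range (alpha n \<gamma>) \<and> (\<forall>j. A_const n \<gamma> \<le> alpha n \<gamma> j)"
proof -
  obtain j where j: "\<And>i. alpha n \<gamma> j \<le> alpha n \<gamma> i"
    using alpha_min_exists[OF assms] by blast
  have "A_const n \<gamma> = alpha n \<gamma> j"
    unfolding A_const_def by (rule Least_equality) (auto simp: j)
  with j show ?thesis by auto
qed

lemma A_const_attained: "n \<ge> 2 \<Longrightarrow> \<exists>j. A_const n \<gamma> = alpha n \<gamma> j"
  using A_const_attained_and_le by blast

lemma A_const_le: "n \<ge> 2 \<Longrightarrow> A_const n \<gamma> \<le> alpha n \<gamma> j"
  using A_const_attained_and_le by blast

lemma grad_polar:
  fixes f :: "real^'n::finite \<Rightarrow> complex"
  assumes f: "f differentiable (at x)" and x: "x \<noteq> 0"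
  shows "(norm (grad f x))\<^sup>2 =
           (norm (vector_derivative (\<lambda>r. f (r *\<^sub>R (x /\<^sub>R norm x))) (at (norm x))))\<^sup>2
           + (norm (sph_grad f x))\<^sup>2 / (norm x)\<^sup>2"
proof -
  define r where "r = norm x"
  define \<theta> where "\<theta> = x /\<^sub>R r"
  define D where "D = frechet_derivative f (at x)"
  have r: "r > 0" using x by (simp add: r_def)
  have x_eq: "x = r *\<^sub>R \<theta>" using r by (simp add: \<theta>_def)
  have n1: "norm \<theta> = 1" using r by (simp add: \<theta>_def r_def)
  have D: "(f has_derivative D) (at x)"
    using f unfolding D_def by (simp add: frechet_derivative_works)
  interpret D: linear D using D by (rule has_derivative_linear)
  have rad: "((\<lambda>s. f (s *\<^sub>R \<theta>)) has_vector_derivative D \<theta>) (at r)"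
  proof -
    have "((\<lambda>s. s *\<^sub>R \<theta>) has_derivative (\<lambda>h. h *\<^sub>R \<theta>)) (at r)"
      by (auto intro!: derivative_eq_intros)
    from diff_chain_at[OF this, of f D] D show ?thesis
      by (simp add: has_vector_derivative_def o_def x_eq D.scaleR)
  qed
  have nrm: "((\<lambda>y::real^'n. norm y) has_derivative (\<lambda>h. \<theta> \<bullet> h)) (at \<theta>)"
  proof -
    have "\<theta> \<noteq> 0" using n1 by auto
    from has_derivative_norm[OF this] n1 show ?thesis
      by (simp add: sgn_div_norm inner_commute)
  qed
  have "((\<lambda>y. r *\<^sub>R (y /\<^sub>R norm y)) has_derivative (\<lambda>h. r *\<^sub>R (h - (\<theta> \<bullet> h) *\<^sub>R \<theta>))) (at \<theta>)"
    by (rule derivative_eq_intros nrm refl)+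
       (use n1 nrm in \<open>auto simp: fun_eq_iff algebra_simps\<close>)
  from diff_chain_at[OF this, of f D] D n1
  have der: "((\<lambda>y. f (r *\<^sub>R (y /\<^sub>R norm y))) has_derivative
               (\<lambda>h. D (r *\<^sub>R (h - (\<theta> \<bullet> h) *\<^sub>R \<theta>)))) (at \<theta>)"
    by (simp add: o_def x_eq)
  have "D (r *\<^sub>R (axis i 1 - (\<theta> \<bullet> axis i 1) *\<^sub>R \<theta>))
          = r *\<^sub>R (D (axis i 1) - (\<theta> $ i) *\<^sub>R D \<theta>)" for i
    by (simp only: D.scaleR D.diff inner_axis inner_real_def mult_1_right)
  with frechet_derivative_at[OF der]
  have sph: "sph_grad f x $ i = r *\<^sub>R (D (axis i 1) - (\<theta> $ i) *\<^sub>R D \<theta>)" for i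
    unfolding sph_grad_def grad_on_sphere_def grad_def partial_def vec_lambda_beta
      r_def[symmetric] \<theta>_def[symmetric] by metis
  have sq: "(norm v)\<^sup>2 = (\<Sum>i\<in>UNIV. (norm (v $ i))\<^sup>2)" for v :: "complex^'n"
    by (simp add: norm_vec_def L2_set_def sum_nonneg)
  have ts: "(\<Sum>i\<in>UNIV. (\<theta> $ i)\<^sup>2) = 1"
    using n1 by (simp add: norm_eq_1 inner_vec_def power2_eq_square)
  have "\<theta> = (\<Sum>i\<in>UNIV. (\<theta> $ i) *\<^sub>R axis i 1)"
    using basis_expansion[of \<theta>] by (simp add: scalar_mult_eq_scaleR)
  then have "D \<theta> = (\<Sum>i\<in>UNIV. (\<theta> $ i) *\<^sub>R D (axis i 1))"
    by (metis (no_types, lifting) D.sum D.scaleR sum.cong)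
  then have td: "(\<Sum>i\<in>UNIV. (\<theta> $ i) * (D (axis i 1) \<bullet> D \<theta>)) = (norm (D \<theta>))\<^sup>2"
    by (metis (no_types, lifting) inner_scaleR_left inner_sum_left power2_norm_eq_inner sum.cong)
  have ex: "(norm (r *\<^sub>R (a - t *\<^sub>R b)))\<^sup>2
              = r\<^sup>2 * ((norm a)\<^sup>2 - 2 * (t * (a \<bullet> b)) + t\<^sup>2 * (norm b)\<^sup>2)" for a b :: complex and t
    unfolding power2_norm_eq_inner
    by (simp add: inner_diff_left inner_diff_right inner_commute[of b a] power2_eq_square
        algebra_simps)
  have "(norm (sph_grad f x))\<^sup>2 =
          r\<^sup>2 * (\<Sum>i\<in>UNIV. (norm (D (axis i 1)))\<^sup>2 - 2 * ((\<theta> $ i) * (D (axis i 1) \<bullet> D \<theta>))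
                   + (\<theta> $ i)\<^sup>2 * (norm (D \<theta>))\<^sup>2)"
    unfolding sq sum_distrib_left
    by (intro sum.cong refl) (simp only: sph ex)
  also have "\<dots> = r\<^sup>2 * ((norm (grad f x))\<^sup>2 - (norm (D \<theta>))\<^sup>2)"
    by (simp add: sum.distrib sum_subtractf sum_distrib_left[symmetric]
        sum_distrib_right[symmetric] td ts sq grad_def partial_def D_def[symmetric])
  finally show ?thesis
    using r vector_derivative_at[OF rad] by (simp add: r_def \<theta>_def)
qed

end

theory Submission
  imports Defs
begin

text \<open>
  Put \<open>a = (4 - n - \<gamma>)/2\<close>, \<open>b = (n - \<gamma>)/2\<close>, \<open>f = \<bar>x\<bar>\<^sup>a g\<close>, let \<open>E = x \<cdot> \<nabla>\<close> and let \<open>\<Delta>\<^sub>S\<close> be half the sum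
  of the squares of the rotation fields \<open>x\<^sub>i\<partial>\<^sub>j - x\<^sub>j\<partial>\<^sub>i\<close>.  The rotation fields and \<open>E\<close> are
  antisymmetric for \<open>\<bar>x\<bar>\<^sup>-\<^sup>n dx\<close>, and the rotation fields commute with \<open>E\<close>, so integration by parts turns the left-hand side into the
  integral of
  \<open>\<bar>E h\<bar>\<^sup>2 + 2\<bar>\<nabla>\<^sub>S E g\<bar>\<^sup>2 + b\<^sup>2\<bar>E g\<bar>\<^sup>2 + \<bar>(ab + \<Delta>\<^sub>S) g\<bar>\<^sup>2\<close> with \<open>h = (E + a) g\<close>.
  The logarithmic terms come from the one-dimensional Hardy inequality in \<open>ln r\<close>, applied to \<open>h\<close> and
  to the rotational derivatives of \<open>g\<close>; the rest uses \<open>A \<le> \<alpha>\<^sub>0 = b\<^sup>2\<close> and the positivity of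
  \<open>(ab - \<lambda>)\<^sup>2 - A(a\<^sup>2 + \<lambda>)\<close> on the spectrum of \<open>-\<Delta>\<^sub>S\<close>.  Optimality is tested on
  \<open>g = \<psi>(\<epsilon> ln(r/R)) Y\<close> with a spherical harmonic \<open>Y\<close> of minimizing degree and \<open>\<epsilon> \<rightarrow> 0\<close>.
\<close>

section \<open>Smooth functions on the line and on the punctured space\<close>

text \<open>The exponent \<open>a\<close> removes all power weights: conjugating |x|^2 \<Delta> =
  E^2 + (n-2)E + \<Delta>_S by |x|^a gives (E + a)(E + b) + \<Delta>_S, with constant coefficients
  in t = ln r. On the eigenspace of an eigenvalue m, at frequency xi in t, the left-hand side is
  xi^4 + (a^2 + b^2 + 2m) xi^2 + (ab - m)^2 and the gradient term is xi^2 + a^2 + m. For m > 0 the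
  quotient at xi = 0 is the constant \<open>alpha\<close>; for m = 0 it is xi^2 + b^2 throughout,
  which is why j = 0 is set apart: at a = 0 the general formula would read 0/0. The factor 2 on
  |\<nabla>_S E g|^2 pays for the second spherical logarithmic term. The obstacle: (ab - m)^2 -
  A(a^2 + m) can be negative between consecutive eigenvalues, so the discreteness of the spectrum
  must enter. It enters through polynomials, which split into finitely many eigenfunctions; there is
  no integration in polar coordinates and no expansion of \<open>g\<close> itself, only algebra of
  derivations together with vanishing integrals.\<close>

text \<open>The powers \<open>1 / t ^ k\<close> are carried along because the family is then closed
  under differentiation up to linear combinations. At 0 the difference quotient of one member is the
  next member.\<close>

lemma deriv_exp_inverse_power:
  "((\<lambda>t::real. if t > 0 then exp (-1/t) / t ^ k else 0) has_real_derivative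
      - real k * (if t > 0 then exp (-1/t) / t ^ Suc k else 0)
        + (if t > 0 then exp (-1/t) / t ^ Suc (Suc k) else 0)) (at t)"
proof -
  consider "t > 0" | "t < 0" | "t = 0" by linarith
  then show ?thesis
  proof cases
    case 1
    have "((\<lambda>t. exp (-1/t) / t ^ k) has_real_derivative
        - real k * (exp (-1/t) / t ^ Suc k) + exp (-1/t) / t ^ Suc (Suc k)) (at t)"
      using 1 by (cases k) (auto intro!: derivative_eq_intros simp: field_simps power2_eq_square,
        metis Suc_pred gr0I power_Suc)
    moreover have "eventually (\<lambda>s. (if s > 0 then exp (-1/s) / s ^ k else 0) = exp (-1/s) / s ^ k) (nhds t)"
      using eventually_nhds_in_open[of "{0<..}" t] 1 by (auto elim!: eventually_mono)
    ultimately show ?thesis using 1 by (subst DERIV_cong_ev[OF refl _ refl]) auto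
  next
    case 2
    have "eventually (\<lambda>s. (if s > 0 then exp (-1/s) / s ^ k else 0) = (0::real)) (nhds t)"
      using eventually_nhds_in_open[of "{..<0}" t] 2 by (auto elim!: eventually_mono)
    then show ?thesis using 2 by (subst DERIV_cong_ev[OF refl _ refl]) auto
  next
    case 3
    have "((\<lambda>s::real. exp (-1/s) / s ^ Suc k) \<longlongrightarrow> 0) (at_right 0)"
      by real_asymp
    then have r: "((\<lambda>s::real. (if s > 0 then exp (-1/s) / s ^ k else 0) / s) \<longlongrightarrow> 0) (at_right 0)"
      by (rule Lim_transform_eventually)
         (auto simp: eventually_at_right_less field_simps intro!: eventually_mono[OF eventually_at_right_less[of 0]])
    have l: "((\<lambda>s::real. (if s > 0 then exp (-1/s) / s ^ k else 0) / s) \<longlongrightarrow> 0) (at_left 0)"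
      by (rule Lim_transform_eventually[OF tendsto_const])
         (auto intro!: eventually_at_leftI[of "-1"])
    show ?thesis
      using filterlim_split_at[OF l r] 3 by (simp add: DERIV_def cong: if_cong)
  qed
qed

text \<open>A syntactic class closed under differentiation (\<open>elem_smooth_deriv\<close>), so
  that higher derivatives never need separate treatment. \<open>elem_antiderivative\<close> serves
  the scaling argument in \<open>I_rad_scale\<close>. The sign conditions range over the whole line,
  which is why the iterated logarithms have to be truncated later.\<close>

inductive elem_smooth :: "(real \<Rightarrow> real) \<Rightarrow> bool" where
  elem_const: "elem_smooth (\<lambda>t. c)"
| elem_id: "elem_smooth (\<lambda>t. t)"
| elem_flat: "elem_smooth (\<lambda>t. if t > 0 then exp (-1/t) / t ^ k else 0)"
| elem_exp: "elem_smooth \<phi> \<Longrightarrow> elem_smooth (\<lambda>t. exp (\<phi> t))"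
| elem_ln: "elem_smooth \<phi> \<Longrightarrow> (\<And>t. \<phi> t > 0) \<Longrightarrow> elem_smooth (\<lambda>t. ln (\<phi> t))"
| elem_add: "elem_smooth \<phi> \<Longrightarrow> elem_smooth \<psi> \<Longrightarrow> elem_smooth (\<lambda>t. \<phi> t + \<psi> t)"
| elem_mult: "elem_smooth \<phi> \<Longrightarrow> elem_smooth \<psi> \<Longrightarrow> elem_smooth (\<lambda>t. \<phi> t * \<psi> t)"
| elem_inverse: "elem_smooth \<phi> \<Longrightarrow> (\<And>t. \<phi> t \<noteq> 0) \<Longrightarrow> elem_smooth (\<lambda>t. inverse (\<phi> t))"
| elem_antiderivative:
    "elem_smooth \<phi> \<Longrightarrow> (\<And>t. (\<Phi> has_real_derivative \<phi> t) (at t)) \<Longrightarrow> elem_smooth \<Phi>"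
| elem_affine: "elem_smooth \<phi> \<Longrightarrow> elem_smooth (\<lambda>t. \<phi> (c * t + d))"

lemma elem_smooth_deriv_ex:
  "elem_smooth \<phi> \<Longrightarrow> \<exists>\<phi>'. elem_smooth \<phi>' \<and> (\<forall>t. (\<phi> has_real_derivative \<phi>' t) (at t))"
proof (induction rule: elem_smooth.induct)
  case (elem_const c)
  then show ?case by (intro exI[of _ "\<lambda>t. 0"]) (auto intro: elem_smooth.elem_const elem_smooth.elem_id elem_smooth.elem_exp elem_smooth.elem_add elem_smooth.elem_mult)
next
  case elem_id
  then show ?case by (intro exI[of _ "\<lambda>t. 1"]) (auto intro: elem_smooth.elem_const elem_smooth.elem_id elem_smooth.elem_exp elem_smooth.elem_add elem_smooth.elem_mult)
next
  case (elem_flat k)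
  show ?case
    by (intro exI conjI allI, rule elem_smooth.elem_add, rule elem_smooth.elem_mult,
        rule elem_smooth.elem_const, rule elem_smooth.elem_flat, rule elem_smooth.elem_flat,
        rule deriv_exp_inverse_power)
next
  case (elem_exp \<phi>)
  then obtain \<phi>' where "elem_smooth \<phi>'" "\<forall>t. (\<phi> has_real_derivative \<phi>' t) (at t)" by blast
  then show ?case using elem_exp
    by (intro exI[of _ "\<lambda>t. exp (\<phi> t) * \<phi>' t"])
       (auto intro!: elem_smooth.elem_const elem_smooth.elem_id elem_smooth.elem_exp elem_smooth.elem_add elem_smooth.elem_mult derivative_eq_intros)
next
  case (elem_ln \<phi>)
  then obtain \<phi>' where *: "elem_smooth \<phi>'" "\<forall>t. (\<phi> has_real_derivative \<phi>' t) (at t)" by blast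
  have "((\<lambda>t. ln (\<phi> t)) has_real_derivative inverse (\<phi> t) * \<phi>' t) (at t)" for t
    using *(2) elem_ln.hyps(2)[of t] by (auto intro!: derivative_eq_intros simp: divide_inverse)
  moreover have "\<phi> t \<noteq> 0" for t using elem_ln.hyps(2)[of t] by simp
  ultimately show ?case using elem_ln.hyps(1) *(1)
    by (intro exI[of _ "\<lambda>t. inverse (\<phi> t) * \<phi>' t"] conjI allI
          elem_smooth.elem_mult elem_smooth.elem_inverse) auto
next
  case (elem_add \<phi> \<psi>)
  then obtain \<phi>' \<psi>' where "elem_smooth \<phi>'" "\<forall>t. (\<phi> has_real_derivative \<phi>' t) (at t)"
    "elem_smooth \<psi>'" "\<forall>t. (\<psi> has_real_derivative \<psi>' t) (at t)" by blast
  then show ?case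
    by (intro exI[of _ "\<lambda>t. \<phi>' t + \<psi>' t"]) (auto intro!: elem_smooth.elem_const elem_smooth.elem_id elem_smooth.elem_exp elem_smooth.elem_add elem_smooth.elem_mult derivative_eq_intros)
next
  case (elem_mult \<phi> \<psi>)
  then obtain \<phi>' \<psi>' where "elem_smooth \<phi>'" "\<forall>t. (\<phi> has_real_derivative \<phi>' t) (at t)"
    "elem_smooth \<psi>'" "\<forall>t. (\<psi> has_real_derivative \<psi>' t) (at t)" by blast
  then show ?case using elem_mult
    by (intro exI[of _ "\<lambda>t. \<phi>' t * \<psi> t + \<psi>' t * \<phi> t"])
       (auto intro!: elem_smooth.elem_add elem_smooth.elem_mult DERIV_mult)
next
  case (elem_inverse \<phi>)
  then obtain \<phi>' where "elem_smooth \<phi>'" "\<forall>t. (\<phi> has_real_derivative \<phi>' t) (at t)" by blast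
  then show ?case using elem_inverse
    by (intro exI[of _ "\<lambda>t. (-1) * (inverse (\<phi> t) * \<phi>' t * inverse (\<phi> t))"] conjI allI
          elem_smooth.elem_mult elem_smooth.elem_inverse elem_smooth.elem_const)
       (auto intro!: derivative_eq_intros)
next
  case (elem_antiderivative \<phi> \<Phi>)
  then show ?case by (intro exI[of _ \<phi>]) blast
next
  case (elem_affine \<phi> c d)
  then obtain \<phi>' where *: "elem_smooth \<phi>'" "\<forall>t. (\<phi> has_real_derivative \<phi>' t) (at t)" by blast
  have "((\<lambda>t. \<phi> (c * t + d)) has_real_derivative c * \<phi>' (c * t + d)) (at t)" for t
    by (rule DERIV_chain2[THEN DERIV_cong], rule *(2)[rule_format])
       (auto intro!: derivative_eq_intros)
  with * show ?case
    by (intro exI[of _ "\<lambda>t. c * \<phi>' (c * t + d)"])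
       (auto intro!: elem_smooth.elem_const elem_smooth.elem_mult elem_smooth.elem_affine)
qed

lemma elem_smooth_deriv:
  assumes "elem_smooth \<phi>"
  shows "elem_smooth (deriv \<phi>)" and "(\<phi> has_real_derivative deriv \<phi> t) (at t)"
proof -
  obtain \<phi>' where *: "elem_smooth \<phi>'" "\<And>t. (\<phi> has_real_derivative \<phi>' t) (at t)"
    using elem_smooth_deriv_ex[OF assms] by blast
  then have "deriv \<phi> = \<phi>'" by (auto intro!: DERIV_imp_deriv)
  with * show "elem_smooth (deriv \<phi>)" and "(\<phi> has_real_derivative deriv \<phi> t) (at t)" by auto
qed

lemma elem_smooth_continuous: "elem_smooth \<phi> \<Longrightarrow> continuous_on A \<phi>"
  by (meson DERIV_isCont continuous_at_imp_continuous_on elem_smooth_deriv(2))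

lemma elem_step:
  obtains \<sigma> where "elem_smooth \<sigma>" "\<And>u. 0 \<le> \<sigma> u" "\<And>u. \<sigma> u \<le> 1" "\<And>u. u \<le> 0 \<Longrightarrow> \<sigma> u = 0"
    "\<And>u. 1 \<le> u \<Longrightarrow> \<sigma> u = 1"
proof -
  define h where "h = (\<lambda>t::real. if t > 0 then exp (-1/t) / t ^ 0 else 0)"
  have h: "elem_smooth h" "h u \<ge> 0" "u \<le> 0 \<Longrightarrow> h u = 0" "u > 0 \<Longrightarrow> h u > 0" for u
    unfolding h_def using elem_flat[of 0] by auto
  have pos: "h t + h (1 - t) > 0" for t
    using h(4)[of t] h(4)[of "1-t"] h(2)[of t] h(2)[of "1-t"] by (cases "t > 0") (auto simp: add_pos_nonneg add_nonneg_pos)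
  have "elem_smooth (\<lambda>t. h (1 - t))"
    using elem_affine[OF h(1), of "-1" 1] by simp
  then have "elem_smooth (\<lambda>t. h t * inverse (h t + h (1 - t)))" using pos
    by (intro elem_mult elem_inverse elem_add h) (auto simp: less_imp_neq[symmetric])
  moreover have "h u * inverse (h u + h (1 - u)) \<ge> 0" "h u * inverse (h u + h (1 - u)) \<le> 1" for u
    using h(2)[of u] h(2)[of "1-u"] pos[of u] by (simp_all add: field_simps)
  moreover have "h u * inverse (h u + h (1 - u)) = 0" if "u \<le> 0" for u using that h(3)[of u] by simp
  moreover have "h u * inverse (h u + h (1 - u)) = 1" if "1 \<le> u" for u
    using that h(3)[of "1-u"] h(4)[of u] by simp
  ultimately show thesis using that[of "\<lambda>t. h t * inverse (h t + h (1 - t))"] by simp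
qed

lemma elem_cutoff:
  fixes s t :: real
  assumes "s \<le> t"
  obtains \<kappa> where "elem_smooth \<kappa>" "\<And>u. 0 \<le> \<kappa> u" "\<And>u. s \<le> u \<Longrightarrow> u \<le> t \<Longrightarrow> \<kappa> u = 1"
    "\<And>u. u \<le> s - 1 \<or> t + 1 \<le> u \<Longrightarrow> \<kappa> u = 0"
proof -
  obtain \<sigma> where \<sigma>: "elem_smooth \<sigma>" "\<And>u. 0 \<le> \<sigma> u" "\<And>u. u \<le> 0 \<Longrightarrow> \<sigma> u = 0" "\<And>u. 1 \<le> u \<Longrightarrow> \<sigma> u = 1"
    using elem_step by metis
  have "elem_smooth (\<lambda>u. \<sigma> (1 * u + (1 - s)) * \<sigma> (-1 * u + (t + 1)))"
    by (intro elem_mult elem_affine \<sigma>(1))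
  then show thesis
    by (rule that) (use \<sigma>(2-4) in auto)
qed

section \<open>Partial derivatives away from the origin\<close>

definition pder :: "'n::finite \<Rightarrow> (real^'n \<Rightarrow> real) \<Rightarrow> real^'n \<Rightarrow> real" where
  "pder i f x = (if x = 0 then 0 else frechet_derivative f (at x) (axis i 1))"

lemma pder_at_0 [simp]: "pder i f 0 = 0"
  by (simp add: pder_def)

lemma pder_eq: "x \<noteq> 0 \<Longrightarrow> (f has_derivative f') (at x) \<Longrightarrow> pder i f x = f' (axis i 1)"
  by (simp add: pder_def frechet_derivative_at[symmetric])

lemma pder_cong: "(\<And>y. y \<noteq> 0 \<Longrightarrow> f y = g y) \<Longrightarrow> pder i f = pder i g"
proof
  fix x assume eq: "\<And>y. y \<noteq> 0 \<Longrightarrow> f y = g y"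
  have "(f has_derivative D) (at x) \<longleftrightarrow> (g has_derivative D) (at x)" if "x \<noteq> 0" for D
    using that has_derivative_transform_within_open[of f D x UNIV "-{0}" g]
      has_derivative_transform_within_open[of g D x UNIV "-{0}" f] eq by auto
  then show "pder i f x = pder i g x"
    by (simp add: pder_def frechet_derivative_def)
qed

text \<open>Infinite differentiability as a greatest fixed point: it is proved by exhibiting a set
  of differentiable functions that is closed under \<open>pder\<close>, without counting
  orders.\<close>

coinductive smooth_punctured :: "(real^'n::finite \<Rightarrow> real) \<Rightarrow> bool" where
  "(\<And>x. x \<noteq> 0 \<Longrightarrow> f differentiable (at x)) \<Longrightarrow> (\<And>i. smooth_punctured (pder i f))
     \<Longrightarrow> smooth_punctured f"

lemma smooth_punctured_diff: "smooth_punctured f \<Longrightarrow> x \<noteq> 0 \<Longrightarrow> f differentiable (at x)"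
  by (erule smooth_punctured.cases) auto

lemma smooth_punctured_pdf: "smooth_punctured f \<Longrightarrow> smooth_punctured (pder i f)"
  by (erule smooth_punctured.cases) auto

lemma smooth_punctured_continuous: "smooth_punctured f \<Longrightarrow> continuous_on (-{0}) f"
  by (auto intro!: continuous_at_imp_continuous_on differentiable_imp_continuous_within smooth_punctured_diff)

text \<open>The invariant for the coinduction. It contains all functions already known to be smooth
  and is closed under sums and products, so the Leibniz rule does not lead out of it.
  \<open>gen_punct\<close> accounts for the value 0 that \<open>pder\<close> takes at the
  origin.\<close>

inductive smooth_gen :: "(real^'n::finite \<Rightarrow> real) \<Rightarrow> bool" where
  gen_base: "smooth_punctured f \<Longrightarrow> smooth_gen f"
| gen_const: "smooth_gen (\<lambda>x. c)"
| gen_coord: "smooth_gen (\<lambda>x. x $ i)"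
| gen_rad: "elem_smooth \<phi> \<Longrightarrow> smooth_gen (\<lambda>x. \<phi> (ln (norm x)))"
| gen_add: "smooth_gen f \<Longrightarrow> smooth_gen g \<Longrightarrow> smooth_gen (\<lambda>x. f x + g x)"
| gen_mult: "smooth_gen f \<Longrightarrow> smooth_gen g \<Longrightarrow> smooth_gen (\<lambda>x. f x * g x)"
| gen_punct: "smooth_gen f \<Longrightarrow> smooth_gen (\<lambda>x. of_bool (x \<noteq> 0) * f x)"

text \<open>|x|^(-2) is written as an exponential of ln |x| so that the derivative is again built
  from \<open>gen_rad\<close> and \<open>gen_coord\<close>.\<close>

lemma has_derivative_rad:
  fixes x :: "real^'n::finite"
  assumes "elem_smooth \<phi>" "x \<noteq> 0"
  shows "((\<lambda>x. \<phi> (ln (norm x))) has_derivative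
           (\<lambda>h. deriv \<phi> (ln (norm x)) * ((x \<bullet> h) * exp (- 2 * ln (norm x))))) (at x)"
proof -
  have n: "norm x > 0" using assms by simp
  have "((\<lambda>x. ln (norm x)) has_derivative (\<lambda>h. (x \<bullet> h) * exp (- 2 * ln (norm x)))) (at x)"
    using n
    by (auto intro!: derivative_eq_intros has_derivative_norm[OF assms(2)]
        simp: sgn_div_norm inner_commute exp_minus exp_double power2_eq_square divide_simps)
  from has_derivative_compose[OF this, of \<phi> "(*) (deriv \<phi> (ln (norm x)))"]
  show ?thesis
    using elem_smooth_deriv(2)[OF assms(1), of "ln (norm x)"]
    by (simp add: has_field_derivative_def mult.assoc)
qed

lemma pder_const: "pder i (\<lambda>x. c) = (\<lambda>x. 0)"
  by (rule ext, case_tac "x = 0") (auto intro!: pder_eq[THEN trans])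

lemma pder_coord: "pder i (\<lambda>x::real^'n::finite. x $ j) = (\<lambda>x. of_bool (x \<noteq> 0) * of_bool (i = j))"
proof
  fix x :: "real^'n"
  have "((\<lambda>x::real^'n. x $ j) has_derivative (\<lambda>h. h $ j)) (at x)"
    by (auto intro!: derivative_eq_intros bounded_linear_imp_has_derivative bounded_linear_vec_nth)
  from pder_eq[OF _ this] show "pder i (\<lambda>x::real^'n. x $ j) x = of_bool (x \<noteq> 0) * of_bool (i = j)"
    by (cases "x = 0") (auto simp: axis_def)
qed

lemma pder_rad:
  fixes i :: "'n::finite"
  assumes "elem_smooth \<phi>"
  shows "pder i (\<lambda>x. \<phi> (ln (norm x))) =
    (\<lambda>x. of_bool (x \<noteq> 0) * (deriv \<phi> (ln (norm x)) * (x $ i * exp (- 2 * ln (norm x)))))"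
proof
  fix x :: "real^'n"
  show "pder i (\<lambda>x. \<phi> (ln (norm x))) x =
     of_bool (x \<noteq> 0) * (deriv \<phi> (ln (norm x)) * (x $ i * exp (- 2 * ln (norm x))))"
    by (cases "x = 0") (auto simp: inner_axis pder_eq[OF _ has_derivative_rad[OF assms]])
qed

lemma pder_add:
  assumes "\<And>x. x \<noteq> 0 \<Longrightarrow> f differentiable (at x)" "\<And>x. x \<noteq> 0 \<Longrightarrow> g differentiable (at x)"
  shows "pder i (\<lambda>x. f x + g x) = (\<lambda>x. pder i f x + pder i g x)"
proof
  fix x
  show "pder i (\<lambda>x. f x + g x) x = pder i f x + pder i g x"
  proof (cases "x = 0")
    case False
    from has_derivative_add[OF assms[OF False, unfolded frechet_derivative_works]] False
    show ?thesis by (subst pder_eq) (auto simp: pder_def)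
  qed simp
qed

lemma pder_mult:
  assumes "\<And>x. x \<noteq> 0 \<Longrightarrow> f differentiable (at x)" "\<And>x. x \<noteq> 0 \<Longrightarrow> g differentiable (at x)"
  shows "pder i (\<lambda>x. f x * g x) = (\<lambda>x. f x * pder i g x + pder i f x * g x)"
proof
  fix x
  show "pder i (\<lambda>x. f x * g x) x = f x * pder i g x + pder i f x * g x"
  proof (cases "x = 0")
    case False
    from has_derivative_mult[OF assms[OF False, unfolded frechet_derivative_works]] False
    show ?thesis by (subst pder_eq) (auto simp: pder_def)
  qed simp
qed

lemma smooth_gen_deriv:
  "smooth_gen f \<Longrightarrow> (\<forall>x. x \<noteq> 0 \<longrightarrow> f differentiable (at x)) \<and> (\<forall>i. smooth_gen (pder i f))"
proof (induction rule: smooth_gen.induct)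
  case (gen_base f)
  then show ?case
    by (auto intro: smooth_gen.intros smooth_punctured_pdf smooth_punctured_diff)
next
  case (gen_const c)
  then show ?case by (auto simp: pder_const intro: smooth_gen.intros)
next
  case (gen_coord i)
  have "((\<lambda>x::real^'a. x $ i) has_derivative (\<lambda>h. h $ i)) (at x)" for x
    by (auto intro!: derivative_eq_intros bounded_linear_imp_has_derivative bounded_linear_vec_nth)
  then have "(\<lambda>x::real^'a. x $ i) differentiable (at x)" for x
    by (auto simp: differentiable_def)
  moreover have "smooth_gen (pder j (\<lambda>x::real^'a. x $ i))" for j
    unfolding pder_coord by (rule smooth_gen.gen_punct[OF smooth_gen.gen_const])
  ultimately show ?case by blast
next
  case (gen_rad \<phi>)
  have "smooth_gen (\<lambda>x::real^'a. exp (-2 * ln (norm x)))"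
    using smooth_gen.gen_rad[OF elem_exp[OF elem_mult[OF elem_const elem_id]], of "-2"] by simp
  then have "smooth_gen (pder i (\<lambda>x::real^'a. \<phi> (ln (norm x))))" for i
    unfolding pder_rad[OF gen_rad]
    by (intro smooth_gen.gen_punct smooth_gen.gen_mult smooth_gen.gen_rad smooth_gen.gen_coord
        elem_smooth_deriv(1) gen_rad elem_exp elem_mult elem_const elem_id)
  with has_derivative_rad[OF gen_rad] show ?case
    by (auto simp: differentiable_def)
next
  case (gen_add f g)
  then show ?case by (auto simp: pder_add intro: smooth_gen.gen_add)
next
  case (gen_mult f g)
  then show ?case by (auto simp: pder_mult intro!: smooth_gen.gen_add smooth_gen.gen_mult)
next
  case (gen_punct f)
  have "pder i (\<lambda>x. of_bool (x \<noteq> 0) * f x) = pder i f" for i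
    by (rule pder_cong) auto
  moreover have "(\<lambda>x. of_bool (x \<noteq> 0) * f x) differentiable (at x)" if "x \<noteq> 0" for x
  proof -
    have "f differentiable (at x)" using gen_punct that by auto
    then obtain D where "(f has_derivative D) (at x)" by (auto simp: differentiable_def)
    then have "((\<lambda>x. of_bool (x \<noteq> 0) * f x) has_derivative D) (at x)"
      by (rule has_derivative_transform_within_open[of _ _ _ _ "-{0}"]) (use that in auto)
    then show ?thesis by (auto simp: differentiable_def)
  qed
  ultimately show ?case using gen_punct by auto
qed

lemma smooth_gen_punctured: "smooth_gen f \<Longrightarrow> smooth_punctured f"
proof (coinduction arbitrary: f rule: smooth_punctured.coinduct)
  case smooth_punctured
  then show ?case using smooth_gen_deriv[of f] by auto
qed

text \<open>Schwarz's theorem: the second difference over a small square equals h^2 times either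
  mixed derivative at some point of the square, by two applications of the mean value theorem;
  continuity at \<open>x\<close> then identifies the two.\<close>

lemma pder_commute:
  fixes f :: "real^'n::finite \<Rightarrow> real"
  assumes f: "smooth_punctured f"
  shows "pder i (pder j f) = pder j (pder i f)"
proof
  fix x :: "real^'n"
  show "pder i (pder j f) x = pder j (pder i f) x"
  proof (cases "x = 0")
    case False
    define c where "c k l s t = x + s *\<^sub>R axis k 1 + t *\<^sub>R axis l (1::real)" for k l :: 'n and s t
    have dline: "((\<lambda>s. g (y + s *\<^sub>R axis k 1)) has_real_derivative pder k g (y + s *\<^sub>R axis k 1)) (at s)"
      if "smooth_punctured g" "y + s *\<^sub>R axis k 1 \<noteq> 0" for g and y :: "real^'n" and k s
    proof -
      have "(g has_derivative frechet_derivative g (at (y + s *\<^sub>R axis k 1))) (at (y + s *\<^sub>R axis k 1))"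
        using smooth_punctured_diff[OF that] by (simp add: frechet_derivative_works)
      moreover have "((\<lambda>s. y + s *\<^sub>R axis k 1) has_derivative (\<lambda>h. h *\<^sub>R axis k 1)) (at s)"
        by (auto intro!: derivative_eq_intros)
      ultimately have "((\<lambda>s. g (y + s *\<^sub>R axis k 1)) has_derivative
          (\<lambda>h. frechet_derivative g (at (y + s *\<^sub>R axis k 1)) (h *\<^sub>R axis k 1))) (at s)"
        by (rule has_derivative_compose[rotated])
      moreover have "linear (frechet_derivative g (at (y + s *\<^sub>R axis k 1)))"
        using smooth_punctured_diff[OF that] by (rule linear_frechet_derivative)
      ultimately show ?thesis
        using that(2) by (simp add: has_field_derivative_def pder_def linear_cmul mult.commute[of _ "frechet_derivative g _ _"])
    qed
    \<comment> \<open>The square has corner \<open>x\<close> and side \<open>h\<close>; the bound 2h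
      < |x| keeps it off the origin, where nothing is known about \<open>f\<close>.\<close>
    have mv: "\<exists>u v. 0 < u \<and> u < h \<and> 0 < v \<and> v < h \<and>
        f (c k l h h) - f (c k l h 0) - f (c k l 0 h) + f (c k l 0 0) = h * h * pder l (pder k f) (c k l u v)"
      if h: "h > 0" "2 * h < norm x" for k l h
    proof -
      have nz: "c k l s t \<noteq> 0" if "0 \<le> s" "s \<le> h" "0 \<le> t" "t \<le> h" for s t
      proof
        assume "c k l s t = 0"
        then have "x = - (s *\<^sub>R axis k 1 + t *\<^sub>R axis l 1)"
          by (simp only: c_def add.assoc eq_neg_iff_add_eq_0)
        then have "norm x \<le> norm (s *\<^sub>R axis k (1::real)) + norm (t *\<^sub>R axis l (1::real))"
          by (metis norm_minus_cancel norm_triangle_ineq)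
        then show False using that h by (simp add: norm_axis_1)
      qed
      have 1: "((\<lambda>s. f (c k l s t)) has_real_derivative pder k f (c k l s t)) (at s)"
        if "0 \<le> s" "s \<le> h" "0 \<le> t" "t \<le> h" for s t
        using dline[OF f, of "x + t *\<^sub>R axis l 1" s k] nz[OF that] by (simp add: c_def algebra_simps)
      have 2: "((\<lambda>t. pder k f (c k l s t)) has_real_derivative pder l (pder k f) (c k l s t)) (at t)"
        if "0 \<le> s" "s \<le> h" "0 \<le> t" "t \<le> h" for s t
        using dline[OF smooth_punctured_pdf[OF f, of k], of "x + s *\<^sub>R axis k 1" t l] nz[OF that] by (simp add: c_def)
      have "\<exists>u>0. u < h \<and> (f (c k l h h) - f (c k l h 0)) - (f (c k l 0 h) - f (c k l 0 0)) =
          (h - 0) * (pder k f (c k l u h) - pder k f (c k l u 0))"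
        by (rule MVT2) (use h in \<open>auto intro!: DERIV_diff 1\<close>)
      then obtain u where u: "u > 0" "u < h" "(f (c k l h h) - f (c k l h 0)) - (f (c k l 0 h) - f (c k l 0 0)) =
          h * (pder k f (c k l u h) - pder k f (c k l u 0))" by auto
      have "\<exists>v>0. v < h \<and> pder k f (c k l u h) - pder k f (c k l u 0) = (h - 0) * pder l (pder k f) (c k l u v)"
        by (rule MVT2) (use h u in \<open>auto intro!: 2\<close>)
      then obtain v where "v > 0" "v < h" "pder k f (c k l u h) - pder k f (c k l u 0) = h * pder l (pder k f) (c k l u v)"
        by auto
      with u show ?thesis by (intro exI[of _ u] exI[of _ v]) simp
    qed
    have close: "dist (c k l u v) x < 2 * h" if "0 < u" "u < h" "0 < v" "v < h" for k l u v h
    proof -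
      have "dist (c k l u v) x = norm (u *\<^sub>R axis k (1::real) + v *\<^sub>R axis l (1::real))"
        by (simp add: c_def dist_norm add.assoc)
      also have "\<dots> \<le> norm (u *\<^sub>R axis k (1::real)) + norm (v *\<^sub>R axis l (1::real))"
        by (rule norm_triangle_ineq)
      finally show ?thesis using that by (simp add: norm_axis_1)
    qed
    have cont: "isCont (pder l (pder k f)) x" for k l
      using False by (intro differentiable_imp_continuous_within smooth_punctured_diff smooth_punctured_pdf f)
    show ?thesis
    proof (rule ccontr)
      assume ne: "pder i (pder j f) x \<noteq> pder j (pder i f) x"
      define e where "e = dist (pder i (pder j f) x) (pder j (pder i f) x) / 2"
      have e: "e > 0" using ne by (simp add: e_def)
      obtain d1 where d1: "d1 > 0" "\<And>y. dist y x < d1 \<Longrightarrow> dist (pder i (pder j f) y) (pder i (pder j f) x) < e"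
        using cont[of i j] e unfolding continuous_at_eps_delta by blast
      obtain d2 where d2: "d2 > 0" "\<And>y. dist y x < d2 \<Longrightarrow> dist (pder j (pder i f) y) (pder j (pder i f) x) < e"
        using cont[of j i] e unfolding continuous_at_eps_delta by blast
      define h where "h = min (min d1 d2) (norm x) / 3"
      have h: "h > 0" "2 * h < norm x" "2 * h < d1" "2 * h < d2"
        using d1 d2 False zero_less_norm_iff[of x] unfolding h_def by linarith+
      obtain u v where uv: "0 < u" "u < h" "0 < v" "v < h"
        "f (c i j h h) - f (c i j h 0) - f (c i j 0 h) + f (c i j 0 0) = h * h * pder j (pder i f) (c i j u v)"
        using mv[OF h(1,2), of i j] by blast
      obtain u' v' where uv': "0 < u'" "u' < h" "0 < v'" "v' < h"
        "f (c j i h h) - f (c j i h 0) - f (c j i 0 h) + f (c j i 0 0) = h * h * pder i (pder j f) (c j i u' v')"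
        using mv[OF h(1,2), of j i] by blast
      have swap: "c j i s t = c i j t s" for s t by (simp add: c_def algebra_simps)
      with uv(5) uv'(5) have "h * h * pder j (pder i f) (c i j u v) = h * h * pder i (pder j f) (c j i u' v')"
        unfolding swap by linarith
      then have "pder j (pder i f) (c i j u v) = pder i (pder j f) (c j i u' v')"
        using h(1) by simp
      moreover have "dist (pder j (pder i f) (c i j u v)) (pder j (pder i f) x) < e"
        by (rule d2(2)) (use close[OF uv(1-4), of i j] h in simp)
      moreover have "dist (pder i (pder j f) (c j i u' v')) (pder i (pder j f) x) < e"
        by (rule d1(2)) (use close[OF uv'(1-4), of j i] h in simp)
      ultimately show False
        using dist_triangle3[of "pder i (pder j f) x" "pder j (pder i f) x" "pder j (pder i f) (c i j u v)"]
        by (simp add: e_def)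
    qed
  qed simp
qed

section \<open>The ring of smooth functions on the punctured space\<close>

lemma smooth_punctured_const: "smooth_punctured (\<lambda>x. c)"
  by (rule smooth_gen_punctured[OF gen_const])

lemma smooth_punctured_add:
  "smooth_punctured f \<Longrightarrow> smooth_punctured g \<Longrightarrow> smooth_punctured (\<lambda>x. f x + g x)"
  by (rule smooth_gen_punctured[OF gen_add[OF gen_base gen_base]])

lemma smooth_punctured_mult:
  "smooth_punctured f \<Longrightarrow> smooth_punctured g \<Longrightarrow> smooth_punctured (\<lambda>x. f x * g x)"
  by (rule smooth_gen_punctured[OF gen_mult[OF gen_base gen_base]])

lemma smooth_punctured_cmult:
  "smooth_punctured f \<Longrightarrow> smooth_punctured (\<lambda>x. c * f x)"
  by (rule smooth_punctured_mult[OF smooth_punctured_const])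

lemma smooth_punctured_uminus: "smooth_punctured f \<Longrightarrow> smooth_punctured (\<lambda>x. - f x)"
  using smooth_punctured_cmult[of f "-1"] by simp

text \<open>
  Assigning the value \<open>0\<close> at the origin makes identities that hold on the punctured space genuine
  equalities, so that calculus becomes algebra in a commutative ring with derivations.
\<close>

typedef (overloaded) 'n pfun = "{f :: real^'n::finite \<Rightarrow> real. smooth_punctured f \<and> f 0 = 0}"
  by (rule exI[of _ "\<lambda>x. 0"]) (simp add: smooth_punctured_const)

setup_lifting type_definition_pfun

instantiation pfun :: (finite) comm_ring
begin

lift_definition zero_pfun :: "'a pfun" is "\<lambda>x. 0"
  by (simp add: smooth_punctured_const)

lift_definition plus_pfun :: "'a pfun \<Rightarrow> 'a pfun \<Rightarrow> 'a pfun" is "\<lambda>f g x. f x + g x"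
  by (simp add: smooth_punctured_add)

lift_definition times_pfun :: "'a pfun \<Rightarrow> 'a pfun \<Rightarrow> 'a pfun" is "\<lambda>f g x. f x * g x"
  by (simp add: smooth_punctured_mult)

lift_definition uminus_pfun :: "'a pfun \<Rightarrow> 'a pfun" is "\<lambda>f x. - f x"
  by (simp add: smooth_punctured_uminus)

definition minus_pfun :: "'a pfun \<Rightarrow> 'a pfun \<Rightarrow> 'a pfun" where
  "minus_pfun f g = f + - g"

instance
proof
  fix f g h :: "'a pfun"
  show "f + g + h = f + (g + h)" "f + g = g + f" "0 + f = f" "- f + f = 0"
    "f * g * h = f * (g * h)" "f * g = g * f" "(f + g) * h = f * h + g * h"
    by (transfer, simp add: algebra_simps)+
qed (rule minus_pfun_def)

end

instantiation pfun :: (finite) comm_ring_1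
begin

lift_definition one_pfun :: "'a pfun" is "\<lambda>x. of_bool (x \<noteq> 0)"
  using smooth_gen_punctured[OF gen_punct[OF gen_const[of 1]]] by auto

instance
proof
  show "1 * f = f" for f :: "'a pfun" by transfer auto
  have ax: "axis undefined 1 \<noteq> (0 :: real^'a)" by (simp add: axis_eq_0_iff)
  have "(\<lambda>x::real^'a. 0::real) \<noteq> (\<lambda>x. of_bool (x \<noteq> 0))"
    using ax by (auto dest: fun_cong[of _ _ "axis undefined 1"])
  then show "0 \<noteq> (1::'a pfun)" by transfer
qed

end

instantiation pfun :: (finite) real_algebra_1
begin

lift_definition scaleR_pfun :: "real \<Rightarrow> 'a pfun \<Rightarrow> 'a pfun" is "\<lambda>c f x. c * f x"
  by (simp add: smooth_punctured_cmult)

instance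
proof
  fix f g :: "'a pfun" and c d :: real
  show "c *\<^sub>R (f + g) = c *\<^sub>R f + c *\<^sub>R g" "(c + d) *\<^sub>R f = c *\<^sub>R f + d *\<^sub>R f"
    "c *\<^sub>R d *\<^sub>R f = (c * d) *\<^sub>R f" "1 *\<^sub>R f = f"
    "(c *\<^sub>R f) * g = c *\<^sub>R (f * g)" "f * (c *\<^sub>R g) = c *\<^sub>R (f * g)"
    by (transfer, simp add: algebra_simps)+
qed

end

lemmas Rep_pfun_simps = zero_pfun.rep_eq plus_pfun.rep_eq times_pfun.rep_eq uminus_pfun.rep_eq
  scaleR_pfun.rep_eq

lemma Rep_pfun_minus: "Rep_pfun (f - g) x = Rep_pfun f x - Rep_pfun g x"
  by (simp only: diff_conv_add_uminus Rep_pfun_simps)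

lemma Rep_pfun_one: "Rep_pfun 1 x = of_bool (x \<noteq> 0)"
  by transfer simp

lemma Rep_pfun_sum: "Rep_pfun (sum f A) x = (\<Sum>i\<in>A. Rep_pfun (f i) x)"
  by (induction A rule: infinite_finite_induct) (auto simp: Rep_pfun_simps)

lemma Rep_pfun_at_0 [simp]: "Rep_pfun f 0 = 0"
  using Rep_pfun[of f] by simp

lemma smooth_Rep_pfun: "smooth_punctured (Rep_pfun f)"
  using Rep_pfun[of f] by simp

lemma pfun_eqI: "(\<And>x. x \<noteq> 0 \<Longrightarrow> Rep_pfun f x = Rep_pfun g x) \<Longrightarrow> f = g"
  by (rule Rep_pfun_inject[THEN iffD1], rule ext, case_tac "x = 0") simp_all

lift_definition D :: "'n \<Rightarrow> 'n::finite pfun \<Rightarrow> 'n pfun" is pder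
  by (simp add: smooth_punctured_pdf)

lift_definition coord :: "'n \<Rightarrow> 'n::finite pfun" is "\<lambda>i x. x $ i"
  by (simp add: smooth_gen_punctured[OF gen_coord])

text \<open>Radial functions are parametrized by t = ln r, in which the Euler field is d/dt
  (\<open>euler_rad\<close>). The value is meaningful only when \<open>Abs_pfun\<close> is applied
  to a smooth function, hence the recurring assumption \<open>elem_smooth\<close>.\<close>

definition rad :: "(real \<Rightarrow> real) \<Rightarrow> 'n::finite pfun" where
  "rad \<phi> = Abs_pfun (\<lambda>x. of_bool (x \<noteq> 0) * \<phi> (ln (norm x)))"

lemma Rep_rad: "elem_smooth \<phi> \<Longrightarrow> Rep_pfun (rad \<phi>) x = of_bool (x \<noteq> 0) * \<phi> (ln (norm x))"
  unfolding rad_def by (subst Abs_pfun_inverse) (simp_all add: smooth_gen_punctured[OF gen_punct[OF gen_rad]])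

lemma D_add: "D i (f + g) = D i f + D i g"
  by transfer (simp add: pder_add smooth_punctured_diff)

lemma D_mult: "D i (f * g) = f * D i g + D i f * g"
  by transfer (simp add: pder_mult smooth_punctured_diff)

lemma D_scaleR: "D i (c *\<^sub>R f) = c *\<^sub>R D i f"
proof transfer
  fix i :: 'a and c and f :: "real^'a \<Rightarrow> real" assume "smooth_punctured f \<and> f 0 = 0"
  then show "pder i (\<lambda>x. c * f x) = (\<lambda>x. c * pder i f x)"
    by (subst pder_mult) (auto simp: smooth_punctured_diff pder_const)
qed

lemma D_zero: "D i 0 = 0"
  by transfer (simp add: pder_const)

lemma D_one: "D i 1 = 0"
  by transfer (subst pder_cong[of _ "\<lambda>x. 1"], auto simp: pder_const)

lemma D_coord: "D i (coord j) = of_bool (i = j)"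
  by (rule pfun_eqI) (auto simp: D.rep_eq coord.rep_eq pder_coord Rep_pfun_one Rep_pfun_simps)

lemma D_commute: "D i (D j f) = D j (D i f)"
  by transfer (simp add: pder_commute)

definition rpow :: "real \<Rightarrow> 'n::finite pfun" where
  "rpow c = rad (\<lambda>t. exp (c * t))"

lemma elem_rpow: "elem_smooth (\<lambda>t. exp (c * t))"
  by (intro elem_exp elem_mult elem_const elem_id)

lemma Rep_rpow: "Rep_pfun (rpow c) x = norm x powr c"
  by (cases "x = 0") (simp_all add: rpow_def Rep_rad elem_rpow powr_def)

lemma rpow_mult: "rpow c * rpow d = rpow (c + d)"
  by (rule pfun_eqI) (simp add: Rep_pfun_simps Rep_rpow powr_add)

lemma rpow_0: "rpow 0 = 1"
  by (rule pfun_eqI) (simp add: Rep_rpow Rep_pfun_one)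

lemma sum_coord_square: "(\<Sum>i\<in>UNIV. coord i * coord i) = rpow 2"
proof (rule pfun_eqI)
  fix x :: "real^'a" assume "x \<noteq> 0"
  then have "Rep_pfun (rpow 2) x = (norm x)\<^sup>2"
    by (simp add: Rep_rpow)
  also have "\<dots> = (\<Sum>i\<in>UNIV. x $ i * x $ i)"
    unfolding power2_norm_eq_inner inner_vec_def inner_real_def ..
  finally show "Rep_pfun (\<Sum>i\<in>UNIV. coord i * coord i) x = Rep_pfun (rpow 2) x"
    by (simp add: Rep_pfun_simps Rep_pfun_sum coord.rep_eq)
qed

lemma D_rad: "elem_smooth \<phi> \<Longrightarrow> D i (rad \<phi>) = rad (deriv \<phi>) * (coord i * rpow (-2))"
proof (rule pfun_eqI)
  fix x :: "real^'a" assume *: "elem_smooth \<phi>" "x \<noteq> 0"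
  have "Rep_pfun (D i (rad \<phi>)) x = pder i (\<lambda>x. \<phi> (ln (norm x))) x"
    unfolding D.rep_eq using * by (subst pder_cong[of _ "\<lambda>x. \<phi> (ln (norm x))"]) (simp_all add: Rep_rad)
  also have "\<dots> = Rep_pfun (rad (deriv \<phi>) * (coord i * rpow (-2))) x"
    using * by (simp add: pder_rad Rep_pfun_simps Rep_rad elem_smooth_deriv coord.rep_eq Rep_rpow powr_def)
  finally show "Rep_pfun (D i (rad \<phi>)) x = Rep_pfun (rad (deriv \<phi>) * (coord i * rpow (-2))) x" .
qed

lemma rad_scaleR: "elem_smooth \<phi> \<Longrightarrow> rad (\<lambda>t. c * \<phi> t) = c *\<^sub>R rad \<phi>"
  by (rule pfun_eqI) (simp add: Rep_rad elem_mult elem_const Rep_pfun_simps)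

lemma rad_mult: "elem_smooth \<phi> \<Longrightarrow> elem_smooth \<psi> \<Longrightarrow> rad (\<lambda>t. \<phi> t * \<psi> t) = rad \<phi> * rad \<psi>"
  by (rule pfun_eqI) (simp add: Rep_rad elem_mult Rep_pfun_simps)

lemma D_rpow: "D i (rpow c) = c *\<^sub>R (coord i * rpow (c - 2))"
proof -
  have d: "deriv (\<lambda>t. exp (c * t)) = (\<lambda>t. c * exp (c * t))"
    by (rule ext, rule DERIV_imp_deriv) (auto intro!: derivative_eq_intros)
  have "D i (rpow c) = c *\<^sub>R (coord i * (rpow c * rpow (-2)))"
    unfolding rpow_def[of c] D_rad[OF elem_rpow] d rad_scaleR[OF elem_rpow] by (simp add: mult_ac)
  then show ?thesis by (simp add: rpow_mult)
qed

section \<open>Euler field, rotations and the spherical Laplacian\<close>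

definition derivation :: "('a \<Rightarrow> 'a::real_algebra_1) \<Rightarrow> bool" where
  "derivation d \<longleftrightarrow> (\<forall>f g. d (f + g) = d f + d g) \<and> (\<forall>f g. d (f * g) = f * d g + d f * g)
     \<and> (\<forall>c f. d (c *\<^sub>R f) = c *\<^sub>R d f)"

lemma
  assumes "derivation d"
  shows derivation_add: "d (f + g) = d f + d g"
    and derivation_mult: "d (f * g) = f * d g + d f * g"
    and derivation_scaleR: "d (c *\<^sub>R f) = c *\<^sub>R d f"
    and derivation_zero: "d 0 = 0"
    and derivation_uminus: "d (- f) = - d f"
    and derivation_minus: "d (f - g) = d f - d g"
    and derivation_sum: "d (sum F A) = (\<Sum>i\<in>A. d (F i))"
proof -
  show *: "d (f + g) = d f + d g" "d (f * g) = f * d g + d f * g" "d (c *\<^sub>R f) = c *\<^sub>R d f" for f g c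
    using assms by (auto simp: derivation_def)
  show z: "d 0 = 0" using *(3)[of 0 0] by simp
  show u: "d (- f) = - d f" for f using *(3)[of "-1" f] by simp
  show "d (f - g) = d f - d g" using *(1)[of f "-g"] u[of g] by simp
  show "d (sum F A) = (\<Sum>i\<in>A. d (F i))"
    by (induction A rule: infinite_finite_induct) (auto simp: z *)
qed

lemmas derivation_simps = derivation_add derivation_mult derivation_scaleR derivation_zero
  derivation_uminus derivation_minus derivation_sum

lemma derivation_D: "derivation (D i)"
  by (simp add: derivation_def D_add D_mult D_scaleR)

lemmas D_simps = derivation_simps[OF derivation_D] D_coord D_rpow

definition euler :: "'n::finite pfun \<Rightarrow> 'n pfun" where
  "euler f = (\<Sum>i\<in>UNIV. coord i * D i f)"

definition rot :: "'n \<Rightarrow> 'n \<Rightarrow> 'n::finite pfun \<Rightarrow> 'n pfun" where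
  "rot i j f = coord i * D j f - coord j * D i f"

definition lap :: "'n::finite pfun \<Rightarrow> 'n pfun" where
  "lap f = (\<Sum>i\<in>UNIV. D i (D i f))"

text \<open>The sum runs over ordered pairs and meets every rotation plane twice, hence 1/2, here
  and in \<open>sph_energy\<close>. This is the Laplace-Beltrami operator of the unit sphere acting
  on each sphere |x| = r, without a factor r^(-2).\<close>

definition sph_lap :: "'n::finite pfun \<Rightarrow> 'n pfun" where
  "sph_lap f = (1/2) *\<^sub>R (\<Sum>i\<in>UNIV. \<Sum>j\<in>UNIV. rot i j (rot i j f))"

definition sph_energy :: "'n::finite pfun \<Rightarrow> 'n pfun" where
  "sph_energy f = (1/2) *\<^sub>R (\<Sum>i\<in>UNIV. \<Sum>j\<in>UNIV. rot i j f * rot i j f)"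

lemma derivation_euler: "derivation (euler :: 'n::finite pfun \<Rightarrow> 'n pfun)"
  by (simp add: derivation_def euler_def D_simps algebra_simps sum.distrib sum_distrib_left scaleR_sum_right)

lemma derivation_rot: "derivation (rot i j :: 'n::finite pfun \<Rightarrow> 'n pfun)"
  by (simp add: derivation_def rot_def D_simps algebra_simps)

lemmas euler_simps = derivation_simps[OF derivation_euler]
lemmas rot_simps = derivation_simps[OF derivation_rot]

lemma sum_of_bool_mult:
  fixes f :: "'n::finite \<Rightarrow> 'n pfun"
  shows "(\<Sum>k\<in>UNIV. of_bool (i = k) * f k) = f i" "(\<Sum>k\<in>UNIV. of_bool (k = i) * f k) = f i"
    "(\<Sum>k\<in>UNIV. f k * of_bool (i = k)) = f i" "(\<Sum>k\<in>UNIV. f k * of_bool (k = i)) = f i"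
  by (simp_all add: of_bool_def if_distrib[of "\<lambda>x. x * _"] if_distrib[of "\<lambda>x. _ * x"] cong: if_cong)

lemma euler_rad:
  assumes "elem_smooth \<phi>"
  shows "euler (rad \<phi> :: 'n::finite pfun) = rad (deriv \<phi>)"
proof -
  have "euler (rad \<phi> :: 'n::finite pfun) = (\<Sum>i\<in>UNIV. (rad (deriv \<phi>) * rpow (-2)) * (coord i * coord i))"
    unfolding euler_def by (intro sum.cong refl) (simp add: D_rad[OF assms] mult_ac)
  also have "\<dots> = rad (deriv \<phi>) * (rpow (-2) * rpow 2)"
    by (simp only: sum_distrib_left[symmetric] sum_coord_square mult.assoc)
  finally show ?thesis by (simp add: rpow_mult rpow_0)
qed

lemma rot_rad: "elem_smooth \<phi> \<Longrightarrow> rot i j (rad \<phi>) = 0"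
  by (simp add: rot_def D_rad mult_ac)

lemma rot_rpow: "rot i j (rpow c) = 0"
  unfolding rpow_def by (rule rot_rad[OF elem_rpow])

lemma euler_rpow: "euler (rpow c) = c *\<^sub>R rpow c"
proof -
  have "deriv (\<lambda>t. exp (c * t)) = (\<lambda>t. c * exp (c * t))"
    by (rule ext, rule DERIV_imp_deriv) (auto intro!: derivative_eq_intros)
  then show ?thesis unfolding rpow_def by (simp add: euler_rad elem_rpow rad_scaleR)
qed

lemma euler_coord: "euler (coord i) = coord i"
  by (simp add: euler_def D_simps sum_of_bool_mult)

lemma D_euler: "D j (euler f) = D j f + euler (D j f)"
  by (simp add: euler_def D_simps sum.distrib sum_of_bool_mult D_commute[of j])

lemma euler_rot: "euler (rot i j f) = rot i j (euler f)"
  by (simp add: rot_def euler_simps euler_coord D_euler algebra_simps)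

lemma euler_euler: "euler (euler f) = euler f + (\<Sum>i\<in>UNIV. \<Sum>j\<in>UNIV. coord i * coord j * D i (D j f))"
proof -
  have "euler (euler f) = euler f + (\<Sum>i\<in>UNIV. coord i * euler (D i f))"
    by (subst euler_def[of "euler f"]) (simp add: D_euler distrib_left sum.distrib, simp add: euler_def[of f])
  then show ?thesis
    by (simp add: euler_def[of "D _ f"] sum_distrib_left mult.assoc D_commute)
qed

text \<open>On the diagonal the field is zero, and the \<open>of_bool\<close> term is what cancels
  the first-order terms there; summed over all pairs it contributes 2E to
  \<open>sph_lap_eq\<close>.\<close>

lemma rot_rot:
  "rot i j (rot i j f) = 2 *\<^sub>R (of_bool (i = j) * (coord i * D j f)) + coord i * coord i * D j (D j f)
     + coord j * coord j * D i (D i f) - coord i * D i f - coord j * D j f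
     - 2 *\<^sub>R (coord i * coord j * D i (D j f))"
  by (cases "i = j")
     (simp_all add: rot_def D_simps D_commute[of j i] scaleR_2 algebra_simps)

text \<open>The polar form |x|^2 \<Delta> = E^2 + (n-2)E + \<Delta>_S, obtained purely by commuting
  derivatives with coordinates.\<close>

lemma sph_lap_eq:
  fixes f :: "'n::finite pfun"
  shows "sph_lap f = rpow 2 * lap f - euler (euler f) - (real CARD('n) - 2) *\<^sub>R euler f"
proof -
  have a: "(\<Sum>i\<in>UNIV. \<Sum>j\<in>UNIV. of_bool (i = j) * (coord i * D j f)) = euler f"
    by (simp add: sum_of_bool_mult euler_def)
  have b: "(\<Sum>i\<in>UNIV. \<Sum>j\<in>UNIV. coord i * coord i * D j (D j f)) = rpow 2 * lap f"
    by (simp add: lap_def sum_coord_square[symmetric] sum_product)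
  have b': "(\<Sum>i\<in>UNIV. \<Sum>j\<in>UNIV. coord j * coord j * D i (D i f)) = rpow 2 * lap f"
    by (subst sum.swap) (rule b)
  have c: "(\<Sum>i\<in>(UNIV::'n set). \<Sum>j\<in>(UNIV::'n set). coord j * D j f) = real CARD('n) *\<^sub>R euler f"
    by (simp add: euler_def scaleR_conv_of_real)
  have c': "(\<Sum>i\<in>(UNIV::'n set). \<Sum>j\<in>(UNIV::'n set). coord i * D i f) = real CARD('n) *\<^sub>R euler f"
    by (subst sum.swap) (rule c)
  have "(\<Sum>i\<in>UNIV. \<Sum>j\<in>UNIV. rot i j (rot i j f)) = 2 *\<^sub>R euler f + rpow 2 * lap f
     + rpow 2 * lap f - real CARD('n) *\<^sub>R euler f - real CARD('n) *\<^sub>R euler f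
     - 2 *\<^sub>R (\<Sum>i\<in>UNIV. \<Sum>j\<in>UNIV. coord i * coord j * D i (D j f))"
    unfolding rot_rot sum.distrib sum_subtractf scaleR_sum_right[symmetric] a b b' c c' by (rule refl)
  also have "\<dots> = 2 *\<^sub>R (rpow 2 * lap f - euler (euler f) - (real CARD('n) - 2) *\<^sub>R euler f)"
    unfolding euler_euler by (simp add: scaleR_conv_of_real algebra_simps)
  finally show ?thesis by (simp add: sph_lap_def)
qed

text \<open>Lagrange's identity for the vectors x and \<nabla>f: the rotational derivatives are the
  components of their exterior product.\<close>

lemma grad_square_eq:
  "rpow 2 * (\<Sum>i\<in>UNIV. D i f * D i f) = euler f * euler f + sph_energy f"
proof -
  have "(\<Sum>i\<in>UNIV. \<Sum>j\<in>UNIV. rot i j f * rot i j f) =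
     (\<Sum>i\<in>UNIV. \<Sum>j\<in>UNIV. coord i * coord i * (D j f * D j f)) + (\<Sum>i\<in>UNIV. \<Sum>j\<in>UNIV. coord j * coord j * (D i f * D i f))
      - 2 *\<^sub>R (\<Sum>i\<in>UNIV. \<Sum>j\<in>UNIV. (coord i * D i f) * (coord j * D j f))"
    unfolding scaleR_sum_right sum.distrib[symmetric] sum_subtractf[symmetric]
    by (intro sum.cong refl) (simp add: rot_def algebra_simps scaleR_2)
  also have "(\<Sum>i\<in>UNIV. \<Sum>j\<in>UNIV. coord j * coord j * (D i f * D i f)) = (\<Sum>i\<in>UNIV. \<Sum>j\<in>UNIV. coord i * coord i * (D j f * D j f))"
    by (rule sum.swap)
  also have "(\<Sum>i\<in>UNIV. \<Sum>j\<in>UNIV. coord i * coord i * (D j f * D j f)) = rpow 2 * (\<Sum>i\<in>UNIV. D i f * D i f)"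
    by (simp add: sum_product sum_coord_square[symmetric])
  also have "(\<Sum>i\<in>UNIV. \<Sum>j\<in>UNIV. (coord i * D i f) * (coord j * D j f)) = euler f * euler f"
    by (simp add: sum_product euler_def)
  also have "rpow 2 * (\<Sum>i\<in>UNIV. D i f * D i f) + rpow 2 * (\<Sum>i\<in>UNIV. D i f * D i f) - 2 *\<^sub>R (euler f * euler f)
      = 2 *\<^sub>R (rpow 2 * (\<Sum>i\<in>UNIV. D i f * D i f) - euler f * euler f)"
    by (simp add: scaleR_conv_of_real algebra_simps)
  finally show ?thesis by (simp add: sph_energy_def)
qed

lemma
  fixes f g :: "'a::finite pfun" and F :: "'b \<Rightarrow> 'a pfun"
  shows sph_lap_add: "sph_lap (f + g) = sph_lap f + sph_lap g"
    and sph_lap_scaleR: "sph_lap (c *\<^sub>R f) = c *\<^sub>R sph_lap f"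
    and sph_lap_zero: "sph_lap (0::'a pfun) = 0"
    and sph_lap_minus: "sph_lap (f - g) = sph_lap f - sph_lap g"
    and sph_lap_euler: "sph_lap (euler f) = euler (sph_lap f)"
    and sph_lap_sum: "sph_lap (sum F A) = (\<Sum>i\<in>A. sph_lap (F i))"
proof -
  show *: "sph_lap (f + g) = sph_lap f + sph_lap g" for f g :: "'a pfun"
    by (simp add: sph_lap_def rot_simps sum.distrib scaleR_right_distrib)
  show c: "sph_lap (c *\<^sub>R f) = c *\<^sub>R sph_lap f" for c and f :: "'a pfun"
    by (simp add: sph_lap_def rot_simps scaleR_sum_right scaleR_left_commute)
  show z: "sph_lap (0::'a pfun) = 0" using c[of 0 0] by simp
  show "sph_lap (f - g) = sph_lap f - sph_lap g"
    using *[of f "- g"] c[of "-1" g] by simp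
  show "sph_lap (euler f) = euler (sph_lap f)"
    by (simp add: sph_lap_def euler_simps euler_rot)
  show "sph_lap (sum F A) = (\<Sum>i\<in>A. sph_lap (F i))"
    by (induction A rule: infinite_finite_induct) (auto simp: z *)
qed

lemma sph_lap_rot_const:
  assumes "\<And>i j. rot i j r = 0"
  shows "sph_lap (r * f) = r * sph_lap f" "sph_energy (r * f) = r * r * sph_energy f"
  by (simp_all add: sph_lap_def sph_energy_def rot_simps assms sum_distrib_left mult_ac)

section \<open>Integration against the dilation invariant measure\<close>

lemma integrable_compact_support:
  fixes u :: "'a::euclidean_space \<Rightarrow> real"
  assumes "continuous_on UNIV u" "\<And>x. norm x > M \<Longrightarrow> u x = 0"
  shows "integrable lborel u"
proof -
  have "integrable lborel (\<lambda>x. indicator (cball 0 M) x *\<^sub>R u x)"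
    using assms(1) by (intro borel_integrable_compact) (auto intro: continuous_on_subset)
  also have "(\<lambda>x. indicator (cball 0 M) x *\<^sub>R u x) = u"
    using assms(2) by (force simp: indicator_def fun_eq_iff)
  finally show ?thesis .
qed

text \<open>By translation invariance every difference quotient of \<open>u\<close> has integral 0,
  and dominated convergence passes this on to the derivative.\<close>

lemma integral_directional_derivative:
  fixes u u' :: "'a::euclidean_space \<Rightarrow> real"
  assumes cont: "continuous_on UNIV u" "continuous_on UNIV u'"
    and supp: "\<And>x. norm x > M \<Longrightarrow> u x = 0" "\<And>x. norm x > M \<Longrightarrow> u' x = 0"
    and der: "\<And>x s. ((\<lambda>s. u (x + s *\<^sub>R e)) has_real_derivative u' (x + s *\<^sub>R e)) (at s)"
  shows "integral\<^sup>L lborel u' = 0"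
proof -
  \<comment> \<open>Steps of length at most |e| keep the quotients supported in the ball of radius M
    + |e|; the intermediate points of the mean value theorem then lie in the ball of radius M +
    2|e|, where \<open>B\<close> bounds the derivative.\<close>
  define q where "q k x = (u (x + (1 / real (Suc k)) *\<^sub>R e) - u x) * real (Suc k)" for k :: nat and x
  have int: "integrable lborel u" using integrable_compact_support[OF cont(1) supp(1)] .
  have meas: "u \<in> borel_measurable borel" "u' \<in> borel_measurable borel"
    using cont by (auto intro: borel_measurable_continuous_onI)
  have "bounded (u' ` cball 0 (M + 2 * norm e))"
    using cont(2) by (intro compact_imp_bounded compact_continuous_image) (auto intro: continuous_on_subset)
  then obtain B where "B > 0" and B: "\<And>x. norm x \<le> M + 2 * norm e \<Longrightarrow> \<bar>u' x\<bar> \<le> B"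
    unfolding bounded_pos by auto
  have bound: "\<bar>q k x\<bar> \<le> B * indicator (cball 0 (M + norm e)) x" for k x
  proof -
    define h where "h = 1 / real (Suc k)"
    have h: "0 < h" "h \<le> 1" by (auto simp: h_def)
    have he: "norm (t *\<^sub>R e) \<le> norm e" if "0 \<le> t" "t \<le> h" for t
      using that h by (simp add: mult_left_le_one_le)
    show ?thesis
    proof (cases "norm x \<le> M + norm e")
      case True
      have "\<exists>z>0. z < h \<and> u (x + h *\<^sub>R e) - u (x + 0 *\<^sub>R e) = (h - 0) * u' (x + z *\<^sub>R e)"
        by (rule MVT2) (use h der in auto)
      then obtain z where z: "0 < z" "z < h" "u (x + h *\<^sub>R e) - u x = h * u' (x + z *\<^sub>R e)" by auto
      have "norm (x + z *\<^sub>R e) \<le> M + 2 * norm e"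
        using norm_triangle_ineq[of x "z *\<^sub>R e"] he[of z] z True by simp
      then have "\<bar>u' (x + z *\<^sub>R e)\<bar> \<le> B" by (rule B)
      moreover have "q k x = u' (x + z *\<^sub>R e)"
        using z(3) by (simp add: q_def h_def field_simps del: of_nat_Suc)
      ultimately show ?thesis using True by simp
    next
      case False
      have "norm x \<le> norm (x + h *\<^sub>R e) + norm (h *\<^sub>R e)"
        using norm_triangle_ineq4[of "x + h *\<^sub>R e" "h *\<^sub>R e"] by simp
      then have "norm (x + h *\<^sub>R e) > M" using False he[of h] h by simp
      moreover have "norm x > M" using False norm_ge_zero[of e] by linarith
      ultimately have "q k x = 0"
        unfolding q_def h_def[symmetric] by (simp add: supp)
      then show ?thesis using \<open>B > 0\<close> by simp
    qed
  qed
  have lim: "(\<lambda>k. q k x) \<longlonglongrightarrow> u' x" for x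
  proof -
    have "((\<lambda>h. (u (x + h *\<^sub>R e) - u x) / h) \<longlongrightarrow> u' x) (at 0)"
      using der[of x 0] by (simp add: DERIV_def)
    moreover have "filterlim (\<lambda>k. 1 / real (Suc k)) (at 0) sequentially"
      using LIMSEQ_inverse_real_of_nat by (auto simp: filterlim_at inverse_eq_divide)
    ultimately have "(\<lambda>k. (u (x + (1 / real (Suc k)) *\<^sub>R e) - u x) / (1 / real (Suc k))) \<longlonglongrightarrow> u' x"
      by (rule filterlim_compose)
    then show ?thesis by (simp add: q_def)
  qed
  have "integral\<^sup>L lborel (q k) = 0" for k
  proof -
    define c where "c = (1 / real (Suc k)) *\<^sub>R e"
    have d: "integral\<^sup>L lborel (\<lambda>x. u (x + c)) = integral\<^sup>L lborel u"
      using integral_distr[of "(+) c" lborel borel u] meas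
      by (simp add: lborel_distr_plus add.commute)
    have i: "integrable lborel (\<lambda>x. u (x + c))"
      using integrable_distr[of "(+) c" lborel borel u] int
      by (simp add: lborel_distr_plus add.commute)
    show ?thesis
      unfolding q_def[abs_def] c_def[symmetric] using i int d by simp
  qed
  moreover have "(\<lambda>k. integral\<^sup>L lborel (q k)) \<longlonglongrightarrow> integral\<^sup>L lborel u'"
  proof (rule integral_dominated_convergence[where w="\<lambda>x. B * indicator (cball 0 (M + norm e)) x"])
    show "integrable lborel (\<lambda>x. B * indicator (cball 0 (M + norm e)) (x::'a))"
      using emeasure_lborel_cball_finite[of 0 "M + norm e"]
      by (intro integrable_mult_right integrable_real_indicator) auto
    have "continuous_on UNIV (\<lambda>x. (u (x + (1 / real (Suc k)) *\<^sub>R e) - u x) * real (Suc k))" for k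
      by (intro continuous_on_mult continuous_on_diff continuous_on_compose2[OF cont(1)] cont(1)
          continuous_on_add continuous_on_const continuous_on_id) auto
    then show "q k \<in> borel_measurable lborel" for k
      unfolding q_def[abs_def] by (simp add: borel_measurable_continuous_onI)
    show "u' \<in> borel_measurable lborel" using meas(2) by simp
    show "AE x in lborel. (\<lambda>k. q k x) \<longlonglongrightarrow> u' x" using lim by (intro AE_I2)
    show "AE x in lborel. norm (q k x) \<le> B * indicator (cball 0 (M + norm e)) x" for k
      using bound[of k] by (intro AE_I2) (simp only: real_norm_def)
  qed
  ultimately have "(\<lambda>k::nat. 0) \<longlonglongrightarrow> integral\<^sup>L lborel u'" by simp
  then show ?thesis by (simp add: LIMSEQ_const_iff)
qed

section \<open>Functions supported in an annulus\<close>

text \<open>Vanishing near the origin makes the prescribed value 0 there harmless: such elements are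
  differentiable and integrable on the whole space, and the ring operations and derivations preserve
  the property.\<close>

definition annular :: "'n::finite pfun \<Rightarrow> bool" where
  "annular f \<longleftrightarrow> (\<exists>m M. 0 < m \<and> (\<forall>x. Rep_pfun f x \<noteq> 0 \<longrightarrow> m \<le> norm x \<and> norm x \<le> M))"

lemma annularE:
  assumes "annular f"
  obtains m M where "0 < m" "m < M" "\<And>x. Rep_pfun f x \<noteq> 0 \<Longrightarrow> m \<le> norm x \<and> norm x \<le> M"
proof -
  obtain m M where *: "0 < m" "\<And>x. Rep_pfun f x \<noteq> 0 \<Longrightarrow> m \<le> norm x \<and> norm x \<le> M"
    using assms by (auto simp: annular_def)
  show thesis by (rule that[of m "max M (m + 1)"]) (use * in \<open>force+\<close>)
qed

lemma annular_mult: "annular f \<Longrightarrow> annular (f * g)" "annular f \<Longrightarrow> annular (g * f)"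
  by (auto simp: annular_def Rep_pfun_simps)

lemma annular_add:
  assumes "annular f" "annular g" shows "annular (f + g)"
proof -
  obtain m M where *: "0 < m" "\<And>x. Rep_pfun f x \<noteq> 0 \<Longrightarrow> m \<le> norm x \<and> norm x \<le> M"
    using assms by (auto simp: annular_def)
  obtain m' M' where **: "0 < m'" "\<And>x. Rep_pfun g x \<noteq> 0 \<Longrightarrow> m' \<le> norm x \<and> norm x \<le> M'"
    using assms by (auto simp: annular_def)
  show ?thesis unfolding annular_def
  proof (intro exI conjI allI impI)
    show "0 < min m m'" using * ** by simp
    fix x assume "Rep_pfun (f + g) x \<noteq> 0"
    then have "Rep_pfun f x \<noteq> 0 \<or> Rep_pfun g x \<noteq> 0" by (auto simp: Rep_pfun_simps)
    then show "min m m' \<le> norm x" "norm x \<le> max M M'" using *(2)[of x] **(2)[of x] by auto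
  qed
qed

lemma annular_zero: "annular 0"
  by (auto simp: annular_def Rep_pfun_simps intro: exI[of _ 1])

lemma annular_scaleR: "annular f \<Longrightarrow> annular (c *\<^sub>R f)"
  by (auto simp: annular_def Rep_pfun_simps)

lemma annular_uminus: "annular f \<Longrightarrow> annular (- f)"
  by (auto simp: annular_def Rep_pfun_simps)

lemma annular_minus: "annular f \<Longrightarrow> annular g \<Longrightarrow> annular (f - g)"
  using annular_add[of f "- g"] annular_uminus[of g] by simp

lemma annular_sum: "(\<And>i. i \<in> A \<Longrightarrow> annular (F i)) \<Longrightarrow> annular (sum F A)"
  by (induction A rule: infinite_finite_induct) (auto intro: annular_zero annular_add)

lemma Rep_D_eq_0:
  assumes "open U" "x \<in> U" "\<And>y. y \<in> U \<Longrightarrow> Rep_pfun f y = 0"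
  shows "Rep_pfun (D i f) x = 0"
proof (cases "x = 0")
  case False
  have "(Rep_pfun f has_derivative (\<lambda>_. 0)) (at x)"
    by (rule has_derivative_transform_within_open[of "\<lambda>_. 0", OF has_derivative_const assms(1,2)])
       (use assms in simp)
  then show ?thesis using False by (simp add: D.rep_eq pder_eq)
qed simp

lemma Rep_D_eq_0_outside:
  fixes x :: "real^'a::finite"
  assumes "\<And>x. Rep_pfun f x \<noteq> 0 \<Longrightarrow> m \<le> norm x \<and> norm x \<le> M" "Rep_pfun (D i f) x \<noteq> 0"
  shows "m \<le> norm x \<and> norm x \<le> M"
proof (rule ccontr)
  assume *: "\<not> (m \<le> norm x \<and> norm x \<le> M)"
  define U where "U = {y::real^'a. norm y < m} \<union> {y. norm y > M}"
  have "open U" unfolding U_def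
    by (intro open_Un open_Collect_less continuous_intros)
  moreover have "x \<in> U" using * by (auto simp: U_def)
  moreover have "Rep_pfun f y = 0" if "y \<in> U" for y
    using assms(1)[of y] that unfolding U_def by fastforce
  ultimately show False using Rep_D_eq_0[of U x f i] assms(2) by blast
qed

lemma annular_D: "annular f \<Longrightarrow> annular (D i f)"
  unfolding annular_def using Rep_D_eq_0_outside by meson

lemma annular_euler: "annular f \<Longrightarrow> annular (euler f)"
  unfolding euler_def by (intro annular_sum annular_mult annular_D)

lemma annular_rot: "annular f \<Longrightarrow> annular (rot i j f)"
  unfolding rot_def by (intro annular_minus annular_mult annular_D)

lemma annular_sph_lap: "annular f \<Longrightarrow> annular (sph_lap f)"
  unfolding sph_lap_def by (intro annular_scaleR annular_sum annular_rot)

lemma annular_sph_energy: "annular f \<Longrightarrow> annular (sph_energy f)"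
  unfolding sph_energy_def by (intro annular_scaleR annular_sum annular_mult annular_rot)

lemmas annular_intros = annular_add annular_minus annular_uminus annular_scaleR annular_zero
  annular_sum annular_D annular_euler annular_rot annular_sph_lap annular_sph_energy

lemma annular_continuous:
  assumes "annular f"
  shows "continuous_on UNIV (Rep_pfun f)"
proof -
  obtain m M where *: "0 < m" "\<And>x. Rep_pfun f x \<noteq> 0 \<Longrightarrow> m \<le> norm x \<and> norm x \<le> M"
    using annularE[OF assms] by metis
  have "continuous_on (ball 0 m) (Rep_pfun f)"
    using *(2) by (subst continuous_on_cong[OF refl, of _ _ "\<lambda>_. 0"]) (auto simp: not_le[symmetric])
  then have "continuous_on (ball 0 m \<union> -{0}) (Rep_pfun f)"
    using smooth_punctured_continuous[OF smooth_Rep_pfun] by (intro continuous_on_open_Un) auto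
  also have "ball 0 m \<union> -{0} = (UNIV :: (real^'a) set)" using * by auto
  finally show ?thesis .
qed

lemma annular_integrable: "annular f \<Longrightarrow> integrable lborel (Rep_pfun f)"
  by (erule annularE, rule integrable_compact_support[OF annular_continuous])
     (auto simp: annular_def not_le[symmetric])

lemma annular_has_derivative:
  fixes f :: "'n::finite pfun"
  assumes "annular f"
  shows "(Rep_pfun f has_derivative (\<lambda>h. \<Sum>i\<in>UNIV. h $ i * Rep_pfun (D i f) x)) (at x)"
proof (cases "x = 0")
  case True
  obtain m M where *: "0 < m" "\<And>x. Rep_pfun f x \<noteq> 0 \<Longrightarrow> m \<le> norm x \<and> norm x \<le> M"
    using annularE[OF assms] by metis
  have "(Rep_pfun f has_derivative (\<lambda>_. 0)) (at x)"
    by (rule has_derivative_transform_within_open[of "\<lambda>_. 0" _ _ _ "ball 0 m", OF has_derivative_const])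
       (use * True in force)+
  then show ?thesis using True by simp
next
  case False
  define T where "T = frechet_derivative (Rep_pfun f) (at x)"
  have T: "(Rep_pfun f has_derivative T) (at x)"
    using smooth_punctured_diff[OF smooth_Rep_pfun False] by (simp add: T_def frechet_derivative_works)
  have "T h = (\<Sum>i\<in>UNIV. h $ i * Rep_pfun (D i f) x)" for h
  proof -
    have "T h = T (\<Sum>i\<in>UNIV. (h $ i) *\<^sub>R axis i 1)"
      using basis_expansion[of h] by (simp add: scalar_mult_eq_scaleR)
    also have "\<dots> = (\<Sum>i\<in>UNIV. (h $ i) *\<^sub>R T (axis i 1))"
      using has_derivative_linear[OF T] by (simp add: linear_sum linear_cmul)
    finally show ?thesis using False by (simp add: D.rep_eq pder_def T_def)
  qed
  then show ?thesis using T by presburger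
qed

lemma annular_integral_D:
  fixes f :: "'n::finite pfun"
  assumes "annular f"
  shows "integral\<^sup>L lborel (Rep_pfun (D i f)) = 0"
proof -
  obtain m M where *: "0 < m" "\<And>x. Rep_pfun f x \<noteq> 0 \<Longrightarrow> m \<le> norm x \<and> norm x \<le> M"
    using annularE[OF assms] by metis
  show ?thesis
  proof (rule integral_directional_derivative[where u="Rep_pfun f" and e="axis i 1" and M=M])
    show "Rep_pfun f x = 0" "Rep_pfun (D i f) x = 0" if "M < norm x" for x
      using that *(2)[of x] Rep_D_eq_0_outside[OF *(2), where i=i and x=x] by auto
    fix x :: "real^'n" and s :: real
    have "((\<lambda>s. x + s *\<^sub>R axis i 1) has_derivative (\<lambda>h. h *\<^sub>R axis i 1)) (at s)"
      by (auto intro!: derivative_eq_intros)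
    then have "((\<lambda>s. Rep_pfun f (x + s *\<^sub>R axis i 1)) has_derivative
        (\<lambda>h. \<Sum>k\<in>UNIV. (h *\<^sub>R axis i 1) $ k * Rep_pfun (D k f) (x + s *\<^sub>R axis i 1))) (at s)"
      using has_derivative_compose[of "\<lambda>s. x + s *\<^sub>R axis i 1" "\<lambda>h. h *\<^sub>R axis i 1" s UNIV "Rep_pfun f"]
        annular_has_derivative[OF assms] by blast
    also have "(\<lambda>h. \<Sum>k\<in>UNIV. (h *\<^sub>R axis i 1) $ k * Rep_pfun (D k f) (x + s *\<^sub>R axis i 1))
        = (*) (Rep_pfun (D i f) (x + s *\<^sub>R axis i 1))"
      by (rule ext) (simp add: axis_def if_distrib[of "\<lambda>y. y * _"] if_distrib[of "\<lambda>y. _ * y"] cong: if_cong)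
    finally show "((\<lambda>s. Rep_pfun f (x + s *\<^sub>R axis i 1)) has_real_derivative
        Rep_pfun (D i f) (x + s *\<^sub>R axis i 1)) (at s)"
      unfolding has_field_derivative_def .
  qed (use assms in \<open>auto intro: annular_continuous annular_D\<close>)
qed

text \<open>The measure |x|^(-n) dx is, in polar coordinates, dt times surface measure with t = ln
  r, invariant under dilations and rotations.\<close>

definition I :: "'n::finite pfun \<Rightarrow> real" where
  "I f = integral\<^sup>L lborel (Rep_pfun (rpow (- real CARD('n)) * f))"

lemma I_add: "annular f \<Longrightarrow> annular g \<Longrightarrow> I (f + g) = I f + I g"
  unfolding I_def distrib_left plus_pfun.rep_eq
  by (intro Bochner_Integration.integral_add annular_integrable annular_mult)

lemma I_scaleR: "I (c *\<^sub>R f) = c * I f"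
  unfolding I_def by (simp add: scaleR_pfun.rep_eq)

lemma I_uminus: "I (- f) = - I f"
  using I_scaleR[of "-1" f] by simp

lemma I_minus: "annular f \<Longrightarrow> annular g \<Longrightarrow> I (f - g) = I f - I g"
  using I_add[of f "-g"] I_uminus[of g] annular_uminus[of g] by simp

lemma I_zero: "I 0 = 0"
  by (simp add: I_def zero_pfun.rep_eq)

lemma I_sum: "(\<And>i. i \<in> A \<Longrightarrow> annular (F i)) \<Longrightarrow> I (sum F A) = (\<Sum>i\<in>A. I (F i))"
  by (induction A rule: infinite_finite_induct) (auto simp: I_zero I_add annular_sum)

lemma I_nonneg: "(\<And>x. Rep_pfun f x \<ge> 0) \<Longrightarrow> I f \<ge> 0"
  unfolding I_def by (intro integral_nonneg_AE AE_I2) (simp add: Rep_pfun_simps Rep_rpow)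

lemma I_square_nonneg: "I (f * f) \<ge> 0"
  by (rule I_nonneg) (simp add: Rep_pfun_simps)

lemma I_mono:
  "annular f \<Longrightarrow> annular g \<Longrightarrow> (\<And>x. Rep_pfun f x \<le> Rep_pfun g x) \<Longrightarrow> I f \<le> I g"
  using I_nonneg[of "g - f"] I_minus[of g f] by (simp add: Rep_pfun_minus)

text \<open>The field |x|^(-n) x is divergence free off the origin, so the integrand is the
  divergence of \<open>f\<close> times this field.\<close>

lemma I_euler:
  fixes f :: "'n::finite pfun"
  assumes "annular f" shows "I (euler f) = 0"
proof -
  let ?n = "real CARD('n)"
  have "rpow (- ?n) * euler f = (\<Sum>i\<in>UNIV. D i (coord i * rpow (- ?n) * f))"
  proof -
    have "(\<Sum>i\<in>UNIV. D i (coord i * rpow (- ?n) * f)) =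
        (\<Sum>i\<in>(UNIV::'n set). rpow (- ?n) * f) + (\<Sum>i\<in>UNIV. coord i * coord i) * ((- ?n) *\<^sub>R (rpow (- ?n - 2) * f))
         + rpow (- ?n) * euler f"
      by (simp add: euler_def D_simps algebra_simps sum.distrib sum_distrib_left sum_distrib_right
          scaleR_sum_right sum_subtractf)
    also have "(\<Sum>i\<in>UNIV. coord i * coord i) * ((- ?n) *\<^sub>R (rpow (- ?n - 2) * f)) = (- ?n) *\<^sub>R (rpow (- ?n) * f)"
      unfolding sum_coord_square by (simp add: mult.assoc[symmetric] rpow_mult)
    finally show ?thesis by (simp add: scaleR_conv_of_real)
  qed
  then have "I (euler f) = (\<Sum>i\<in>UNIV. integral\<^sup>L lborel (Rep_pfun (D i (coord i * rpow (- ?n) * f))))"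
    unfolding I_def by (simp only: ext[OF Rep_pfun_sum])
       (intro Bochner_Integration.integral_sum annular_integrable annular_D annular_mult assms)
  then show ?thesis
    using assms by (simp add: annular_integral_D annular_mult)
qed

lemma I_rot:
  fixes f :: "'n::finite pfun"
  assumes "annular f" shows "I (rot i j f) = 0"
proof -
  let ?n = "real CARD('n)"
  have "rpow (- ?n) * rot i j f = D j (coord i * rpow (- ?n) * f) - D i (coord j * rpow (- ?n) * f)"
    by (simp add: rot_def D_simps algebra_simps)
  then have "I (rot i j f) = integral\<^sup>L lborel (Rep_pfun (D j (coord i * rpow (- ?n) * f)))
     - integral\<^sup>L lborel (Rep_pfun (D i (coord j * rpow (- ?n) * f)))"
    unfolding I_def by (simp only: ext[OF Rep_pfun_minus])
       (intro Bochner_Integration.integral_diff annular_integrable annular_D annular_mult assms)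
  then show ?thesis
    using assms by (simp add: annular_integral_D annular_mult)
qed

section \<open>Factorization and Hardy inequalities\<close>

lemma I_euler_by_parts:
  assumes "annular f" shows "I (euler f * g) = - I (f * euler g)"
proof -
  have "I (f * euler g + euler f * g) = 0"
    using I_euler[of "f * g"] assms by (simp add: euler_simps annular_mult)
  then show ?thesis using assms by (simp add: I_add annular_mult annular_intros)
qed

lemma I_rot_by_parts:
  assumes "annular f" shows "I (rot i j f * g) = - I (f * rot i j g)"
proof -
  have "I (f * rot i j g + rot i j f * g) = 0"
    using I_rot[of "f * g"] assms by (simp add: rot_simps annular_mult)
  then show ?thesis using assms by (simp add: I_add annular_mult annular_intros)
qed

lemma I_sph_lap:
  assumes "annular f"
  shows "I (f * sph_lap g) = - (1/2) * (\<Sum>i\<in>UNIV. \<Sum>j\<in>UNIV. I (rot i j f * rot i j g))"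
proof -
  have "I (f * sph_lap g) = (1/2) * (\<Sum>i\<in>UNIV. \<Sum>j\<in>UNIV. I (f * rot i j (rot i j g)))"
    using assms by (simp add: sph_lap_def sum_distrib_left I_scaleR I_sum annular_sum annular_mult)
  then show ?thesis using assms by (simp add: I_rot_by_parts sum_negf)
qed

lemma I_sph_lap_sym: "annular f \<Longrightarrow> I (f * sph_lap g) = I (sph_lap f * g)"
proof -
  assume f: "annular f"
  have "I (sph_lap f * g) = (1/2) * (\<Sum>i\<in>UNIV. \<Sum>j\<in>UNIV. I (rot i j (rot i j f) * g))"
    using f by (simp add: sph_lap_def sum_distrib_right I_scaleR I_sum annular_sum annular_mult annular_intros)
  then show ?thesis using f by (simp add: I_rot_by_parts I_sph_lap annular_rot sum_negf)
qed

lemma I_sph_energy: "annular f \<Longrightarrow> I (sph_energy f) = - I (f * sph_lap f)"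
  by (simp add: I_sph_lap sph_energy_def I_scaleR I_sum annular_sum annular_mult annular_rot)

text \<open>L is (E + a)(E + b)g + \<Delta>_S g. After expanding the square, the pairings of g with
  Eg, of Eg with E^2 g and of Eg with \<Delta>_S g vanish. The pairing of g with E^2 g is minus the
  norm of Eg, which reduces (a + b)^2 to a^2 + b^2, and the pairing of E^2 g with \<Delta>_S g is
  the spherical energy of Eg.\<close>

lemma hardy_factorization:
  assumes "annular g" and h: "h = euler g + a *\<^sub>R g" and
    L: "L = euler (euler g) + (a + b) *\<^sub>R euler g + (a * b) *\<^sub>R g + sph_lap g"
  shows "I (L * L) = I (euler h * euler h) + 2 * I (sph_energy (euler g)) + b\<^sup>2 * I (euler g * euler g)
     + I (((a * b) *\<^sub>R g + sph_lap g) * ((a * b) *\<^sub>R g + sph_lap g))"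
proof -
  define e where "e = euler g"
  define c where "c = euler e"
  define s where "s = sph_lap g"
  have ann: "annular g" "annular e" "annular c" "annular s"
    using assms(1) by (auto simp: e_def c_def s_def intro: annular_intros)
  have ge: "I (g * e) = 0"
    using I_euler_by_parts[of g g] ann by (simp add: e_def mult.commute)
  have ec: "I (e * c) = 0"
    using I_euler_by_parts[of e e] ann by (simp add: c_def mult.commute)
  have gc: "I (g * c) = - I (e * e)"
    using I_euler_by_parts[of g e] ann by (simp add: c_def e_def)
  \<comment> \<open>E is antisymmetric, \<Delta>_S is symmetric and the two commute, so the pairing
    equals its own negative.\<close>
  have es: "I (e * s) = 0"
  proof -
    have "I (e * s) = - I (g * sph_lap e)"
      using I_euler_by_parts[of g s] ann by (simp add: e_def s_def sph_lap_euler)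
    also have "\<dots> = - I (e * s)"
      using I_sph_lap_sym[of g e] ann by (simp add: s_def mult.commute)
    finally show ?thesis by simp
  qed
  have cs: "I (c * s) = I (sph_energy e)"
    using I_euler_by_parts[of e s] ann by (simp add: c_def e_def s_def sph_lap_euler I_sph_energy)
  have LL: "L * L = c * c + (a + b)\<^sup>2 *\<^sub>R (e * e) + (a * b)\<^sup>2 *\<^sub>R (g * g) + s * s
      + (2 * (a + b)) *\<^sub>R (e * c) + (2 * (a * b)) *\<^sub>R (g * c) + 2 *\<^sub>R (c * s)
      + (2 * (a + b) * (a * b)) *\<^sub>R (g * e) + (2 * (a + b)) *\<^sub>R (e * s) + (2 * (a * b)) *\<^sub>R (g * s)"
    unfolding L e_def[symmetric] c_def[symmetric] s_def[symmetric]
    by (simp add: scaleR_conv_of_real algebra_simps power2_eq_square)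
  have hh: "euler h * euler h = c * c + (2 * a) *\<^sub>R (e * c) + a\<^sup>2 *\<^sub>R (e * e)"
    unfolding h by (simp add: euler_simps e_def[symmetric] c_def[symmetric])
       (simp add: scaleR_conv_of_real algebra_simps power2_eq_square)
  have gs: "((a * b) *\<^sub>R g + s) * ((a * b) *\<^sub>R g + s) = (a * b)\<^sup>2 *\<^sub>R (g * g) + (2 * (a * b)) *\<^sub>R (g * s) + s * s"
    by (simp add: scaleR_conv_of_real algebra_simps power2_eq_square)
  note lin = I_add I_scaleR annular_mult annular_add annular_scaleR ann ge ec gc es cs
  have "I (L * L) = I (c * c) + (a\<^sup>2 + b\<^sup>2) * I (e * e) + (a * b)\<^sup>2 * I (g * g) + I (s * s)
     + 2 * I (sph_energy e) + 2 * (a * b) * I (g * s)"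
    unfolding LL by (simp add: lin) (simp add: algebra_simps power2_eq_square)
  moreover have "I (euler h * euler h) = I (c * c) + a\<^sup>2 * I (e * e)"
    unfolding hh by (simp add: lin)
  moreover have "I (((a * b) *\<^sub>R g + s) * ((a * b) *\<^sub>R g + s)) =
      (a * b)\<^sup>2 * I (g * g) + 2 * (a * b) * I (g * s) + I (s * s)"
    unfolding gs by (simp add: lin)
  ultimately show ?thesis
    unfolding e_def[symmetric] s_def[symmetric] by (simp add: algebra_simps)
qed

text \<open>The condition on \<open>a\<close> says \<gamma> + n - 4 + 2a = 0, so both integrals lose
  their power weight. Conjugation by |x|^a replaces E by E + a, and |x|^2 \<Delta> f = |x|^a
  L.\<close>

lemma power_substitution:
  fixes f g :: "'n::finite pfun"
  assumes f: "f = rpow a * g" and a: "2 * a = 4 - real CARD('n) - \<gamma>" and b: "b = a + real CARD('n) - 2"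
    and h: "h = euler g + a *\<^sub>R g"
    and L: "L = euler (euler g) + (a + b) *\<^sub>R euler g + (a * b) *\<^sub>R g + sph_lap g"
  shows "rpow (\<gamma> + real CARD('n)) * (lap f * lap f) = L * L"
    and "rpow (\<gamma> - 2 + real CARD('n)) * (\<Sum>i\<in>UNIV. D i f * D i f) = h * h + sph_energy g"
    and "rpow (\<gamma> - 4 + real CARD('n)) * sph_energy f = sph_energy g"
proof -
  let ?n = "real CARD('n)"
  have ef: "euler f = rpow a * h"
    by (simp add: f h euler_simps euler_rpow algebra_simps)
  have sf: "sph_lap f = rpow a * sph_lap g" and enf: "sph_energy f = rpow a * rpow a * sph_energy g"
    unfolding f by (simp_all add: sph_lap_rot_const rot_rpow)
  have "euler (euler f) = rpow a * (euler h + a *\<^sub>R h)"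
    unfolding ef by (simp add: euler_simps euler_rpow algebra_simps)
  then have "rpow 2 * lap f = rpow a * (euler h + a *\<^sub>R h) + (?n - 2) *\<^sub>R (rpow a * h) + rpow a * sph_lap g"
    using sph_lap_eq[of f] by (simp add: sf ef algebra_simps)
  also have "\<dots> = rpow a * L"
    unfolding L h b by (simp add: euler_simps) (simp add: scaleR_conv_of_real algebra_simps)
  finally have lf: "rpow 2 * lap f = rpow a * L" .
  have g: "\<gamma> = 4 - ?n - 2 * a" using a by linarith
  have r: "rpow (\<gamma> + ?n) = rpow (- 2 * a) * (rpow 2 * rpow 2)" "rpow (- 2 * a) * (rpow a * rpow a) = 1"
    "rpow (\<gamma> - 2 + ?n) = rpow (- 2 * a) * rpow 2" "rpow (\<gamma> - 4 + ?n) = rpow (- 2 * a)"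
    by (simp_all add: g rpow_mult algebra_simps flip: rpow_0)
  have "rpow (\<gamma> + ?n) * (lap f * lap f) = rpow (- 2 * a) * ((rpow 2 * lap f) * (rpow 2 * lap f))"
    unfolding r by (simp only: mult_ac)
  also have "\<dots> = (rpow (- 2 * a) * (rpow a * rpow a)) * (L * L)"
    unfolding lf by (simp only: mult_ac)
  finally show "rpow (\<gamma> + ?n) * (lap f * lap f) = L * L" unfolding r by simp
  have "rpow (\<gamma> - 2 + ?n) * (\<Sum>i\<in>UNIV. D i f * D i f) = rpow (- 2 * a) * (euler f * euler f + sph_energy f)"
    unfolding r grad_square_eq[symmetric] by (simp only: mult_ac)
  also have "\<dots> = (rpow (- 2 * a) * (rpow a * rpow a)) * (h * h + sph_energy g)"
    unfolding ef enf by (simp add: algebra_simps)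
  finally show "rpow (\<gamma> - 2 + ?n) * (\<Sum>i\<in>UNIV. D i f * D i f) = h * h + sph_energy g" unfolding r by simp
  have "rpow (- 2 * a) * sph_energy f = (rpow (- 2 * a) * (rpow a * rpow a)) * sph_energy g"
    unfolding enf by (simp only: mult_ac)
  then show "rpow (\<gamma> - 4 + ?n) * sph_energy f = sph_energy g" unfolding r by simp
qed

text \<open>Expand the integral of (Eh + \<phi> h)^2, which is nonnegative, and integrate the mixed
  term 2 \<phi> h Eh by parts.\<close>

lemma hardy_weighted:
  fixes h :: "'n::finite pfun"
  assumes \<phi>: "elem_smooth \<phi>" and h: "annular h"
  shows "I ((rad (deriv \<phi>) - rad \<phi> * rad \<phi>) * (h * h)) \<le> I (euler h * euler h)"
proof -
  define e where "e = euler h"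
  define r :: "'n pfun" where "r = rad \<phi>"
  define r' :: "'n pfun" where "r' = rad (deriv \<phi>)"
  have ann: "annular h" "annular e" using h by (auto simp: e_def annular_intros)
  note lin = I_add I_minus I_scaleR annular_mult annular_add annular_minus annular_scaleR ann
  have "I (euler (r * (h * h))) = 0"
    using ann by (intro I_euler) (simp add: annular_mult)
  also have "euler (r * (h * h)) = 2 *\<^sub>R (r * (h * e)) + r' * (h * h)"
    using \<phi> by (simp add: euler_simps euler_rad r_def r'_def e_def scaleR_2 algebra_simps)
  finally have 1: "2 * I (r * (h * e)) + I (r' * (h * h)) = 0" by (simp add: lin)
  have "0 \<le> I ((e + r * h) * (e + r * h))" by (rule I_square_nonneg)
  also have "(e + r * h) * (e + r * h) = e * e + 2 *\<^sub>R (r * (h * e)) + (r * r) * (h * h)"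
    by (simp add: scaleR_2 algebra_simps)
  finally have 2: "0 \<le> I (e * e) + 2 * I (r * (h * e)) + I ((r * r) * (h * h))" by (simp add: lin)
  have "I ((r' - r * r) * (h * h)) = I (r' * (h * h)) - I ((r * r) * (h * h))"
    by (simp only: left_diff_distrib lin)
  with 1 2 show ?thesis unfolding e_def r_def r'_def by linarith
qed

section \<open>Iterated logarithms as a Riccati potential on the line\<close>

lemma elem_sum:
  "finite A \<Longrightarrow> (\<And>i. i \<in> A \<Longrightarrow> elem_smooth (\<phi> i)) \<Longrightarrow> elem_smooth (\<lambda>t. \<Sum>i\<in>A. \<phi> i t)"
  by (induction A rule: finite_induct) (auto intro: elem_const elem_add)

lemma elem_prod:
  "finite A \<Longrightarrow> (\<And>i. i \<in> A \<Longrightarrow> elem_smooth (\<phi> i)) \<Longrightarrow> elem_smooth (\<lambda>t. \<Prod>i\<in>A. \<phi> i t)"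
  by (induction A rule: finite_induct) (auto intro: elem_const elem_mult)

text \<open>A smooth replacement for the minimum of t and a constant. It is the identity on a
  neighbourhood of everything up to \<open>b\<close>, so derivatives there are unaffected, and it
  never reaches \<open>c\<close>.\<close>

lemma elem_truncate:
  fixes b c :: real
  assumes "b < c"
  obtains \<tau> d where "elem_smooth \<tau>" "b < d" "\<And>t. t \<le> d \<Longrightarrow> \<tau> t = t" "\<And>t. \<tau> t < c"
proof -
  define \<delta> where "\<delta> = (c - b) / 4"
  have "\<delta> > 0" using assms by (simp add: \<delta>_def)
  moreover have "c = b + 4 * \<delta>" unfolding \<delta>_def by (simp add: diff_divide_distrib)
  ultimately have \<delta>: "\<delta> > 0" "c = b + 4 * \<delta>" by blast+
  obtain \<sigma> where \<sigma>: "elem_smooth \<sigma>" "\<And>u. 0 \<le> \<sigma> u" "\<And>u. \<sigma> u \<le> 1" "\<And>u. u \<le> 0 \<Longrightarrow> \<sigma> u = 0"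
      "\<And>u. 1 \<le> u \<Longrightarrow> \<sigma> u = 1"
    using elem_step by metis
  \<comment> \<open>\<open>s\<close> climbs from 0 to 1 between b + \<delta> and b + 2\<delta>,
    while \<tau> moves from t to the constant b + 3\<delta>, still below c = b + 4\<delta>.\<close>
  define s where "s t = \<sigma> ((1 / \<delta>) * t + - ((b + \<delta>) / \<delta>))" for t
  have s_eq: "s t = \<sigma> ((t - b - \<delta>) / \<delta>)" for t
    unfolding s_def using \<delta> by (intro arg_cong[of _ _ \<sigma>]) (simp add: field_simps)
  define \<tau> where "\<tau> t = t + ((b + 3 * \<delta>) + (-1) * t) * s t" for t
  show thesis
  proof (rule that)
    have "elem_smooth s" unfolding s_def by (rule elem_affine[OF \<sigma>(1)])
    then show "elem_smooth \<tau>" unfolding \<tau>_def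
      by (intro elem_add elem_mult elem_id elem_const)
    show "b < b + \<delta>" using \<delta> by simp
    show "\<tau> t = t" if "t \<le> b + \<delta>" for t
    proof -
      have "s t = 0" unfolding s_eq using that \<delta> by (intro \<sigma>(4)) (simp add: field_simps)
      then show ?thesis by (simp add: \<tau>_def)
    qed
    show "\<tau> t < c" for t
    proof (cases "t \<le> b + 2 * \<delta>")
      case True
      have "(b + 3 * \<delta> - t) * s t \<le> (b + 3 * \<delta> - t) * 1"
        using True \<delta> \<sigma>(3) by (intro mult_left_mono) (auto simp: s_def)
      then show ?thesis using \<delta> by (simp add: \<tau>_def)
    next
      case False
      have "s t = 1" unfolding s_eq using False \<delta> by (intro \<sigma>(5)) (simp add: field_simps)
      then show ?thesis using \<delta> by (simp add: \<tau>_def)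
    qed
  qed
qed

lemma iter_ln_Suc: "iter_ln (Suc p) x = ln (iter_ln p x)"
  by (simp add: iter_ln_def)

lemma iter_exp_nonneg: "iter_exp j \<ge> 0"
  by (cases j) (auto simp: iter_exp_def)

text \<open>Each logarithm lowers the tower of exponentials by one level. This is the origin of the
  threshold \<open>iter_exp N * R\<close>: for r < R all logarithms up to order N stay
  positive.\<close>

lemma iter_ln_greater: "iter_exp N < x \<Longrightarrow> p \<le> N \<Longrightarrow> iter_exp (N - p) < iter_ln p x"
proof (induction p)
  case (Suc p)
  then have "iter_exp (N - p) < iter_ln p x" by simp
  moreover have "iter_exp (N - p) = exp (iter_exp (N - Suc p))"
    using Suc.prems by (simp add: iter_exp_def Suc_diff_Suc flip: funpow.simps(2)[unfolded o_def] del: funpow.simps(2))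
      (metis Suc_diff_Suc Suc_le_lessD comp_apply funpow.simps(2))
  ultimately show ?case
    unfolding iter_ln_Suc by (metis exp_gt_zero less_trans ln_exp ln_less_cancel_iff)
qed (simp add: iter_ln_def)

text \<open>The left side collects the products of pairs p <= k, that is, half of the full square
  plus half of the diagonal. In \<phi>' - \<phi>^2 with \<phi> half the sum of the P k, the full
  square cancels and a quarter of the diagonal remains.\<close>

lemma hardy_log_potential:
  fixes P :: "nat \<Rightarrow> real"
  shows "(\<Sum>k=1..N. P k * (\<Sum>p=1..k. P p)) = ((\<Sum>k=1..N. P k)\<^sup>2 + (\<Sum>k=1..N. (P k)\<^sup>2)) / 2"
  by (induction N) (simp_all add: power2_eq_square algebra_simps add_divide_distrib)

text \<open>
  With \<open>t = ln r\<close>, the logarithmic derivative \<open>\<phi>\<close> of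
  \<open>(ln\<^sub>1(\<eta>/r) \<cdots> ln\<^sub>N(\<eta>/r))\<^sup>1\<^sup>/\<^sup>2\<close> (up to sign) solves the Riccati equation
  \<open>\<phi>' - \<phi>\<^sup>2 = log_weight / 4\<close>.  Truncating \<open>t\<close> below \<open>ln R\<close> makes it smooth on the whole line.
\<close>

lemma log_weight_potential:
  assumes "0 < M" "M < R" and \<eta>: "\<eta> \<ge> iter_exp N * R" and N: "N \<ge> 1"
  obtains \<phi> \<Lambda> where "elem_smooth \<phi>" "elem_smooth \<Lambda>" "\<And>t. 0 \<le> \<Lambda> t"
    "\<And>r. 0 < r \<Longrightarrow> r \<le> M \<Longrightarrow> deriv \<phi> (ln r) - \<phi> (ln r) * \<phi> (ln r) = \<Lambda> (ln r) / 4"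
    "\<And>r. 0 < r \<Longrightarrow> r \<le> M \<Longrightarrow> \<Lambda> (ln r) = log_weight N \<eta> r"
proof -
  have R: "R > 0" using assms by linarith
  have "iter_exp N > 0" using N by (cases N) (auto simp: iter_exp_def)
  then have "\<eta> > 0" using \<eta> R by (meson less_le_trans mult_pos_pos)
  obtain \<tau> d where \<tau>: "elem_smooth \<tau>" "ln M < d" "\<And>t. t \<le> d \<Longrightarrow> \<tau> t = t" "\<And>t. \<tau> t < ln R"
    using elem_truncate[of "ln M" "ln R"] assms by auto
  define l where "l p t = iter_ln p (\<eta> / exp (\<tau> t))" for p t
  \<comment> \<open>The truncation stays below ln R, so every iterated logarithm is positive for all
    real t and not only for t < ln R.\<close>
  have arg: "iter_exp N < \<eta> / exp (\<tau> t)" for t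
  proof -
    have "exp (\<tau> t) < R" using \<tau>(4)[of t] R by (metis exp_less_cancel_iff exp_ln)
    then have "iter_exp N * exp (\<tau> t) < iter_exp N * R" using \<open>iter_exp N > 0\<close> by simp
    with \<eta> show ?thesis by (simp add: pos_less_divide_eq)
  qed
  have l_pos: "l p t > 0" if "p \<le> N" for p t
    using iter_ln_greater[OF arg that] iter_exp_nonneg[of "N - p"] by (simp add: l_def less_le_trans le_less_trans)
  have l1: "l 1 = (\<lambda>t. ln \<eta> + (-1) * \<tau> t)"
    using \<open>\<eta> > 0\<close> by (simp add: l_def iter_ln_def ln_div fun_eq_iff)
  have lS: "l (Suc p) = (\<lambda>t. ln (l p t))" for p
    by (rule ext) (simp add: l_def iter_ln_Suc)
  have l_elem: "elem_smooth (l p)" if "1 \<le> p" "p \<le> N" for p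
    using that
  proof (induction p rule: dec_induct)
    case base
    show ?case unfolding l1 by (intro elem_add elem_mult elem_const \<tau>(1))
  next
    case (step p)
    then show ?case unfolding lS using l_pos[of p] by (intro elem_ln) auto
  qed
  define P where "P k t = (\<Prod>p=1..k. inverse (l p t))" for k t
  have P_elem: "elem_smooth (P k)" if "k \<le> N" for k
    unfolding P_def using that l_pos by (intro elem_prod elem_inverse l_elem) (auto simp: less_imp_neq[symmetric])
  \<comment> \<open>Each further logarithm divides the derivative by the previous one; the chain
    starts at -1 with the empty product P 0 = 1. Below \<open>d\<close> the truncation is
    invisible.\<close>
  have dl: "(l p has_real_derivative - P (p - 1) t) (at t)" if "1 \<le> p" "p \<le> N" "t < d" for p t
    using that
  proof (induction p rule: dec_induct)
    case base
    have "((\<lambda>t. ln \<eta> - t) has_real_derivative -1) (at t)" by (auto intro!: derivative_eq_intros)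
    then have "(l 1 has_real_derivative -1) (at t)"
      by (rule has_field_derivative_transform_within_open[of _ _ _ "{..<d}"])
         (use base \<tau>(3) in \<open>auto simp: l1 simp del: One_nat_def\<close>)
    then show ?case by (simp add: P_def)
  next
    case (step p)
    then have "(l p has_real_derivative - P (p - 1) t) (at t)" by simp
    then have "(l (Suc p) has_real_derivative inverse (l p t) * - P (p - 1) t) (at t)"
      unfolding lS using l_pos[of p t] step by (intro DERIV_chain2[OF DERIV_ln]) auto
    moreover have "P p t = P (p - 1) t * inverse (l p t)"
      using step(1) unfolding P_def by (cases p) auto
    ultimately show ?case by (simp add: mult.commute)
  qed
  \<comment> \<open>The logarithmic derivative of 1 / (l 1 ... l k) is the sum of the quotients P (p
    - 1) / l p, and each of these is P p.\<close>
  have dP: "(P k has_real_derivative P k t * (\<Sum>p=1..k. P p t)) (at t)" if "k \<le> N" "t < d" for k t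
    using that
  proof (induction k)
    case 0
    have "P 0 = (\<lambda>t. 1)" by (simp add: P_def fun_eq_iff)
    then show ?case by simp
  next
    case (Suc k)
    have *: "P (Suc k) = (\<lambda>t. P k t * inverse (l (Suc k) t))"
      by (simp add: P_def fun_eq_iff)
    have IH: "(P k has_real_derivative P k t * (\<Sum>p=1..k. P p t)) (at t)" using Suc by simp
    have "(l (Suc k) has_real_derivative - P k t) (at t)" using dl[of "Suc k" t] Suc by simp
    moreover have "l (Suc k) t \<noteq> 0" using l_pos[of "Suc k" t] Suc by simp
    ultimately have "((\<lambda>t. inverse (l (Suc k) t)) has_real_derivative
        - (inverse (l (Suc k) t) * - P k t * inverse (l (Suc k) t))) (at t)"
      by (rule DERIV_inverse_fun[THEN DERIV_cong]) (simp add: power2_eq_square)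
    from DERIV_mult[OF IH this] have "(P (Suc k) has_real_derivative
        P k t * (\<Sum>p=1..k. P p t) * inverse (l (Suc k) t)
        + - (inverse (l (Suc k) t) * - P k t * inverse (l (Suc k) t)) * P k t) (at t)"
      unfolding * .
    moreover have "P k t * (\<Sum>p=1..k. P p t) * inverse (l (Suc k) t)
        + - (inverse (l (Suc k) t) * - P k t * inverse (l (Suc k) t)) * P k t
        = P (Suc k) t * (\<Sum>p=1..Suc k. P p t)"
      by (simp add: fun_cong[OF *] algebra_simps)
    ultimately show ?case by (simp only:)
  qed
  define \<phi> where "\<phi> = (\<lambda>t. (1/2) * (\<Sum>k=1..N. P k t))"
  define \<Lambda> where "\<Lambda> = (\<lambda>t. \<Sum>k=1..N. P k t * P k t)"
  show thesis
  proof (rule that)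
    show "elem_smooth \<phi>" unfolding \<phi>_def by (intro elem_mult elem_const elem_sum P_elem) auto
    show "elem_smooth \<Lambda>" unfolding \<Lambda>_def by (intro elem_mult elem_sum P_elem) auto
    show "0 \<le> \<Lambda> t" for t unfolding \<Lambda>_def by (intro sum_nonneg) simp
    fix r assume r: "0 < r" "r \<le> M"
    have t: "ln r < d" using r assms \<tau>(2) by (meson le_less_trans ln_le_cancel_iff)
    have "(\<phi> has_real_derivative (1/2) * (\<Sum>k=1..N. P k (ln r) * (\<Sum>p=1..k. P p (ln r)))) (at (ln r))"
      unfolding \<phi>_def using t by (intro DERIV_cmult DERIV_sum dP) auto
    then have "deriv \<phi> (ln r) = (1/2) * (\<Sum>k=1..N. P k (ln r) * (\<Sum>p=1..k. P p (ln r)))"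
      by (rule DERIV_imp_deriv)
    then show "deriv \<phi> (ln r) - \<phi> (ln r) * \<phi> (ln r) = \<Lambda> (ln r) / 4"
      unfolding hardy_log_potential by (simp add: \<phi>_def \<Lambda>_def power2_eq_square algebra_simps)
    show "\<Lambda> (ln r) = log_weight N \<eta> r"
      unfolding \<Lambda>_def log_weight_def P_def l_def
      using r t \<tau>(3) by (simp add: power_int_minus power2_eq_square flip: prod.distrib)
  qed
qed

section \<open>Spherical harmonics and spectral positivity\<close>

inductive hompoly :: "nat \<Rightarrow> 'n::finite pfun \<Rightarrow> bool" where
  hompoly_zero: "hompoly d 0"
| hompoly_const: "hompoly 0 (c *\<^sub>R 1)"
| hompoly_coord: "hompoly d f \<Longrightarrow> hompoly (Suc d) (coord i * f)"
| hompoly_add: "hompoly d f \<Longrightarrow> hompoly d g \<Longrightarrow> hompoly d (f + g)"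

lemma hompoly_scaleR: "hompoly d f \<Longrightarrow> hompoly d (c *\<^sub>R f)"
proof (induction rule: hompoly.induct)
  case (hompoly_coord d f i)
  then show ?case using hompoly.hompoly_coord[of d "c *\<^sub>R f" i] by simp
qed (auto simp: scaleR_add_right intro: hompoly.intros)

lemma hompoly_sum: "(\<And>i. i \<in> A \<Longrightarrow> hompoly d (F i)) \<Longrightarrow> hompoly d (sum F A)"
  by (induction A rule: infinite_finite_induct) (auto intro: hompoly_zero hompoly_add)

lemma hompoly_mult: "hompoly d f \<Longrightarrow> hompoly e g \<Longrightarrow> hompoly (d + e) (f * g)"
proof (induction rule: hompoly.induct)
  case (hompoly_coord d f i)
  then show ?case using hompoly.hompoly_coord[of "d + e" "f * g" i] by (simp add: mult.assoc)
qed (auto simp: distrib_right intro: hompoly_zero hompoly_add hompoly_scaleR)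

lemma hompoly_euler: "hompoly d f \<Longrightarrow> euler f = real d *\<^sub>R f"
proof (induction rule: hompoly.induct)
  case (hompoly_const c)
  then show ?case by (simp add: euler_def D_scaleR D_one)
qed (simp_all add: euler_simps euler_coord algebra_simps)

text \<open>Truncated subtraction makes 0 - 1 equal to 0, so the first conjunct alone is too weak
  for constants; the second records that their derivative vanishes. The same device appears in
  \<open>hompoly_lap\<close>.\<close>

lemma hompoly_D: "hompoly d f \<Longrightarrow> hompoly (d - 1) (D i f) \<and> (d = 0 \<longrightarrow> D i f = 0)"
proof (induction rule: hompoly.induct)
  case (hompoly_coord d f j)
  have "hompoly d (coord j * D i f)"
    using hompoly_coord hompoly.hompoly_coord[of "d - 1" "D i f" j] by (cases d) (auto intro: hompoly_zero)
  moreover have "hompoly d (of_bool (i = j) * f)"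
    using hompoly_coord by (auto intro: hompoly_zero)
  ultimately show ?case by (simp add: D_simps hompoly_add)
qed (auto simp: D_simps D_one intro: hompoly_zero hompoly_add)

lemma hompoly_lap: "hompoly d f \<Longrightarrow> hompoly (d - 2) (lap f) \<and> (d < 2 \<longrightarrow> lap f = 0)"
proof -
  assume f: "hompoly d f"
  have "hompoly (d - 2) (D i (D i f)) \<and> (d < 2 \<longrightarrow> D i (D i f) = 0)" for i
  proof (cases "d = 0")
    case True
    then show ?thesis using hompoly_D[OF f, of i] by (simp add: D_zero hompoly_zero)
  next
    case False
    then show ?thesis
      using hompoly_D[OF conjunct1[OF hompoly_D[OF f, of i]], of i] by (auto simp: numeral_2_eq_2)
  qed
  then show ?thesis by (auto simp: lap_def intro!: hompoly_sum)
qed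

text \<open>The summands are eigenfunctions on the whole punctured space with arbitrary radial
  dependence. Indexing by the degree \<open>l\<close> itself lets two sums be added eigenvalue by
  eigenvalue.\<close>

definition eigensum :: "'n::finite pfun \<Rightarrow> bool" where
  "eigensum f \<longleftrightarrow> (\<exists>u N. (\<forall>l. sph_lap (u l) = - sph_eigenvalue CARD('n) l *\<^sub>R u l) \<and>
     (\<forall>l\<ge>N. u l = 0) \<and> f = (\<Sum>l<N. u l))"

lemma sum_lessThan_extend:
  fixes u :: "nat \<Rightarrow> 'a::comm_monoid_add"
  shows "(\<And>l. l \<ge> N \<Longrightarrow> u l = 0) \<Longrightarrow> N \<le> M \<Longrightarrow> (\<Sum>l<N. u l) = (\<Sum>l<M. u l)"
  by (rule sum.mono_neutral_left) auto

lemma eigensum_add: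
  fixes f g :: "'n::finite pfun"
  assumes "eigensum f" "eigensum g" shows "eigensum (f + g)"
proof -
  let ?E = "\<lambda>u l. sph_lap (u l :: 'n pfun) = - sph_eigenvalue CARD('n) l *\<^sub>R u l"
  obtain u N where u: "\<And>l. ?E u l" "\<And>l. l \<ge> N \<Longrightarrow> u l = 0" "f = (\<Sum>l<N. u l)"
    using assms(1) by (auto simp: eigensum_def)
  obtain v K where v: "\<And>l. ?E v l" "\<And>l. l \<ge> K \<Longrightarrow> v l = 0" "g = (\<Sum>l<K. v l)"
    using assms(2) by (auto simp: eigensum_def)
  have "f + g = (\<Sum>l<max N K. u l + v l)"
    using sum_lessThan_extend[of N u "max N K"] sum_lessThan_extend[of K v "max N K"] u v
    by (simp add: sum.distrib)
  then show ?thesis unfolding eigensum_def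
    by (intro exI[of _ "\<lambda>l. u l + v l"] exI[of _ "max N K"])
       (simp add: u(1,2) v(1,2) sph_lap_add scaleR_add_right)
qed

lemma sph_eigenvalue_strict_mono:
  "n \<ge> 2 \<Longrightarrow> l < d \<Longrightarrow> sph_eigenvalue n l < sph_eigenvalue n d"
  unfolding sph_eigenvalue_def by (intro mult_strict_mono) auto

lemma sph_lap_hompoly:
  fixes f :: "'n::finite pfun"
  assumes "hompoly d f"
  shows "sph_lap f = rpow 2 * lap f - sph_eigenvalue CARD('n) d *\<^sub>R f"
  using hompoly_euler[OF assms]
  by (simp add: sph_lap_eq euler_simps sph_eigenvalue_def algebra_simps)

lemma sph_lap_rpow_mult: "sph_lap (rpow c * f) = rpow c * sph_lap f"
  by (rule sph_lap_rot_const) (rule rot_rpow)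

text \<open>
  On homogeneous polynomials of degree \<open>d\<close> one has \<open>\<Delta>\<^sub>S + \<lambda>\<^sub>d = \<bar>x\<bar>\<^sup>2\<Delta>\<close>, which
  lowers the degree; so subtracting lower eigenfunctions leaves an eigenfunction.
\<close>

lemma hompoly_eigensum:
  fixes f :: "'n::finite pfun"
  assumes n: "CARD('n) \<ge> 2" and "hompoly d f"
  shows "\<exists>u. (\<forall>l. sph_lap (u l) = - sph_eigenvalue CARD('n) l *\<^sub>R u l) \<and>
     (\<forall>l>d. u l = 0) \<and> f = (\<Sum>l<Suc d. u l)"
  using assms(2)
proof (induction d arbitrary: f rule: less_induct)
  case (less d)
  let ?ev = "sph_eigenvalue CARD('n)"
  show ?case
  proof (cases "d < 2")
    case True
    then have "sph_lap f = - ?ev d *\<^sub>R f" using hompoly_lap[OF less.prems] sph_lap_hompoly[OF less.prems] by simp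
    then show ?thesis
      by (intro exI[of _ "\<lambda>l. if l = d then f else 0"]) (simp add: sph_lap_zero)
  next
    case False
    then obtain v where v: "\<And>l. sph_lap (v l) = - ?ev l *\<^sub>R v l" "\<And>l. l > d - 2 \<Longrightarrow> v l = 0"
      "lap f = (\<Sum>l<Suc (d - 2). v l)"
      using less.IH[of "d - 2" "lap f"] hompoly_lap[OF less.prems] by auto
    \<comment> \<open>The expansion of the Laplacian ends at degree d - 2; the slot d - 1 is filled
      with 0.\<close>
    have lf: "lap f = (\<Sum>l<d. v l)"
      unfolding v(3) by (rule sum_lessThan_extend) (use v(2) False in auto)
    \<comment> \<open>Chosen so that (\<Delta>_S + \<lambda>_d) w_l = |x|^2 v_l for l < d; the
      radial factor leaves the eigenvalue of \<open>v l\<close> unchanged. Subtracting all of them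
      from \<open>f\<close> therefore cancels |x|^2 \<Delta> f.\<close>
    define w where "w l = (1 / (?ev d - ?ev l)) *\<^sub>R (rpow 2 * v l)" for l
    have w: "sph_lap (w l) = - ?ev l *\<^sub>R w l" for l
      by (simp add: w_def sph_lap_scaleR sph_lap_rpow_mult v(1))
    have wd: "(?ev d - ?ev l) *\<^sub>R w l = rpow 2 * v l" if "l < d" for l
      using sph_eigenvalue_strict_mono[OF n that] by (simp add: w_def)
    define h where "h = f - (\<Sum>l<d. w l)"
    have "sph_lap h = rpow 2 * lap f - ?ev d *\<^sub>R f + (\<Sum>l<d. ?ev l *\<^sub>R w l)"
      by (simp add: h_def sph_lap_minus sph_lap_sum w sph_lap_hompoly[OF less.prems] sum_negf)
    also have "rpow 2 * lap f = (\<Sum>l<d. (?ev d - ?ev l) *\<^sub>R w l)"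
      unfolding lf sum_distrib_left by (intro sum.cong refl) (simp add: wd)
    also have "(\<Sum>l<d. (?ev d - ?ev l) *\<^sub>R w l) - ?ev d *\<^sub>R f + (\<Sum>l<d. ?ev l *\<^sub>R w l) = - ?ev d *\<^sub>R h"
      by (simp add: h_def scaleR_diff_left sum_subtractf scaleR_sum_right scaleR_diff_right sum_negf)
    finally have h: "sph_lap h = - ?ev d *\<^sub>R h" .
    have fh: "f = (\<Sum>l<d. w l) + h" by (simp add: h_def)
    show ?thesis
      by (intro exI[of _ "\<lambda>l. if l = d then h else if l < d then w l else 0"])
         (auto simp: h w sph_lap_zero fh)
  qed
qed

section \<open>Polynomials: finite eigenfunction expansion and density\<close>

inductive polyspan :: "'n::finite pfun \<Rightarrow> bool" where
  polyspan_hom: "hompoly d f \<Longrightarrow> polyspan f"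
| polyspan_add: "polyspan f \<Longrightarrow> polyspan g \<Longrightarrow> polyspan (f + g)"

lemma polyspan_hom_mult: "polyspan g \<Longrightarrow> hompoly d f \<Longrightarrow> polyspan (f * g)"
  by (induction rule: polyspan.induct)
     (auto simp: distrib_left intro: polyspan.intros hompoly_mult)

lemma polyspan_mult: "polyspan f \<Longrightarrow> polyspan g \<Longrightarrow> polyspan (f * g)"
  by (induction rule: polyspan.induct)
     (auto simp: distrib_right intro: polyspan_add polyspan_hom_mult)

lemma polyspan_eigensum:
  fixes f :: "'n::finite pfun"
  assumes "polyspan f" "CARD('n) \<ge> 2" shows "eigensum f"
  using assms(1)
proof (induction rule: polyspan.induct)
  case (polyspan_hom d f)
  then obtain u where "\<forall>l. sph_lap (u l) = - sph_eigenvalue CARD('n) l *\<^sub>R u l"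
     "\<forall>l>d. u l = 0" "f = (\<Sum>l<Suc d. u l)"
    using hompoly_eigensum[OF assms(2)] by blast
  then show ?case unfolding eigensum_def by (intro exI[of _ u] exI[of _ "Suc d"]) auto
qed (rule eigensum_add)

lemma polynomial_polyspan:
  fixes p :: "real^'n::finite \<Rightarrow> real"
  assumes "real_polynomial_function p"
  shows "\<exists>f. polyspan f \<and> (\<forall>x. x \<noteq> 0 \<longrightarrow> Rep_pfun f x = p x)"
  using assms
proof (induction rule: real_polynomial_function.induct)
  case (linear p)
  have p: "p x = (\<Sum>i\<in>UNIV. p (axis i 1) * x $ i)" for x
  proof -
    have "p x = p (\<Sum>i\<in>UNIV. (x $ i) *\<^sub>R axis i 1)"
      using basis_expansion[of x] by (simp add: scalar_mult_eq_scaleR)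
    then show ?thesis
      using linear by (simp add: bounded_linear.linear linear_sum linear_cmul mult.commute)
  qed
  have "hompoly (Suc 0) (\<Sum>i\<in>UNIV. p (axis i 1) *\<^sub>R (coord i * (1 *\<^sub>R 1)))"
    by (intro hompoly_sum hompoly_scaleR hompoly_coord hompoly_const)
  then have "polyspan (\<Sum>i\<in>UNIV. p (axis i 1) *\<^sub>R coord i)"
    by (auto intro: polyspan_hom)
  then show ?case
    by (intro exI[of _ "\<Sum>i\<in>UNIV. p (axis i 1) *\<^sub>R coord i"] conjI)
       (simp_all add: p[symmetric] Rep_pfun_sum Rep_pfun_simps coord.rep_eq)
next
  case (const c)
  show ?case by (intro exI[of _ "c *\<^sub>R 1"] conjI polyspan_hom[OF hompoly_const]) (simp add: Rep_pfun_simps Rep_pfun_one)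
next
  case (add p q)
  then obtain f g where "polyspan f" "\<forall>x. x \<noteq> 0 \<longrightarrow> Rep_pfun f x = p x"
     "polyspan g" "\<forall>x. x \<noteq> 0 \<longrightarrow> Rep_pfun g x = q x" by blast
  then show ?case by (intro exI[of _ "f + g"]) (simp add: polyspan_add Rep_pfun_simps)
next
  case (mult p q)
  then obtain f g where "polyspan f" "\<forall>x. x \<noteq> 0 \<longrightarrow> Rep_pfun f x = p x"
     "polyspan g" "\<forall>x. x \<noteq> 0 \<longrightarrow> Rep_pfun g x = q x" by blast
  then show ?case by (intro exI[of _ "f * g"]) (simp add: polyspan_mult Rep_pfun_simps)
qed

lemma polyspan_dense:
  fixes w :: "'n::finite pfun"
  assumes "0 < m" "0 < e"
  shows "\<exists>p. polyspan p \<and> (\<forall>x. m \<le> norm x \<and> norm x \<le> M \<longrightarrow> \<bar>Rep_pfun w x - Rep_pfun p x\<bar> < e)"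
proof -
  define K where "K = cball 0 M - ball (0::real^'n) m"
  have K: "compact K" unfolding K_def by (intro compact_diff) auto
  have "continuous_on K (Rep_pfun w)"
    by (rule continuous_on_subset[OF smooth_punctured_continuous[OF smooth_Rep_pfun]])
       (use assms in \<open>auto simp: K_def\<close>)
  from Stone_Weierstrass_real_polynomial_function[OF K this assms(2)]
  obtain p where p: "real_polynomial_function p" "\<And>x. x \<in> K \<Longrightarrow> \<bar>Rep_pfun w x - p x\<bar> < e"
    by blast
  obtain f where "polyspan f" "\<And>x. x \<noteq> 0 \<Longrightarrow> Rep_pfun f x = p x"
    using polynomial_polyspan[OF p(1)] by blast
  moreover have "x \<in> K \<and> x \<noteq> 0" if "m \<le> norm x \<and> norm x \<le> M" for x
    using that assms by (auto simp: K_def)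
  ultimately show ?thesis using p(2) by (intro exI[of _ f]) auto
qed

section \<open>Positivity of quadratic polynomials in the spherical Laplacian\<close>

text \<open>Polynomials are not supported in an annulus, so the cutoff \<open>W\<close> makes the
  pairing finite. For radial \<open>W\<close> the spherical Laplacian remains symmetric, see
  \<open>wip_sph_lap\<close>.\<close>

definition wip :: "'n::finite pfun \<Rightarrow> 'n pfun \<Rightarrow> 'n pfun \<Rightarrow> real" where
  "wip W u v = I (W * (u * v))"

lemma
  assumes W: "annular W"
  shows wip_add_left: "wip W (f + g) h = wip W f h + wip W g h"
    and wip_minus_left: "wip W (f - g) h = wip W f h - wip W g h"
    and wip_scaleR_left: "wip W (c *\<^sub>R f) h = c * wip W f h"
    and wip_add_right: "wip W h (f + g) = wip W h f + wip W h g"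
    and wip_minus_right: "wip W h (f - g) = wip W h f - wip W h g"
    and wip_scaleR_right: "wip W h (c *\<^sub>R f) = c * wip W h f"
    and wip_sum_left: "wip W (sum F A) h = (\<Sum>i\<in>A. wip W (F i) h)"
    and wip_sum_right: "wip W h (sum F A) = (\<Sum>i\<in>A. wip W h (F i))"
  unfolding wip_def
  by (simp_all add: distrib_left distrib_right left_diff_distrib right_diff_distrib I_add I_minus
      I_scaleR annular_mult W sum_distrib_left sum_distrib_right I_sum)

lemma wip_commute: "wip W u v = wip W v u"
  by (simp add: wip_def mult_ac)

lemma wip_nonneg: "(\<And>x. Rep_pfun W x \<ge> 0) \<Longrightarrow> wip W u u \<ge> 0"
  unfolding wip_def by (rule I_nonneg) (simp add: Rep_pfun_simps)

lemma wip_sph_lap: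
  fixes u v :: "'n::finite pfun"
  assumes "annular (rad \<kappa> :: 'n pfun)" "elem_smooth \<kappa>"
  shows "wip (rad \<kappa>) (sph_lap u) v = wip (rad \<kappa>) u (sph_lap v)"
proof -
  have "I ((rad \<kappa> * u) * sph_lap v) = I (sph_lap (rad \<kappa> * u) * v)"
    using assms by (intro I_sph_lap_sym annular_mult(1))
  also have "sph_lap (rad \<kappa> * u) = rad \<kappa> * sph_lap u"
    by (rule sph_lap_rot_const) (rule rot_rad[OF assms(2)])
  finally show ?thesis by (simp add: wip_def mult.assoc)
qed

text \<open>
  To show \<open>\<langle>q(-\<Delta>\<^sub>S)g, g\<rangle> \<ge> 0\<close>, approximate \<open>q(-\<Delta>\<^sub>S)g\<close> (rather than \<open>g\<close>) by a polynomial \<open>p\<close> and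
  solve \<open>q(-\<Delta>\<^sub>S)s = p\<close> by the finite eigenfunction expansion of \<open>p\<close>; so no approximation of
  derivatives is needed.
\<close>

lemma spectral_positive_strict:
  fixes g :: "'n::finite pfun"
  assumes n: "CARD('n) \<ge> 2" and g: "annular g" and \<delta>: "\<delta> > 0"
    and q: "\<And>l. (sph_eigenvalue CARD('n) l)\<^sup>2 + b * sph_eigenvalue CARD('n) l + c \<ge> \<delta>"
  shows "0 \<le> I ((sph_lap (sph_lap g) - b *\<^sub>R sph_lap g + c *\<^sub>R g) * g)"
proof -
  obtain m M where mM: "0 < m" "m < M" "\<And>x. Rep_pfun g x \<noteq> 0 \<Longrightarrow> m \<le> norm x \<and> norm x \<le> M"
    using annularE[OF g] by metis
  define T where "T f = sph_lap (sph_lap f) - b *\<^sub>R sph_lap f + c *\<^sub>R f" for f :: "'n pfun"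
  define w where "w = T g"
  \<comment> \<open>The cutoff equals 1 on the support of \<open>g\<close>, hence W g = g and the
    weighted pairing with \<open>g\<close> is the integral to be estimated. It is positive on a
    slightly larger annulus at most, on which polynomials will approximate \<open>w\<close>.\<close>
  obtain \<kappa> where \<kappa>: "elem_smooth \<kappa>" "\<And>u. 0 \<le> \<kappa> u" "\<And>u. ln m \<le> u \<Longrightarrow> u \<le> ln M \<Longrightarrow> \<kappa> u = 1"
    "\<And>u. u \<le> ln m - 1 \<or> ln M + 1 \<le> u \<Longrightarrow> \<kappa> u = 0"
    using elem_cutoff[of "ln m" "ln M"] mM by auto
  define W :: "'n pfun" where "W = rad \<kappa>"
  have W_supp: "exp (ln m - 1) \<le> norm x \<and> norm x \<le> exp (ln M + 1)" if "Rep_pfun W x \<noteq> 0" for x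
  proof -
    have "x \<noteq> 0" "\<kappa> (ln (norm x)) \<noteq> 0" using that by (auto simp: W_def Rep_rad[OF \<kappa>(1)])
    then have "ln m - 1 < ln (norm x)" "ln (norm x) < ln M + 1"
      using \<kappa>(4)[of "ln (norm x)"] by (meson not_le)+
    then show ?thesis using \<open>x \<noteq> 0\<close> by (metis exp_le_cancel_iff exp_ln less_imp_le zero_less_norm_iff)
  qed
  have W: "annular W" unfolding annular_def using W_supp exp_gt_zero by blast
  have W0: "Rep_pfun W x \<ge> 0" for x by (simp add: W_def Rep_rad[OF \<kappa>(1)] \<kappa>(2))
  have Wg: "W * g = g"
  proof (rule pfun_eqI)
    fix x :: "real^'n" assume "x \<noteq> 0"
    then show "Rep_pfun (W * g) x = Rep_pfun g x"
      using mM \<kappa>(3)[of "ln (norm x)"] by (cases "Rep_pfun g x = 0") (auto simp: Rep_pfun_simps W_def Rep_rad[OF \<kappa>(1)])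
  qed
  note ip = wip_add_left[OF W] wip_minus_left[OF W] wip_scaleR_left[OF W] wip_add_right[OF W]
    wip_minus_right[OF W] wip_scaleR_right[OF W] wip_sum_left[OF W] wip_sum_right[OF W]
  have sym: "wip W (sph_lap u) v = wip W u (sph_lap v)" for u v
    using W \<kappa>(1) unfolding W_def by (rule wip_sph_lap)
  have symT: "wip W (T u) v = wip W u (T v)" for u v
    unfolding T_def by (simp add: ip sym)
  \<comment> \<open>A bound independent of the accuracy \<open>e\<close>: the squared error is at
    most e^2 \<open>I W\<close>, and the remaining terms bound the squared norm of g + s through the
    norms of \<open>g\<close> and \<open>w\<close>.\<close>
  define C where "C = I W + 2 * wip W g g + 4 * (wip W w w + I W) / \<delta>\<^sup>2"
  have key: "- (e * C) \<le> 2 * wip W w g" if e: "0 < e" "e \<le> 1" for e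
  proof -
    obtain p where p: "polyspan p"
      "\<And>x. exp (ln m - 1) \<le> norm x \<and> norm x \<le> exp (ln M + 1) \<Longrightarrow> \<bar>Rep_pfun w x - Rep_pfun p x\<bar> < e"
      using polyspan_dense[of "exp (ln m - 1)" e] e by (metis exp_gt_zero)
    obtain u N where u: "\<And>l. sph_lap (u l) = - sph_eigenvalue CARD('n) l *\<^sub>R u l" "p = (\<Sum>l<N. u l)"
      using polyspan_eigensum[OF p(1) n] by (auto simp: eigensum_def)
    define Q where "Q l = (sph_eigenvalue CARD('n) l)\<^sup>2 + b * sph_eigenvalue CARD('n) l + c" for l
    have Q: "Q l \<ge> \<delta>" for l using q by (simp add: Q_def)
    then have Q0: "Q l > 0" for l using \<delta> by (meson less_le_trans)
    have Tu: "T (u l) = Q l *\<^sub>R u l" for l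
    proof -
      have "sph_lap (sph_lap (u l)) = (sph_eigenvalue CARD('n) l)\<^sup>2 *\<^sub>R u l"
        using sph_lap_scaleR[of "- sph_eigenvalue CARD('n) l" "u l"] by (simp add: u(1) power2_eq_square)
      then show ?thesis by (simp add: T_def Q_def u(1) algebra_simps)
    qed
    have orth: "wip W (u l) (u k) = 0" if "l \<noteq> k" for l k
    proof -
      have "sph_eigenvalue CARD('n) l \<noteq> sph_eigenvalue CARD('n) k"
        using sph_eigenvalue_strict_mono[OF n] that by (metis less_irrefl nat_neq_iff)
      moreover have "sph_eigenvalue CARD('n) l * wip W (u l) (u k) = sph_eigenvalue CARD('n) k * wip W (u l) (u k)"
        using sym[of "u l" "u k"] by (simp add: u(1) ip del: scaleR_minus_left)
      ultimately show ?thesis by simp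
    qed
    \<comment> \<open>\<open>s\<close> solves T s = p on the finite expansion; the gap \<delta>
      below all \<open>Q l\<close> bounds its norm by that of \<open>p\<close>, uniformly in the
      approximation.\<close>
    define s where "s = (\<Sum>l<N. (1 / Q l) *\<^sub>R u l)"
    have Ts: "T s = p"
    proof -
      have "T s = (\<Sum>l<N. (1 / Q l) *\<^sub>R T (u l))"
        by (simp add: T_def s_def sph_lap_sum sph_lap_scaleR scaleR_sum_right sum.distrib sum_subtractf
            algebra_simps)
      then show ?thesis using Q0 by (simp add: Tu u(2) less_imp_neq[symmetric])
    qed
    have diag: "(\<Sum>l<N. \<Sum>k<N. A l k * wip W (u l) (u k)) = (\<Sum>l<N. A l l * wip W (u l) (u l))" for A :: "nat \<Rightarrow> nat \<Rightarrow> real"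
    proof (rule sum.cong[OF refl])
      fix l assume l: "l \<in> {..<N}"
      have "(\<Sum>k<N. A l k * wip W (u l) (u k)) = (\<Sum>k<N. if k = l then A l l * wip W (u l) (u l) else 0)"
        by (rule sum.cong) (auto simp: orth)
      then show "(\<Sum>k<N. A l k * wip W (u l) (u k)) = A l l * wip W (u l) (u l)"
        using l by simp
    qed
    have nonneg: "wip W v v \<ge> 0" for v using W0 by (rule wip_nonneg)
    have sp: "wip W s p \<ge> 0"
    proof -
      have "wip W s p = (\<Sum>l<N. \<Sum>k<N. (1 / Q l) * wip W (u l) (u k))"
        by (simp only: s_def u(2) wip_sum_left[OF W]) (simp add: ip)
      also have "\<dots> = (\<Sum>l<N. (1 / Q l) * wip W (u l) (u l))" by (rule diag)
      also have "\<dots> \<ge> 0" using Q0 nonneg by (intro sum_nonneg mult_nonneg_nonneg) (auto simp: less_imp_le)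
      finally show ?thesis .
    qed
    have pp: "wip W p p = (\<Sum>l<N. wip W (u l) (u l))"
      using diag[of "\<lambda>_ _. 1"] by (simp only: u(2) wip_sum_left[OF W]) (simp add: ip)
    have ss: "wip W s s \<le> wip W p p / \<delta>\<^sup>2"
    proof -
      have "wip W s s = (\<Sum>l<N. \<Sum>k<N. (1 / Q l * (1 / Q k)) * wip W (u l) (u k))"
        by (simp only: s_def wip_sum_left[OF W]) (simp add: ip mult.commute)
      also have "\<dots> = (\<Sum>l<N. (1 / Q l * (1 / Q l)) * wip W (u l) (u l))" by (rule diag)
      also have "\<dots> \<le> (\<Sum>l<N. (1 / \<delta>\<^sup>2) * wip W (u l) (u l))"
      proof (intro sum_mono mult_right_mono nonneg)
        fix l
        have "1 / Q l \<le> 1 / \<delta>" using Q[of l] \<delta> by (simp add: frac_le)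
        then have "1 / Q l * (1 / Q l) \<le> 1 / \<delta> * (1 / \<delta>)"
          using Q0[of l] \<delta> by (intro mult_mono) auto
        then show "1 / Q l * (1 / Q l) \<le> 1 / \<delta>\<^sup>2" by (simp add: power2_eq_square)
      qed
      also have "\<dots> = wip W p p / \<delta>\<^sup>2" by (simp add: pp sum_divide_distrib)
      finally show ?thesis .
    qed
    define d where "d = w - p"
    have dd: "wip W d d \<le> e\<^sup>2 * I W"
    proof -
      have "wip W d d \<le> I (e\<^sup>2 *\<^sub>R W)" unfolding wip_def
      proof (rule I_mono)
        fix x
        show "Rep_pfun (W * (d * d)) x \<le> Rep_pfun (e\<^sup>2 *\<^sub>R W) x"
        proof (cases "Rep_pfun W x = 0")
          case False
          then have "\<bar>Rep_pfun d x\<bar> \<le> e" using p(2)[OF W_supp[OF False]] by (simp add: d_def Rep_pfun_minus)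
          then have "(Rep_pfun d x)\<^sup>2 \<le> e\<^sup>2" using e by (simp add: abs_le_square_iff[symmetric])
          then show ?thesis using mult_left_mono[OF _ W0[of x], of "(Rep_pfun d x)\<^sup>2" "e\<^sup>2"]
            by (simp add: Rep_pfun_simps power2_eq_square mult_ac)
        qed (simp add: Rep_pfun_simps)
      qed (use W in \<open>auto intro: annular_mult annular_scaleR\<close>)
      then show ?thesis by (simp add: I_scaleR)
    qed
    have IW: "I W \<ge> 0" using W0 by (rule I_nonneg)
    have "e\<^sup>2 \<le> 1" using e by (simp add: power_le_one)
    then have dd1: "wip W d d \<le> I W" using dd IW by (meson mult_left_le_one_le order_trans zero_le_power2)
    have pp2: "wip W p p \<le> 2 * wip W w w + 2 * I W"
    proof -
      have "0 \<le> wip W (w + d) (w + d)" by (rule nonneg)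
      moreover have "wip W p p = wip W w w - 2 * wip W w d + wip W d d"
        by (simp add: d_def ip wip_commute[of W p w])
      moreover have "wip W (w + d) (w + d) = wip W w w + 2 * wip W w d + wip W d d"
        by (simp add: ip wip_commute[of W d w])
      ultimately show ?thesis using dd1 by linarith
    qed
    have ss2: "wip W s s \<le> 2 * (wip W w w + I W) / \<delta>\<^sup>2"
      using ss divide_right_mono[OF pp2, of "\<delta>\<^sup>2"] by (simp add: distrib_left)
    have gs: "wip W (g + s) (g + s) \<le> 2 * wip W g g + 2 * wip W s s"
    proof -
      have "0 \<le> wip W (g - s) (g - s)" by (rule nonneg)
      then show ?thesis by (simp add: ip wip_commute[of W s g])
    qed
    have gs2: "wip W (g + s) (g + s) \<le> 2 * wip W g g + 2 * (2 * (wip W w w + I W) / \<delta>\<^sup>2)"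
      using gs ss2 by linarith
    \<comment> \<open>With T g = w, T s = p and d = w - p, symmetry of T turns the pairing of p with
      g into that of s with w. So the target is the pairing of d with g + s, plus the pairing of s
      with p, which is nonnegative.\<close>
    have "wip W w g = wip W d g + wip W p g" by (simp add: d_def ip)
    also have "wip W p g = wip W s w" using symT[of s g] by (simp add: Ts w_def)
    also have "wip W s w = wip W s d + wip W s p" by (simp add: d_def ip)
    finally have 1: "wip W w g \<ge> wip W d (g + s)"
      using sp by (simp add: ip wip_commute[of W s d])
    \<comment> \<open>A square with parameter \<open>e\<close> takes the place of Cauchy-Schwarz:
      since the norm of \<open>d\<close> is of order e, division by e leaves the wanted pairing plus
      a term of order e.\<close>
    have "0 \<le> wip W (d + e *\<^sub>R (g + s)) (d + e *\<^sub>R (g + s))" by (rule nonneg)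
    also have "\<dots> = wip W d d + 2 * e * wip W d (g + s) + e\<^sup>2 * wip W (g + s) (g + s)"
      by (simp add: wip_add_left[OF W] wip_add_right[OF W] wip_scaleR_left[OF W] wip_scaleR_right[OF W]
          wip_commute[of W g d] wip_commute[of W s d] wip_commute[of W s g] power2_eq_square algebra_simps)
    also have "\<dots> \<le> e\<^sup>2 * I W + 2 * e * wip W d (g + s) + e\<^sup>2 * (2 * wip W g g + 2 * (2 * (wip W w w + I W) / \<delta>\<^sup>2))"
      using dd mult_left_mono[OF gs2, of "e\<^sup>2"] by simp
    also have "\<dots> = e * (e * C + 2 * wip W d (g + s))"
      by (simp add: C_def power2_eq_square algebra_simps add_divide_distrib)
    finally have "0 \<le> e * C + 2 * wip W d (g + s)"
      using e by (simp add: zero_le_mult_iff)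
    then show ?thesis using 1 by linarith
  qed
  have "0 \<le> wip W w g"
  proof (rule ccontr)
    assume neg: "\<not> 0 \<le> wip W w g"
    have "((\<lambda>e. - (e * C)) \<longlongrightarrow> - (0 * C)) (at_right 0)" by (intro tendsto_intros)
    moreover have "\<forall>\<^sub>F e in at_right (0::real). - (e * C) \<le> 2 * wip W w g"
      using eventually_at_right_less[of 0] eventually_at_right_field[of "\<lambda>e. e \<le> 1" 0]
      by (auto intro!: eventually_at_rightI[of 0 1] key)
    ultimately have "- (0 * C) \<le> 2 * wip W w g"
      by (rule tendsto_upperbound) simp
    then show False using neg by simp
  qed
  also have "wip W w g = I (w * (W * g))" by (simp add: wip_def mult_ac)
  finally show ?thesis by (simp add: Wg w_def T_def)
qed

text \<open>Raising the constant term by \<delta> > 0 creates the spectral gap required before; then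
  \<delta> tends to 0.\<close>

lemma spectral_positive:
  fixes g :: "'n::finite pfun"
  assumes n: "CARD('n) \<ge> 2" and g: "annular g"
    and q: "\<And>l. (sph_eigenvalue CARD('n) l)\<^sup>2 + b * sph_eigenvalue CARD('n) l + c \<ge> 0"
  shows "0 \<le> I (sph_lap g * sph_lap g) - b * I (g * sph_lap g) + c * I (g * g)"
proof -
  have *: "I (sph_lap (sph_lap g) * g) = I (sph_lap g * sph_lap g)"
    using I_sph_lap_sym[of "sph_lap g" g] g by (simp add: annular_sph_lap)
  have "I ((sph_lap (sph_lap g) - b *\<^sub>R sph_lap g + (c + \<delta>) *\<^sub>R g) * g)
      = I (sph_lap g * sph_lap g) - b * I (g * sph_lap g) + (c + \<delta>) * I (g * g)" for \<delta>
    using g by (simp add: distrib_right left_diff_distrib I_add I_minus I_scaleR annular_mult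
        annular_intros * mult.commute[of "sph_lap g" g])
  moreover have "0 \<le> I ((sph_lap (sph_lap g) - b *\<^sub>R sph_lap g + (c + \<delta>) *\<^sub>R g) * g)" if "\<delta> > 0" for \<delta>
    by (rule spectral_positive_strict[OF n g that]) (use q in \<open>simp flip: add.assoc\<close>)
  ultimately have ge: "0 \<le> I (sph_lap g * sph_lap g) - b * I (g * sph_lap g) + (c + \<delta>) * I (g * g)" if "\<delta> > 0" for \<delta>
    using that by simp
  have "((\<lambda>\<delta>. I (sph_lap g * sph_lap g) - b * I (g * sph_lap g) + (c + \<delta>) * I (g * g)) \<longlongrightarrow>
      I (sph_lap g * sph_lap g) - b * I (g * sph_lap g) + (c + 0) * I (g * g)) (at_right 0)"
    by (intro tendsto_intros)
  then have "0 \<le> I (sph_lap g * sph_lap g) - b * I (g * sph_lap g) + (c + 0) * I (g * g)"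
    by (rule tendsto_lowerbound) (auto intro!: eventually_at_rightI[of 0 1] ge)
  then show ?thesis by simp
qed

section \<open>The inequality\<close>

definition supported :: "real \<Rightarrow> 'n::finite pfun \<Rightarrow> bool" where
  "supported M f \<longleftrightarrow> (\<forall>x. Rep_pfun f x \<noteq> 0 \<longrightarrow> norm x \<le> M)"

lemma supported_mult: "supported M f \<Longrightarrow> supported M (g * f)" "supported M f \<Longrightarrow> supported M (f * g)"
  by (auto simp: supported_def Rep_pfun_simps)

lemma supported_add: "supported M f \<Longrightarrow> supported M g \<Longrightarrow> supported M (f + g)"
  by (simp add: supported_def Rep_pfun_simps) (metis add.right_neutral)

lemma supported_scaleR: "supported M f \<Longrightarrow> supported M (c *\<^sub>R f)"
  by (auto simp: supported_def Rep_pfun_simps)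

lemma supported_minus: "supported M f \<Longrightarrow> supported M g \<Longrightarrow> supported M (f - g)"
  using supported_add[of M f "(-1) *\<^sub>R g"] supported_scaleR[of M g "-1"] by simp

lemma supported_zero: "supported M 0"
  by (simp add: supported_def Rep_pfun_simps)

lemma supported_sum: "(\<And>i. i \<in> A \<Longrightarrow> supported M (F i)) \<Longrightarrow> supported M (sum F A)"
  by (induction A rule: infinite_finite_induct) (auto intro: supported_zero supported_add)

lemma supported_D: "supported M f \<Longrightarrow> supported M (D i f)"
  using Rep_D_eq_0_outside[of f 0 M i] by (simp add: supported_def)

lemma supported_euler: "supported M f \<Longrightarrow> supported M (euler f)"
  unfolding euler_def by (intro supported_sum supported_mult(1) supported_D)

lemma supported_rot: "supported M f \<Longrightarrow> supported M (rot i j f)"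
  unfolding rot_def by (intro supported_minus supported_mult(1) supported_D)

lemma supported_lap: "supported M f \<Longrightarrow> supported M (lap f)"
  unfolding lap_def by (intro supported_sum supported_D)

lemma supported_sph_energy: "supported M f \<Longrightarrow> supported M (sph_energy f)"
  unfolding sph_energy_def by (intro supported_scaleR supported_sum supported_mult(1) supported_rot)

text \<open>The Riccati identity is available only up to radius \<open>M\<close>, which suffices
  because \<open>h\<close> vanishes beyond it.\<close>

lemma hardy_log:
  assumes \<phi>: "elem_smooth \<phi>" "elem_smooth \<Lambda>"
    "\<And>r. 0 < r \<Longrightarrow> r \<le> M \<Longrightarrow> deriv \<phi> (ln r) - \<phi> (ln r) * \<phi> (ln r) = \<Lambda> (ln r) / 4"
    and h: "annular h" "supported M h"
  shows "I (rad \<Lambda> * (h * h)) / 4 \<le> I (euler h * euler h)"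
proof -
  have "(rad (deriv \<phi>) - rad \<phi> * rad \<phi>) * (h * h) = (1/4) *\<^sub>R (rad \<Lambda> * (h * h))"
  proof (rule pfun_eqI)
    fix x :: "real^'a" assume "x \<noteq> 0"
    then show "Rep_pfun ((rad (deriv \<phi>) - rad \<phi> * rad \<phi>) * (h * h)) x = Rep_pfun ((1/4) *\<^sub>R (rad \<Lambda> * (h * h))) x"
      using \<phi>(3)[of "norm x"] h(2)
      by (cases "Rep_pfun h x = 0")
         (auto simp: supported_def Rep_pfun_simps Rep_pfun_minus Rep_rad \<phi> elem_smooth_deriv)
  qed
  then show ?thesis using hardy_weighted[OF \<phi>(1) h(1)] by (simp add: I_scaleR)
qed

lemma alpha_substitution:
  fixes a b \<gamma> :: real
  assumes "2 * a = 4 - real n - \<gamma>" "b = a + real n - 2"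
  shows "alpha n \<gamma> 0 = b\<^sup>2"
    and "j \<noteq> 0 \<Longrightarrow> alpha n \<gamma> j = (sph_eigenvalue n j - a * b)\<^sup>2 / (a\<^sup>2 + sph_eigenvalue n j)"
proof -
  have e: "real n - \<gamma> = 2 * b" "real n + \<gamma> - 4 = - 2 * a" using assms by linarith+
  show "alpha n \<gamma> 0 = b\<^sup>2" by (simp add: alpha_def e power2_eq_square)
  assume "j \<noteq> 0"
  then show "alpha n \<gamma> j = (sph_eigenvalue n j - a * b)\<^sup>2 / (a\<^sup>2 + sph_eigenvalue n j)"
    unfolding alpha_def e by (simp add: power2_eq_square)
qed

lemma sph_eigenvalue_pos: "n \<ge> 2 \<Longrightarrow> j \<noteq> 0 \<Longrightarrow> sph_eigenvalue n j > 0"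
  by (auto simp: sph_eigenvalue_def)

lemma real_hardy_rellich:
  fixes f :: "'n::finite pfun"
  assumes n: "CARD('n) \<ge> 2" and f: "annular f" "supported M f"
    and A: "\<And>j. A \<le> alpha CARD('n) \<gamma> j"
    and \<phi>: "elem_smooth \<phi>" "elem_smooth \<Lambda>"
    "\<And>r. 0 < r \<Longrightarrow> r \<le> M \<Longrightarrow> deriv \<phi> (ln r) - \<phi> (ln r) * \<phi> (ln r) = \<Lambda> (ln r) / 4"
  shows "I (rpow (\<gamma> + real CARD('n)) * (lap f * lap f)) \<ge>
     A * I (rpow (\<gamma> - 2 + real CARD('n)) * (\<Sum>i\<in>UNIV. D i f * D i f))
     + 1/4 * I (rad \<Lambda> * (rpow (\<gamma> - 2 + real CARD('n)) * (\<Sum>i\<in>UNIV. D i f * D i f)))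
     + 1/4 * I (rad \<Lambda> * (rpow (\<gamma> - 4 + real CARD('n)) * sph_energy f))"
proof -
  define a where "a = (4 - real CARD('n) - \<gamma>) / 2"
  define b where "b = a + real CARD('n) - 2"
  have a: "2 * a = 4 - real CARD('n) - \<gamma>" by (simp add: a_def)
  define g where "g = rpow (- a) * f"
  have fg: "f = rpow a * g"
    by (simp add: g_def mult.assoc[symmetric] rpow_mult rpow_0)
  define h where "h = euler g + a *\<^sub>R g"
  define L where "L = euler (euler g) + (a + b) *\<^sub>R euler g + (a * b) *\<^sub>R g + sph_lap g"
  define s where "s = sph_lap g"
  have g: "annular g" "supported M g" unfolding g_def using f by (auto intro: annular_mult supported_mult)
  have h: "annular h" "supported M h" unfolding h_def
    using g by (auto intro!: annular_intros supported_add supported_scaleR supported_euler)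
  have ann: "annular g" "annular (euler g)" "annular s" "annular (sph_energy g)" "annular (rad \<Lambda> * sph_energy g)"
    "annular (h * h)" "annular (rad \<Lambda> * (h * h))"
    using g h by (auto simp: s_def intro: annular_intros annular_mult)
  note lin = I_add I_scaleR annular_mult(1) annular_add annular_scaleR ann
  have hl: "I (rad \<Lambda> * (k * k)) / 4 \<le> I (euler k * euler k)" if "annular k" "supported M k" for k :: "'n pfun"
    by (rule hardy_log[OF \<phi>(1,2) _ that]) (rule \<phi>(3))
  have h1: "I (rad \<Lambda> * (h * h)) / 4 \<le> I (euler h * euler h)" by (rule hl[OF h])
  have h2: "I (rad \<Lambda> * sph_energy g) / 4 \<le> I (sph_energy (euler g))"
  proof -
    have "I (rad \<Lambda> * sph_energy g) / 4 =
        (1/2) * (\<Sum>i\<in>UNIV. \<Sum>j\<in>UNIV. I (rad \<Lambda> * (rot i j g * rot i j g)) / 4)"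
      using g by (simp add: sph_energy_def sum_distrib_left I_scaleR I_sum annular_sum annular_mult annular_rot sum_divide_distrib)
    also have "\<dots> \<le> (1/2) * (\<Sum>i\<in>UNIV. \<Sum>j\<in>UNIV. I (euler (rot i j g) * euler (rot i j g)))"
      by (intro mult_left_mono sum_mono hl annular_rot supported_rot g) simp
    also have "\<dots> = I (sph_energy (euler g))"
      using g by (simp add: sph_energy_def I_scaleR I_sum annular_sum annular_mult annular_intros euler_rot)
    finally show ?thesis .
  qed
  note alpha = alpha_substitution[OF a b_def]
  have Ab: "A \<le> b\<^sup>2" using A[of 0] alpha(1) by simp
  have eg: "A * I (euler g * euler g) \<le> b\<^sup>2 * I (euler g * euler g)"
    by (intro mult_right_mono Ab I_square_nonneg)
  \<comment> \<open>The coefficients are those of (m - ab)^2 - A(a^2 + m) as a polynomial in m. At m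
    = 0 its value is a^2 (b^2 - A), so the separate value b^2 of \<open>alpha\<close> at j = 0 is
    enough there, even if a = 0.\<close>
  have sp: "0 \<le> I (s * s) - (- (2 * (a * b) + A)) * I (g * s) + ((a * b)\<^sup>2 - A * a\<^sup>2) * I (g * g)"
    unfolding s_def
  proof (rule spectral_positive[OF n g(1)])
    fix l
    let ?m = "sph_eigenvalue CARD('n) l"
    have "A * (a\<^sup>2 + ?m) \<le> (?m - a * b)\<^sup>2"
    proof (cases "l = 0")
      case True
      then have "?m = 0" by (simp add: sph_eigenvalue_def)
      then show ?thesis using mult_right_mono[OF Ab, of "a\<^sup>2"] by (simp add: power_mult_distrib mult.commute)
    next
      case False
      then have "a\<^sup>2 + ?m > 0" using sph_eigenvalue_pos[OF n] by (simp add: add_nonneg_pos)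
      then show ?thesis using A[of l] alpha(2)[OF False] by (simp add: pos_le_divide_eq)
    qed
    then show "0 \<le> ?m\<^sup>2 + - (2 * (a * b) + A) * ?m + ((a * b)\<^sup>2 - A * a\<^sup>2)"
      by (simp add: power2_eq_square algebra_simps)
  qed
  have ge: "I (g * euler g) = 0"
    using I_euler_by_parts[of g g] g by (simp add: mult.commute)
  have hh: "I (h * h) = I (euler g * euler g) + a\<^sup>2 * I (g * g)"
  proof -
    have "h * h = euler g * euler g + (2 * a) *\<^sub>R (g * euler g) + a\<^sup>2 *\<^sub>R (g * g)"
      unfolding h_def by (simp add: scaleR_conv_of_real algebra_simps power2_eq_square)
    then show ?thesis by (simp add: lin ge)
  qed
  have gs: "I (((a * b) *\<^sub>R g + s) * ((a * b) *\<^sub>R g + s)) = (a * b)\<^sup>2 * I (g * g) + 2 * (a * b) * I (g * s) + I (s * s)"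
  proof -
    have "((a * b) *\<^sub>R g + s) * ((a * b) *\<^sub>R g + s) = (a * b)\<^sup>2 *\<^sub>R (g * g) + (2 * (a * b)) *\<^sub>R (g * s) + s * s"
      by (simp add: scaleR_conv_of_real algebra_simps power2_eq_square)
    then show ?thesis by (simp add: lin)
  qed
  note ps = power_substitution[OF fg a b_def h_def L_def]
  note fac = hardy_factorization[OF g(1) h_def L_def, folded s_def, unfolded gs]
  \<comment> \<open>The spherical logarithmic energy occurs twice, once inside the gradient term and
    once on its own; the two copies are absorbed by the factor 2 in \<open>fac\<close>.\<close>
  have "A * I (h * h + sph_energy g) + 1/4 * I (rad \<Lambda> * (h * h + sph_energy g)) + 1/4 * I (rad \<Lambda> * sph_energy g)
     = A * I (euler g * euler g) + A * a\<^sup>2 * I (g * g) - A * I (g * s) + I (rad \<Lambda> * (h * h)) / 4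
       + 2 * (I (rad \<Lambda> * sph_energy g) / 4)"
    using I_sph_energy[OF g(1)] by (simp add: distrib_left lin hh s_def[symmetric]) (simp add: algebra_simps)
  also have "\<dots> \<le> I (L * L)"
    unfolding fac using h1 h2 eg sp by (simp add: algebra_simps)
  finally show ?thesis unfolding ps .
qed

section \<open>From complex test functions to pairs of real ring elements\<close>

lemma smooth_directional: "smooth f \<Longrightarrow> smooth (\<lambda>x. frechet_derivative f (at x) v)"
  unfolding smooth_def by (metis k_times_cont_diff.simps(2))

lemma smooth_differentiable: "smooth f \<Longrightarrow> f differentiable (at x)"
  unfolding smooth_def by (metis k_times_cont_diff.simps(2))

lemma smooth_partial: "smooth f \<Longrightarrow> smooth (partial i f)"
  using smooth_directional[of f "axis i 1"] by (simp add: partial_def[abs_def])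

lemma pder_component:
  assumes "smooth f" "bounded_linear L"
  shows "pder i (\<lambda>x. of_bool (x \<noteq> 0) * L (f x)) = (\<lambda>x. of_bool (x \<noteq> 0) * L (partial i f x))"
proof
  fix x
  show "pder i (\<lambda>x. of_bool (x \<noteq> 0) * L (f x)) x = of_bool (x \<noteq> 0) * L (partial i f x)"
  proof (cases "x = 0")
    case False
    have "(f has_derivative frechet_derivative f (at x)) (at x)"
      using smooth_differentiable[OF assms(1)] by (simp add: frechet_derivative_works)
    then have "((\<lambda>x. L (f x)) has_derivative (\<lambda>h. L (frechet_derivative f (at x) h))) (at x)"
      by (rule bounded_linear.has_derivative[OF assms(2)])
    then have "pder i (\<lambda>x. L (f x)) x = L (partial i f x)"
      using False by (simp add: pder_eq partial_def)
    moreover have "pder i (\<lambda>x. of_bool (x \<noteq> 0) * L (f x)) = pder i (\<lambda>x. L (f x))"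
      by (rule pder_cong) simp
    ultimately show ?thesis using False by simp
  qed simp
qed

lemma smooth_punctured_component:
  fixes f :: "real^'n::finite \<Rightarrow> complex"
  assumes "smooth f" "bounded_linear L"
  shows "smooth_punctured (\<lambda>x. of_bool (x \<noteq> 0) * L (f x))"
  using assms(1)
proof (coinduction arbitrary: f rule: smooth_punctured.coinduct)
  case smooth_punctured
  have "(\<lambda>x. of_bool (x \<noteq> 0) * L (f x)) differentiable (at x)" if "x \<noteq> 0" for x
  proof -
    have "(f has_derivative frechet_derivative f (at x)) (at x)"
      using smooth_differentiable[OF smooth_punctured] by (simp add: frechet_derivative_works)
    then have "((\<lambda>x. L (f x)) has_derivative (\<lambda>h. L (frechet_derivative f (at x) h))) (at x)"
      by (rule bounded_linear.has_derivative[OF assms(2)])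
    then have "((\<lambda>x. of_bool (x \<noteq> 0) * L (f x)) has_derivative (\<lambda>h. L (frechet_derivative f (at x) h))) (at x)"
      by (rule has_derivative_transform_within_open[of _ _ _ _ "-{0}"]) (use that in auto)
    then show ?thesis by (auto simp: differentiable_def)
  qed
  then show ?case
    using pder_component[OF smooth_punctured assms(2)] smooth_partial[OF smooth_punctured] by blast
qed

text \<open>Used with the real and the imaginary part. All integrands are sums of squares over the
  two parts, so the complex inequality is the sum of two real ones.\<close>

definition component :: "(complex \<Rightarrow> real) \<Rightarrow> (real^'n::finite \<Rightarrow> complex) \<Rightarrow> 'n pfun" where
  "component L f = Abs_pfun (\<lambda>x. of_bool (x \<noteq> 0) * L (f x))"

lemma Rep_component:
  "smooth f \<Longrightarrow> bounded_linear L \<Longrightarrow> Rep_pfun (component L f) x = of_bool (x \<noteq> 0) * L (f x)"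
  unfolding component_def by (subst Abs_pfun_inverse) (auto simp: smooth_punctured_component)

lemma D_component:
  "smooth f \<Longrightarrow> bounded_linear L \<Longrightarrow> D i (component L f) = component L (partial i f)"
  by (rule pfun_eqI) (simp add: D.rep_eq Rep_component smooth_partial pder_component
      Rep_component[THEN ext, unfolded fun_eq_iff[symmetric]] ext[OF Rep_component])

lemma norm_laplacian_square:
  assumes "smooth f" "x \<noteq> 0"
  shows "(norm (- laplacian f x))\<^sup>2 = Rep_pfun (lap (component Re f) * lap (component Re f)
     + lap (component Im f) * lap (component Im f)) x"
proof -
  have "Rep_pfun (lap (component Re f)) x = Re (laplacian f x)" "Rep_pfun (lap (component Im f)) x = Im (laplacian f x)"
    using assms by (simp_all add: lap_def laplacian_def D_component smooth_partial bounded_linear_Re bounded_linear_Im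
        Rep_pfun_sum Rep_component)
  then show ?thesis
    unfolding norm_minus_cancel cmod_power2 by (simp only: Rep_pfun_simps power2_eq_square)
qed

lemma norm_grad_square:
  assumes "smooth f" "x \<noteq> 0"
  shows "(norm (grad f x))\<^sup>2 = Rep_pfun ((\<Sum>i\<in>UNIV. D i (component Re f) * D i (component Re f))
     + (\<Sum>i\<in>UNIV. D i (component Im f) * D i (component Im f))) x"
proof -
  have "(norm (grad f x))\<^sup>2 = (\<Sum>i\<in>UNIV. (norm (partial i f x))\<^sup>2)"
    by (simp add: norm_vec_def L2_set_def sum_nonneg grad_def)
  also have "\<dots> = (\<Sum>i\<in>UNIV. (Re (partial i f x))\<^sup>2) + (\<Sum>i\<in>UNIV. (Im (partial i f x))\<^sup>2)"
    by (simp add: cmod_power2 sum.distrib)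
  finally show ?thesis
    using assms by (simp add: D_component smooth_partial bounded_linear_Re bounded_linear_Im
        Rep_pfun_sum Rep_component Rep_pfun_simps power2_eq_square)
qed

text \<open>Both \<open>grad_polar\<close> and \<open>grad_square_eq\<close> split |x|^2
  |\<nabla>f|^2 into a radial and a spherical part. The radial parts agree with |Ef|^2, hence so do
  the spherical ones, and the map y / |y| need not be differentiated again.\<close>

lemma norm_sph_grad_square:
  fixes f :: "real^'n::finite \<Rightarrow> complex"
  assumes "smooth f" "x \<noteq> 0"
  shows "(norm (sph_grad f x))\<^sup>2 = Rep_pfun (sph_energy (component Re f) + sph_energy (component Im f)) x"
proof -
  let ?r = "norm x"
  let ?D = "frechet_derivative f (at x)"
  have D: "(f has_derivative ?D) (at x)"
    using smooth_differentiable[OF assms(1)] by (simp add: frechet_derivative_works)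
  have r: "?r > 0" using assms(2) by simp
  have "((\<lambda>s. s *\<^sub>R (x /\<^sub>R ?r)) has_derivative (\<lambda>h. h *\<^sub>R (x /\<^sub>R ?r))) (at ?r)"
    by (auto intro!: derivative_eq_intros)
  from diff_chain_at[OF this, of f ?D] D r
  have "((\<lambda>s. f (s *\<^sub>R (x /\<^sub>R ?r))) has_derivative (\<lambda>h. ?D (h *\<^sub>R (x /\<^sub>R ?r)))) (at ?r)"
    by (simp add: o_def)
  then have "((\<lambda>s. f (s *\<^sub>R (x /\<^sub>R ?r))) has_vector_derivative ?D (x /\<^sub>R ?r)) (at ?r)"
    using has_derivative_linear[OF D] by (simp add: has_vector_derivative_def linear_cmul)
  then have vd: "vector_derivative (\<lambda>s. f (s *\<^sub>R (x /\<^sub>R ?r))) (at ?r) = ?D x /\<^sub>R ?r"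
    using has_derivative_linear[OF D] by (simp add: vector_derivative_at linear_cmul)
  have "?D x = ?D (\<Sum>i\<in>UNIV. (x $ i) *\<^sub>R axis i 1)"
    using basis_expansion[of x] by (simp add: scalar_mult_eq_scaleR)
  also have "\<dots> = (\<Sum>i\<in>UNIV. (x $ i) *\<^sub>R partial i f x)"
    using has_derivative_linear[OF D] by (simp add: linear_sum linear_cmul partial_def)
  finally have Dx: "?D x = (\<Sum>i\<in>UNIV. (x $ i) *\<^sub>R partial i f x)" .
  have e: "Rep_pfun (euler (component Re f)) x = Re (?D x)" "Rep_pfun (euler (component Im f)) x = Im (?D x)"
    using assms by (simp_all add: Dx euler_def D_component smooth_partial bounded_linear_Re bounded_linear_Im
        Rep_pfun_sum Rep_component Rep_pfun_simps coord.rep_eq)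
  have "(norm (grad f x))\<^sup>2 = (norm (?D x))\<^sup>2 / ?r\<^sup>2 + (norm (sph_grad f x))\<^sup>2 / ?r\<^sup>2"
    using grad_polar[OF smooth_differentiable[OF assms(1)] assms(2)] r
    unfolding vd by (simp add: power_divide divide_inverse power_mult_distrib power_inverse)
  then have "(norm (sph_grad f x))\<^sup>2 = ?r\<^sup>2 * (norm (grad f x))\<^sup>2 - (norm (?D x))\<^sup>2"
    using r by (simp add: field_simps)
  also have "(norm (?D x))\<^sup>2 = Rep_pfun (euler (component Re f) * euler (component Re f)
      + euler (component Im f) * euler (component Im f)) x"
    unfolding cmod_power2 by (simp only: Rep_pfun_simps e power2_eq_square)
  also have "?r\<^sup>2 * (norm (grad f x))\<^sup>2 =
     Rep_pfun (rpow 2 * (\<Sum>i\<in>UNIV. D i (component Re f) * D i (component Re f))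
     + rpow 2 * (\<Sum>i\<in>UNIV. D i (component Im f) * D i (component Im f))) x"
    using r by (simp add: norm_grad_square[OF assms] Rep_pfun_simps Rep_rpow distrib_left)
  finally show ?thesis
    unfolding grad_square_eq by (simp add: Rep_pfun_simps)
qed

lemma set_integral_pfun:
  fixes K :: "'n::finite pfun"
  assumes "\<And>x. x \<noteq> 0 \<Longrightarrow> norm x < R \<Longrightarrow> F x = norm x powr (- real CARD('n)) * Rep_pfun K x"
    and "F 0 = 0" and "\<And>x. norm x \<ge> R \<Longrightarrow> Rep_pfun K x = 0"
  shows "(LINT x:ball 0 R|lborel. F x) = I K"
proof -
  have "indicator (ball 0 R) x *\<^sub>R F x = Rep_pfun (rpow (- real CARD('n)) * K) x" for x
    using assms(1)[of x] assms(2) assms(3)[of x]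
    by (cases "x = 0"; cases "norm x < R") (auto simp: indicator_def Rep_pfun_simps Rep_rpow)
  then show ?thesis unfolding I_def set_lebesgue_integral_def by simp
qed

lemma C0_infty_support:
  fixes f :: "real^'n::finite \<Rightarrow> complex"
  assumes "f \<in> C0_infty (ball 0 R - {0})" "R > 0"
  obtains m M where "0 < m" "0 < M" "M < R" "\<And>x. f x \<noteq> 0 \<Longrightarrow> m \<le> norm x \<and> norm x \<le> M"
proof -
  define K where "K = closure {x. f x \<noteq> 0}"
  have K: "compact K" "K \<subseteq> ball 0 R - {0}" and sub: "{x. f x \<noteq> 0} \<subseteq> K"
    using assms by (auto simp: C0_infty_def K_def intro: closure_subset[THEN subsetD])
  show thesis
  proof (cases "K = {}")
    case True
    show thesis by (rule that[of 1 "R / 2"]) (use sub True assms in auto)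
  next
    case False
    have c: "continuous_on K norm" by (intro continuous_intros)
    obtain x where x: "x \<in> K" "\<And>y. y \<in> K \<Longrightarrow> norm y \<le> norm x"
      using continuous_attains_sup[OF K(1) False c] by blast
    obtain z where z: "z \<in> K" "\<And>y. y \<in> K \<Longrightarrow> norm z \<le> norm y"
      using continuous_attains_inf[OF K(1) False c] by blast
    show thesis
      by (rule that[of "norm z" "norm x"]) (use x z K sub in auto)
  qed
qed

lemma supported_eq_0: "supported M w \<Longrightarrow> M < norm x \<Longrightarrow> Rep_pfun w x = 0"
  by (auto simp: supported_def not_le[symmetric])

lemma powr_card_split:
  fixes x :: "real^'n::finite"
  shows "norm x powr c = norm x powr - real CARD('n) * norm x powr (c + real CARD('n))"
  by (simp flip: powr_add)

lemma
  fixes f :: "real^'n::finite \<Rightarrow> complex"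
  assumes f: "smooth f" and supp: "supported M (component Re f)" "supported M (component Im f)" and MR: "M < R"
  shows integral_laplacian:
    "(LINT x:ball 0 R|lborel. norm x powr \<gamma> * (norm (- laplacian f x))\<^sup>2)
      = I (rpow (\<gamma> + real CARD('n)) * (lap (component Re f) * lap (component Re f)
          + lap (component Im f) * lap (component Im f)))" (is ?lap)
    and integral_grad:
    "(LINT x:ball 0 R|lborel. norm x powr \<gamma> * (norm (grad f x))\<^sup>2)
      = I (rpow (\<gamma> + real CARD('n)) * ((\<Sum>i\<in>UNIV. D i (component Re f) * D i (component Re f))
          + (\<Sum>i\<in>UNIV. D i (component Im f) * D i (component Im f))))" (is ?grad)
proof -
  have "Rep_pfun (K * (lap (component Re f) * lap (component Re f)
          + lap (component Im f) * lap (component Im f))) x = 0" if "R \<le> norm x" for K x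
    using supported_eq_0[OF supported_lap[OF supp(1)]] supported_eq_0[OF supported_lap[OF supp(2)]] that MR
    by (simp add: Rep_pfun_simps)
  then show ?lap
    by (intro set_integral_pfun)
       (auto simp: norm_laplacian_square[OF f] powr_card_split[of _ \<gamma>] times_pfun.rep_eq Rep_rpow mult.assoc
         simp del: norm_minus_cancel)
  have "Rep_pfun (K * ((\<Sum>i\<in>UNIV. D i (component Re f) * D i (component Re f))
          + (\<Sum>i\<in>UNIV. D i (component Im f) * D i (component Im f)))) x = 0" if "R \<le> norm x" for K x
    using supported_eq_0[OF supported_D[OF supp(1)]] supported_eq_0[OF supported_D[OF supp(2)]] that MR
    by (simp add: Rep_pfun_simps Rep_pfun_sum)
  then show ?grad
    by (intro set_integral_pfun)
       (auto simp: norm_grad_square[OF f] powr_card_split[of _ \<gamma>] times_pfun.rep_eq Rep_rpow mult.assoc)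
qed

lemma hardy_rellich_inequality:
  fixes f :: "real^'n::finite \<Rightarrow> complex"
  assumes R: "R > 0" and N: "N \<ge> 1" and n: "CARD('n) \<ge> 2" and \<eta>: "\<eta> \<ge> iter_exp N * R"
    and f: "f \<in> C0_infty (ball 0 R - {0})"
  shows "hardy_rellich (A_const CARD('n) \<gamma>) R \<gamma> N \<eta> f"
proof -
  let ?n = "real CARD('n)"
  have sm: "smooth f" using f by (simp add: C0_infty_def)
  obtain m M where mM: "0 < m" "0 < M" "M < R" "\<And>x. f x \<noteq> 0 \<Longrightarrow> m \<le> norm x \<and> norm x \<le> M"
    using C0_infty_support[OF f R] by metis
  obtain \<phi> \<Lambda> where \<phi>: "elem_smooth \<phi>" "elem_smooth \<Lambda>"
    "\<And>r. 0 < r \<Longrightarrow> r \<le> M \<Longrightarrow> deriv \<phi> (ln r) - \<phi> (ln r) * \<phi> (ln r) = \<Lambda> (ln r) / 4"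
    "\<And>r. 0 < r \<Longrightarrow> r \<le> M \<Longrightarrow> \<Lambda> (ln r) = log_weight N \<eta> r"
    using log_weight_potential[OF mM(2,3) \<eta> N] by metis
  define u where "u = component Re f"
  define v where "v = component Im f"
  have supp_L: "annular (component L f) \<and> supported M (component L f)" if L: "bounded_linear L" for L
  proof -
    have "f x \<noteq> 0" if "Rep_pfun (component L f) x \<noteq> 0" for x
      using that linear_0[OF bounded_linear.linear[OF L]] by (auto simp: Rep_component sm L)
    then show ?thesis using mM unfolding annular_def supported_def by blast
  qed
  have supp: "annular u" "supported M u" "annular v" "supported M v"
    unfolding u_def v_def using supp_L[OF bounded_linear_Re] supp_L[OF bounded_linear_Im] by auto
  define G where "G w = (\<Sum>i\<in>UNIV. D i w * D i w)" for w :: "'n pfun"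
  have ann: "annular (lap w)" "annular (G w)" "annular (sph_energy w)"
    and sup: "supported M (G w)" "supported M (sph_energy w)"
    if "annular w" "supported M w" for w
    using that by (auto simp: lap_def G_def intro!: annular_intros annular_mult supported_sum supported_mult(1)
        supported_D supported_sph_energy)
  note ineq = real_hardy_rellich[OF n _ _ A_const_le[OF n] \<phi>(1-3), folded G_def]
  have G0: "Rep_pfun (G u + G v) x = 0" "Rep_pfun (sph_energy u + sph_energy v) x = 0" if "norm x > M" for x
    using that supported_eq_0[OF sup(1)] supported_eq_0[OF sup(2)] supp by (simp_all add: Rep_pfun_simps)
  have out: "Rep_pfun (K * (G u + G v)) x = 0" "Rep_pfun (K * (sph_energy u + sph_energy v)) x = 0"
    if "R \<le> norm x" for K x
    using that mM(3) G0[of x] by (simp_all add: times_pfun.rep_eq)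
  \<comment> \<open>Beyond \<open>M\<close> the smooth potential \<Lambda> and the logarithmic
    weight may differ, but there the factor \<open>y\<close> is 0.\<close>
  have rL: "Rep_pfun (rad \<Lambda>) x * y = log_weight N \<eta> (norm x) * y" if "x \<noteq> 0" "norm x > M \<Longrightarrow> y = 0" for x :: "real^'n" and y
    using that \<phi>(4)[of "norm x"] by (cases "norm x > M") (auto simp: Rep_rad \<phi>(2) not_less)
  note 1 = integral_laplacian[OF sm supp(2,4)[unfolded u_def v_def] mM(3), of \<gamma>, folded u_def v_def]
  note 2 = integral_grad[OF sm supp(2,4)[unfolded u_def v_def] mM(3), of "\<gamma> - 2", folded u_def v_def G_def]
  have 3: "(LINT x:ball 0 R|lborel. norm x powr (\<gamma> - 2) * log_weight N \<eta> (norm x) * (norm (grad f x))\<^sup>2)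
      = I ((rad \<Lambda> * rpow (\<gamma> - 2 + ?n)) * (G u + G v))"
    by (rule set_integral_pfun[OF _ _ out(1)])
       (auto simp: norm_grad_square[OF sm] u_def[symmetric] v_def[symmetric] G_def[symmetric] powr_card_split[of _ "\<gamma> - 2"]
         times_pfun.rep_eq Rep_rpow mult.assoc mult.left_commute[of _ "Rep_pfun (rad \<Lambda>) _"] rL[OF _ G0(1)]
         mult.left_commute[of "log_weight N \<eta> _"])
  have 4: "(LINT x:ball 0 R|lborel. norm x powr (\<gamma> - 4) * log_weight N \<eta> (norm x) * (norm (sph_grad f x))\<^sup>2)
      = I ((rad \<Lambda> * rpow (\<gamma> - 4 + ?n)) * (sph_energy u + sph_energy v))"
    by (rule set_integral_pfun[OF _ _ out(2)])
       (auto simp: norm_sph_grad_square[OF sm] u_def[symmetric] v_def[symmetric] powr_card_split[of _ "\<gamma> - 4"]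
         times_pfun.rep_eq Rep_rpow mult.assoc mult.left_commute[of _ "Rep_pfun (rad \<Lambda>) _"] rL[OF _ G0(2)]
         mult.left_commute[of "log_weight N \<eta> _"])
  show ?thesis
    unfolding hardy_rellich_def 1 2 3 4
    using ineq[OF supp(1,2), of \<gamma>] ineq[OF supp(3,4), of \<gamma>] ann[OF supp(1,2)] ann[OF supp(3,4)]
    by (simp add: distrib_left I_add annular_mult mult.assoc)
qed

section \<open>Optimality\<close>

text \<open>The real and imaginary parts of the complex power (x_a + i x_b)^j.\<close>

primrec harmonic_pair :: "'n \<Rightarrow> 'n \<Rightarrow> nat \<Rightarrow> 'n::finite pfun \<times> 'n pfun" where
  "harmonic_pair a b 0 = (1, 0)"
| "harmonic_pair a b (Suc j) = (let (p, q) = harmonic_pair a b j in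
     (coord a * p - coord b * q, coord a * q + coord b * p))"

lemma hompoly_uminus: "hompoly d f \<Longrightarrow> hompoly d (- f)"
  using hompoly_scaleR[of d f "-1"] by simp

lemma hompoly_minus: "hompoly d f \<Longrightarrow> hompoly d g \<Longrightarrow> hompoly d (f - g)"
  using hompoly_add[of d f "- g"] hompoly_uminus[of d g] by simp

lemma lap_coord_mult: "lap (coord a * f) = 2 *\<^sub>R D a f + coord a * lap f"
proof -
  have "lap (coord a * f) = (\<Sum>i\<in>UNIV. coord a * D i (D i f)) + (\<Sum>i\<in>UNIV. of_bool (i = a) * D i f)
      + (\<Sum>i\<in>UNIV. of_bool (i = a) * D i f)"
    unfolding lap_def sum.distrib[symmetric]
    by (intro sum.cong refl) (auto simp: D_simps D_zero D_one)
  then show ?thesis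
    by (simp add: sum_of_bool_mult lap_def sum_distrib_left scaleR_2)
qed

lemma lap_add: "lap (f + g) = lap f + lap g" and lap_minus: "lap (f - g) = lap f - lap g"
  by (simp_all add: lap_def D_simps sum.distrib sum_subtractf)

text \<open>The Cauchy-Riemann equations are carried through the induction because the new
  Laplacians reduce to 2(D a p - D b q) and 2(D a q + D b p). The values on the axis show that
  \<open>p\<close> is not zero.\<close>

lemma harmonic_pair_props:
  assumes "a \<noteq> b" "harmonic_pair a b j = (p, q)"
  shows "hompoly j p \<and> hompoly j q \<and> D a p = D b q \<and> D b p = - D a q \<and> lap p = 0 \<and> lap q = 0
    \<and> (\<forall>r>0. Rep_pfun p (r *\<^sub>R axis a 1) = r ^ j \<and> Rep_pfun q (r *\<^sub>R axis a 1) = 0)"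
  using assms(2)
proof (induction j arbitrary: p q)
  case 0
  then have "p = 1" "q = 0" by auto
  then show ?case
    using hompoly_const[of 1] by (auto simp: D_one D_zero lap_def hompoly_zero Rep_pfun_one Rep_pfun_simps axis_eq_0_iff)
next
  case (Suc j)
  obtain p' q' where pq: "harmonic_pair a b j = (p', q')" by force
  have p: "p = coord a * p' - coord b * q'" and q: "q = coord a * q' + coord b * p'"
    using Suc.prems by (auto simp: pq)
  have IH: "hompoly j p'" "hompoly j q'" "D a p' = D b q'" "D b p' = - D a q'" "lap p' = 0" "lap q' = 0"
    "\<And>r. r > 0 \<Longrightarrow> Rep_pfun p' (r *\<^sub>R axis a 1) = r ^ j" "\<And>r. r > 0 \<Longrightarrow> Rep_pfun q' (r *\<^sub>R axis a 1) = 0"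
    using Suc.IH[OF pq] by auto
  have "hompoly (Suc j) p" "hompoly (Suc j) q"
    unfolding p q by (intro hompoly_minus hompoly_add hompoly_coord IH)+
  moreover have "D a p = D b q" "D b p = - D a q"
    using assms(1) IH(3,4) by (simp_all add: p q D_simps algebra_simps)
  moreover have "lap p = 0" "lap q = 0"
    unfolding p q using IH(3-6) by (simp_all add: lap_add lap_minus lap_coord_mult)
  moreover have "Rep_pfun p (r *\<^sub>R axis a 1) = r ^ Suc j" "Rep_pfun q (r *\<^sub>R axis a 1) = 0" if "r > 0" for r
    using IH(7,8)[OF that] assms(1) by (simp_all add: p q Rep_pfun_simps Rep_pfun_minus coord.rep_eq axis_def)
  ultimately show ?case by blast
qed

text \<open>Dividing by |x|^j makes the harmonic polynomial constant along rays without changing its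
  eigenvalue. The normalization on one ray is there to guarantee positive integrals later.\<close>

lemma spherical_harmonic_exists:
  assumes n: "CARD('n::finite) \<ge> 2"
  obtains Y :: "'n::finite pfun" and e :: "real^'n::finite" where "euler Y = 0"
    "sph_lap Y = - sph_eigenvalue CARD('n) j *\<^sub>R Y" "norm e = 1" "\<And>r. r > 0 \<Longrightarrow> Rep_pfun Y (r *\<^sub>R e) = 1"
proof -
  obtain a b :: 'n where ab: "a \<noteq> b"
    using n card_le_Suc0_iff_eq[of "UNIV :: 'n set"] by force
  obtain p q where pq: "harmonic_pair a b j = (p, q)" by force
  note props = harmonic_pair_props[OF ab pq]
  define Y where "Y = rpow (- real j) * p"
  have "euler Y = 0"
    using hompoly_euler[of j p] props by (simp add: Y_def euler_simps euler_rpow)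
  moreover have "sph_lap Y = - sph_eigenvalue CARD('n) j *\<^sub>R Y"
    using sph_lap_hompoly[of j p] props by (simp add: Y_def sph_lap_rpow_mult)
  moreover have "Rep_pfun Y (r *\<^sub>R axis a 1) = 1" if "r > 0" for r
    using props that by (simp add: Y_def Rep_pfun_simps Rep_rpow norm_axis_1 powr_minus powr_realpow)
  ultimately show thesis using that[of Y "axis a 1"] by (simp add: norm_axis_1)
qed

section \<open>Scaling of radial factors and energies of test functions\<close>

text \<open>The integrand is continuous, so it is nonzero on a nonempty open set, and such a set is
  not negligible.\<close>

lemma I_pos:
  fixes f :: "'n::finite pfun"
  assumes f: "annular f" "\<And>x. Rep_pfun f x \<ge> 0" and x: "Rep_pfun f x > 0"
  shows "I f > 0"
proof (rule ccontr)
  let ?F = "Rep_pfun (rpow (- real CARD('n)) * f)"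
  have ann: "annular (rpow (- real CARD('n)) * f)" using f by (intro annular_mult)
  assume "\<not> I f > 0"
  then have "integral\<^sup>L lborel ?F = 0" using I_nonneg[OF f(2)] by (simp add: I_def)
  moreover have "AE x in lborel. 0 \<le> ?F x"
    using f(2) by (intro AE_I2) (simp add: Rep_pfun_simps Rep_rpow)
  ultimately have "AE x in lborel. ?F x = 0"
    using integral_nonneg_eq_0_iff_AE[OF annular_integrable[OF ann]] by blast
  then obtain N where N: "N \<in> null_sets lborel" "{x. ?F x \<noteq> 0} \<subseteq> N"
    by (auto elim!: AE_E simp: null_sets_def)
  have "open {x. ?F x \<noteq> 0}"
    by (rule open_Collect_neq[OF annular_continuous[OF ann] continuous_on_const])
  moreover have "{x. ?F x \<noteq> 0} \<noteq> {}"
    using x by (auto simp: Rep_pfun_simps Rep_rpow intro!: exI[of _ x])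
  moreover have "negligible {x. ?F x \<noteq> 0}"
    using N negligible_iff_null_sets negligible_subset null_sets_completionI by blast
  ultimately show False using open_not_negligible by blast
qed

lemma continuous_antiderivative:
  fixes \<rho> :: "real \<Rightarrow> real"
  assumes cont: "continuous_on UNIV \<rho>" and supp: "\<And>t. t \<le> s1 \<or> s2 \<le> t \<Longrightarrow> \<rho> t = 0" and s: "s1 < s2"
  obtains \<Phi> c where "\<And>t. (\<Phi> has_real_derivative \<rho> t) (at t)" "\<And>t. t \<le> s1 \<Longrightarrow> \<Phi> t = 0"
    "\<And>t. s2 \<le> t \<Longrightarrow> \<Phi> t = c"
proof -
  define \<Phi> where "\<Phi> t = integral {s1..t} \<rho>" for t
  have left: "\<Phi> t = 0" if "t \<le> s1" for t
    using that by (cases "t = s1") (auto simp: \<Phi>_def)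
  \<comment> \<open>Starting the integral at s1 - 1 makes s1 an interior point, so that the
    two-sided derivative exists there as well.\<close>
  have shift: "\<Phi> t = integral {s1 - 1..t} \<rho>" if "s1 - 1 \<le> t" for t
  proof -
    have z: "integral {s1 - 1..u} \<rho> = 0" if "u \<le> s1" for u
      using integral_cong[of "{s1 - 1..u}" \<rho> "\<lambda>_. 0"] supp that by auto
    show ?thesis
    proof (cases "t \<le> s1")
      case True
      then show ?thesis using z left by simp
    next
      case False
      have "integral {s1 - 1..s1} \<rho> + integral {s1..t} \<rho> = integral {s1 - 1..t} \<rho>"
        using False cont by (intro Henstock_Kurzweil_Integration.integral_combine integrable_continuous_real)
           (auto intro: continuous_on_subset)
      then show ?thesis using z by (simp add: \<Phi>_def)
    qed
  qed
  have der: "(\<Phi> has_real_derivative \<rho> t) (at t)" for t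
  proof (cases "t < s1")
    case True
    have "(\<Phi> has_real_derivative 0) (at t)"
      by (rule has_field_derivative_transform_within_open[of "\<lambda>_. 0" _ _ "{..<s1}"])
         (use True left in auto)
    then show ?thesis using supp[of t] True by simp
  next
    case False
    have "((\<lambda>u. integral {s1 - 1..u} \<rho>) has_real_derivative \<rho> t) (at t within {s1 - 1..t + 1})"
      using cont False by (intro integral_has_real_derivative) (auto intro: continuous_on_subset)
    then have "((\<lambda>u. integral {s1 - 1..u} \<rho>) has_real_derivative \<rho> t) (at t)"
      using False by (subst (asm) at_within_interior) auto
    then show ?thesis
      by (rule has_field_derivative_transform_within_open[of _ _ _ "{s1 - 1<..}"])
         (use False shift in auto)
  qed
  have "\<Phi> t = \<Phi> s2" if "s2 \<le> t" for t
  proof -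
    have "\<exists>c. \<forall>t\<in>{s2..}. \<Phi> t = c"
    proof (rule has_field_derivative_zero_constant)
      fix t assume "t \<in> {s2..}"
      then show "(\<Phi> has_real_derivative 0) (at t within {s2..})"
        using der[of t] supp[of t] by (auto intro: has_field_derivative_at_within)
    qed simp
    then show ?thesis using that by auto
  qed
  with der left show thesis using that by blast
qed

lemma annular_rad:
  assumes "elem_smooth \<phi>" "\<And>t. t \<le> s1 \<or> s2 \<le> t \<Longrightarrow> \<phi> t = 0"
  shows "annular (rad \<phi>)"
  unfolding annular_def
proof (intro exI conjI allI impI)
  show "0 < exp s1" by simp
  fix x assume "Rep_pfun (rad \<phi>) x \<noteq> 0"
  then have x: "x \<noteq> 0" "\<phi> (ln (norm x)) \<noteq> 0" using assms(1) by (auto simp: Rep_rad)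
  then have "s1 \<le> ln (norm x)" "ln (norm x) \<le> s2" using assms(2)[of "ln (norm x)"] by linarith+
  then show "exp s1 \<le> norm x" "norm x \<le> exp s2"
    using x by (metis exp_le_cancel_iff exp_ln zero_less_norm_iff)+
qed

text \<open>
  Scaling in \<open>t = ln r\<close> without polar coordinates: the difference of the two radial factors is
  the derivative of a compactly supported function, and \<open>I\<close> annihilates \<open>euler\<close>.
\<close>

lemma I_rad_scale:
  fixes K :: "'n::finite pfun"
  assumes \<rho>: "elem_smooth \<rho>" "\<And>t. t \<le> s1 \<or> s2 \<le> t \<Longrightarrow> \<rho> t = 0" and K: "euler K = 0" and e: "\<epsilon> > 0"
  shows "I (rad (\<lambda>t. \<rho> (1 * t + d')) * K) = \<epsilon> * I (rad (\<lambda>t. \<rho> (\<epsilon> * t + d)) * K)"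
proof -
  have \<rho>': "\<rho> t = 0" if "t \<le> s1 \<or> max s2 (s1 + 1) \<le> t" for t using that \<rho>(2) by auto
  obtain \<Phi> c where \<Phi>: "\<And>t. (\<Phi> has_real_derivative \<rho> t) (at t)" "\<And>t. t \<le> s1 \<Longrightarrow> \<Phi> t = 0"
    "\<And>t. max s2 (s1 + 1) \<le> t \<Longrightarrow> \<Phi> t = c"
    using continuous_antiderivative[OF elem_smooth_continuous[OF \<rho>(1)] \<rho>'] by (metis less_add_one less_max_iff_disj)
  have el: "elem_smooth \<Phi>" using \<rho>(1) \<Phi>(1) by (rule elem_antiderivative)
  define s where "s = max s2 (s1 + 1)"
  \<comment> \<open>Both antiderivatives are 0 far to the left and reach the same constant
    \<open>c\<close> far to the right, so their difference has compact support although neither need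
    have it.\<close>
  define F where "F = (\<lambda>t. \<Phi> (\<epsilon> * t + d) + (-1) * \<Phi> (1 * t + d'))"
  have F: "elem_smooth F" unfolding F_def by (intro elem_add elem_mult elem_const elem_affine el)
  have "F t = 0" if "t \<le> min (s1 - d') ((s1 - d) / \<epsilon>) \<or> max (s - d') ((s - d) / \<epsilon>) \<le> t" for t
    using that
  proof
    assume "t \<le> min (s1 - d') ((s1 - d) / \<epsilon>)"
    then have "1 * t + d' \<le> s1" "\<epsilon> * t + d \<le> s1" using e by (auto simp: pos_le_divide_eq mult.commute)
    then show ?thesis by (simp add: F_def \<Phi>(2))
  next
    assume "max (s - d') ((s - d) / \<epsilon>) \<le> t"
    then have "s \<le> 1 * t + d'" "s \<le> \<epsilon> * t + d" using e by (auto simp: pos_divide_le_eq mult.commute)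
    then show ?thesis using \<Phi>(3) by (simp add: F_def s_def)
  qed
  then have annF: "annular (rad F :: 'n pfun)" by (intro annular_rad[OF F])
  have "(F has_real_derivative \<epsilon> * \<rho> (\<epsilon> * t + d) + (-1) * \<rho> (1 * t + d')) (at t)" for t
    unfolding F_def
    by (rule DERIV_chain2[OF \<Phi>(1), THEN DERIV_cong] derivative_eq_intros refl | simp)+
  then have dF: "deriv F = (\<lambda>t. \<epsilon> * \<rho> (\<epsilon> * t + d) + (-1) * \<rho> (1 * t + d'))"
    by (intro ext DERIV_imp_deriv)
  have r1: "elem_smooth (\<lambda>t. \<rho> (\<epsilon> * t + d))" and r2: "elem_smooth (\<lambda>t. \<rho> (1 * t + d'))"
    by (rule elem_affine[OF \<rho>(1)])+
  have split: "rad (deriv F) = \<epsilon> *\<^sub>R rad (\<lambda>t. \<rho> (\<epsilon> * t + d)) - (rad (\<lambda>t. \<rho> (1 * t + d')) :: 'n pfun)"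
  proof (rule pfun_eqI)
    fix x :: "real^'n"
    have "elem_smooth (\<lambda>t. \<epsilon> * \<rho> (\<epsilon> * t + d) + (-1) * \<rho> (1 * t + d'))"
      by (intro elem_add elem_mult elem_const r1 r2)
    from Rep_rad[OF this, of x] Rep_rad[OF r1, of x] Rep_rad[OF r2, of x]
    show "Rep_pfun (rad (deriv F)) x
        = Rep_pfun (\<epsilon> *\<^sub>R rad (\<lambda>t. \<rho> (\<epsilon> * t + d)) - rad (\<lambda>t. \<rho> (1 * t + d'))) x"
      unfolding dF Rep_pfun_minus scaleR_pfun.rep_eq by (simp only: algebra_simps)
  qed
  have a1: "annular (rad (\<lambda>t. \<rho> (\<epsilon> * t + d)) :: 'n pfun)"
    by (rule annular_rad[OF r1, of "(s1 - d) / \<epsilon>" "(s2 - d) / \<epsilon>"])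
       (use e in \<open>auto intro!: \<rho>(2) simp: field_simps\<close>)
  have a2: "annular (rad (\<lambda>t. \<rho> (1 * t + d')) :: 'n pfun)"
    by (rule annular_rad[OF r2, of "s1 - d'" "s2 - d'"]) (auto intro!: \<rho>(2))
  have "0 = I (euler (rad F * K))" using annF by (simp add: I_euler annular_mult)
  also have "euler (rad F * K) = rad (deriv F) * K" by (simp add: euler_simps K euler_rad[OF F])
  also have "I \<dots> = \<epsilon> * I (rad (\<lambda>t. \<rho> (\<epsilon> * t + d)) * K) - I (rad (\<lambda>t. \<rho> (1 * t + d')) * K)"
    unfolding split left_diff_distrib mult_scaleR_left
    using a1 a2 by (subst I_minus) (auto simp: I_scaleR intro: annular_mult(1) annular_scaleR)
  finally show ?thesis by simp
qed

text \<open>On one eigenspace \<Delta>_S acts as -m, and the energies become combinations of the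
  norms of g, Eg and E^2 g; the coefficients are those of the polynomials in xi^2 that describe the
  two sides.\<close>

lemma eigenfunction_energies:
  fixes g :: "'n::finite pfun"
  assumes g: "annular g" and eig: "sph_lap g = - m *\<^sub>R g" and h: "h = euler g + a *\<^sub>R g" and
    L: "L = euler (euler g) + (a + b) *\<^sub>R euler g + (a * b) *\<^sub>R g + sph_lap g"
  shows "I (L * L) = I (euler (euler g) * euler (euler g)) + (a\<^sup>2 + b\<^sup>2 + 2 * m) * I (euler g * euler g)
      + (a * b - m)\<^sup>2 * I (g * g)"
    and "I (h * h + sph_energy g) = I (euler g * euler g) + (a\<^sup>2 + m) * I (g * g)"
proof -
  define e where "e = euler g"
  define c where "c = euler e"
  have ann: "annular g" "annular e" "annular c" "annular (sph_energy g)"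
    using g by (auto simp: e_def c_def intro: annular_intros)
  note lin = I_add I_scaleR annular_mult(1) annular_add annular_scaleR ann
  have ge: "I (g * e) = 0"
    using I_euler_by_parts[of g g] g by (simp add: e_def mult.commute)
  have ec: "I (e * c) = 0"
    using I_euler_by_parts[of e e] ann by (simp add: c_def mult.commute)
  have en: "I (sph_energy w) = m * I (w * w)" if "annular w" "sph_lap w = - m *\<^sub>R w" for w :: "'n pfun"
    using I_sph_energy[OF that(1)] by (simp add: that(2) I_scaleR I_uminus)
  have eige: "sph_lap e = - m *\<^sub>R e"
    unfolding e_def by (simp add: sph_lap_euler eig euler_simps)
  have "euler h * euler h = c * c + (2 * a) *\<^sub>R (e * c) + a\<^sup>2 *\<^sub>R (e * e)"
    unfolding h by (simp add: euler_simps e_def[symmetric] c_def[symmetric])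
       (simp add: scaleR_conv_of_real algebra_simps power2_eq_square)
  then have 1: "I (euler h * euler h) = I (c * c) + a\<^sup>2 * I (e * e)" by (simp add: lin ec)
  have "(a * b) *\<^sub>R g + sph_lap g = (a * b - m) *\<^sub>R g" by (simp add: eig scaleR_diff_left)
  then have 2: "I (((a * b) *\<^sub>R g + sph_lap g) * ((a * b) *\<^sub>R g + sph_lap g)) = (a * b - m)\<^sup>2 * I (g * g)"
    by (simp add: I_scaleR power2_eq_square)
  show "I (L * L) = I (euler (euler g) * euler (euler g)) + (a\<^sup>2 + b\<^sup>2 + 2 * m) * I (euler g * euler g)
      + (a * b - m)\<^sup>2 * I (g * g)"
    using hardy_factorization[OF g h L] 1 2 en[OF ann(2) eige]
    by (simp add: e_def[symmetric] c_def[symmetric] algebra_simps)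
  have "h * h = e * e + (2 * a) *\<^sub>R (g * e) + a\<^sup>2 *\<^sub>R (g * g)"
    unfolding h e_def by (simp add: scaleR_conv_of_real algebra_simps power2_eq_square)
  then show "I (h * h + sph_energy g) = I (euler g * euler g) + (a\<^sup>2 + m) * I (g * g)"
    using en[OF g eig] by (simp add: lin ge e_def[symmetric]) (simp add: algebra_simps)
qed

lemma smooth_pfun:
  fixes u :: "'n::finite pfun"
  assumes "annular u"
  shows "smooth (\<lambda>x. complex_of_real (Rep_pfun u x))"
proof -
  have "k_times_cont_diff k (\<lambda>x. complex_of_real (Rep_pfun u x))" if "annular u" for k and u :: "'n pfun"
    using that
  proof (induction k arbitrary: u)
    case 0
    then show ?case by (auto intro: continuous_on_of_real annular_continuous)
  next
    case (Suc k)
    have der: "((\<lambda>x. complex_of_real (Rep_pfun u x)) has_derivative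
        (\<lambda>h. complex_of_real (\<Sum>i\<in>UNIV. h $ i * Rep_pfun (D i u) x))) (at x)" for x
      by (rule has_derivative_of_real[OF annular_has_derivative[OF Suc.prems]])
    have "(\<lambda>x. frechet_derivative (\<lambda>x. complex_of_real (Rep_pfun u x)) (at x) v)
        = (\<lambda>x. complex_of_real (Rep_pfun (\<Sum>i\<in>UNIV. (v $ i) *\<^sub>R D i u) x))" for v
      by (rule ext) (simp add: frechet_derivative_at[OF der, symmetric] Rep_pfun_sum scaleR_pfun.rep_eq)
    moreover have "annular (\<Sum>i\<in>UNIV. (v $ i) *\<^sub>R D i u)" for v
      by (intro annular_intros Suc.prems)
    ultimately have "k_times_cont_diff k (\<lambda>x. frechet_derivative (\<lambda>x. complex_of_real (Rep_pfun u x)) (at x) v)" for v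
      using Suc.IH by presburger
    moreover have "(\<lambda>x. complex_of_real (Rep_pfun u x)) differentiable (at x)" for x
      using der[of x] by (auto simp: differentiable_def)
    ultimately show ?case by simp
  qed
  with assms show ?thesis by (simp add: smooth_def)
qed

lemma pfun_C0_infty:
  fixes u :: "'n::finite pfun"
  assumes "0 < m" "M < R" and u: "\<And>x. Rep_pfun u x \<noteq> 0 \<Longrightarrow> m \<le> norm x \<and> norm x \<le> M"
  shows "(\<lambda>x. complex_of_real (Rep_pfun u x)) \<in> C0_infty (ball 0 R - {0})"
proof -
  have ann: "annular u" using assms by (auto simp: annular_def)
  define K where "K = cball 0 M - ball (0::real^'n) m"
  have K: "compact K" unfolding K_def by (intro compact_diff) auto
  have "{x. complex_of_real (Rep_pfun u x) \<noteq> 0} \<subseteq> K"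
  proof
    fix x assume "x \<in> {x. complex_of_real (Rep_pfun u x) \<noteq> 0}"
    then show "x \<in> K" using u[of x] by (simp add: K_def)
  qed
  then have cl: "closure {x. complex_of_real (Rep_pfun u x) \<noteq> 0} \<subseteq> K"
    by (intro closure_minimal compact_imp_closed K)
  have "compact (closure {x. complex_of_real (Rep_pfun u x) \<noteq> 0})"
    using cl K compact_imp_bounded bounded_subset compact_closure closure_closure
    by (metis closed_closure compact_eq_bounded_closed)
  moreover have "K \<subseteq> ball 0 R - {0}" using assms by (auto simp: K_def)
  ultimately show ?thesis
    using cl smooth_pfun[OF ann] by (auto simp: C0_infty_def)
qed

lemma log_weight_nonneg: "log_weight N \<eta> r \<ge> 0"
  unfolding log_weight_def by (intro sum_nonneg prod_nonneg) (auto simp: power_int_minus)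

text \<open>To bound the constant from above, the logarithmic terms may be dropped, since they are
  nonnegative.\<close>

lemma hardy_rellich_real_test:
  fixes u :: "'n::finite pfun"
  assumes "0 < m" "M < R" and u: "\<And>x. Rep_pfun u x \<noteq> 0 \<Longrightarrow> m \<le> norm x \<and> norm x \<le> M"
    and hr: "hardy_rellich C R \<gamma> N \<eta> (\<lambda>x. complex_of_real (Rep_pfun u x))"
  shows "C * I (rpow (\<gamma> - 2 + real CARD('n)) * (\<Sum>i\<in>UNIV. D i u * D i u))
    \<le> I (rpow (\<gamma> + real CARD('n)) * (lap u * lap u))"
proof -
  let ?f = "\<lambda>x. complex_of_real (Rep_pfun u x)"
  have ann: "annular u" and sup: "supported M u" using assms by (auto simp: annular_def supported_def)
  have sm: "smooth ?f" by (rule smooth_pfun[OF ann])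
  have re: "component Re ?f = u" and im: "component Im ?f = 0"
    by (rule pfun_eqI, simp add: Rep_component[OF sm] bounded_linear_Re bounded_linear_Im zero_pfun.rep_eq)+
  have sup0: "supported M (component Re ?f)" "supported M (component Im ?f)"
    by (simp_all add: re im sup supported_zero)
  have z: "lap (0::'n pfun) = 0" "D i (0::'n pfun) = 0" for i by (simp_all add: lap_def D_zero)
  have 1: "0 \<le> (LINT x:ball 0 R|lborel. norm x powr (\<gamma> - 2) * log_weight N \<eta> (norm x) * (norm (grad ?f x))\<^sup>2)"
    and 2: "0 \<le> (LINT x:ball 0 R|lborel. norm x powr (\<gamma> - 4) * log_weight N \<eta> (norm x) * (norm (sph_grad ?f x))\<^sup>2)"
    unfolding set_lebesgue_integral_def
    by (intro integral_nonneg_AE AE_I2 scaleR_nonneg_nonneg mult_nonneg_nonneg log_weight_nonneg; simp)+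
  show ?thesis
    using hr 1 2 integral_laplacian[OF sm sup0 assms(2), of \<gamma>] integral_grad[OF sm sup0 assms(2), of "\<gamma> - 2"]
    unfolding hardy_rellich_def re im z by simp
qed

text \<open>J0, J1, J2 stand for the squared norms of a profile and its first two derivatives.
  Normally \<epsilon> = 0 in the limit compares the terms with J0. If s = 0 these disappear on both
  sides, and the comparison takes place at order \<epsilon>^2 instead, yielding p.\<close>

lemma test_inequality:
  fixes C J0 J1 J2 p q s :: real
  assumes ineq: "\<And>\<epsilon>. \<epsilon> > 0 \<Longrightarrow> C * (\<epsilon>\<^sup>2 * J1 + s * J0) \<le> \<epsilon> ^ 4 * J2 + p * (\<epsilon>\<^sup>2 * J1) + q * J0"
    and J: "J0 > 0" "J1 > 0" and s: "s \<ge> 0" "s = 0 \<Longrightarrow> q = 0"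
  shows "if s = 0 then C \<le> p else C \<le> q / s"
proof (cases "s = 0")
  case True
  have le: "C * J1 \<le> \<epsilon>\<^sup>2 * J2 + p * J1" if "\<epsilon> > 0" for \<epsilon>
  proof -
    have "\<epsilon>\<^sup>2 * (C * J1) \<le> \<epsilon>\<^sup>2 * (\<epsilon>\<^sup>2 * J2 + p * J1)"
      using ineq[OF that] True s(2) by (simp add: algebra_simps power4_eq_xxxx power2_eq_square)
    then show ?thesis using that by simp
  qed
  have "((\<lambda>\<epsilon>. \<epsilon>\<^sup>2 * J2 + p * J1) \<longlongrightarrow> 0\<^sup>2 * J2 + p * J1) (at_right 0)"
    by (intro tendsto_intros)
  then have "C * J1 \<le> 0\<^sup>2 * J2 + p * J1"
    by (rule tendsto_lowerbound) (auto intro!: eventually_at_rightI[of 0 1] le)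
  then show ?thesis using J True by simp
next
  case False
  have "((\<lambda>\<epsilon>. \<epsilon> ^ 4 * J2 + p * (\<epsilon>\<^sup>2 * J1) + q * J0 - C * (\<epsilon>\<^sup>2 * J1 + s * J0)) \<longlongrightarrow>
      0 ^ 4 * J2 + p * (0\<^sup>2 * J1) + q * J0 - C * (0\<^sup>2 * J1 + s * J0)) (at_right 0)"
    by (intro tendsto_intros)
  then have "0 \<le> 0 ^ 4 * J2 + p * (0\<^sup>2 * J1) + q * J0 - C * (0\<^sup>2 * J1 + s * J0)"
    by (rule tendsto_lowerbound) (auto intro!: eventually_at_rightI[of 0 1] ineq)
  then have "C * s * J0 \<le> q * J0" by simp
  then have "C * s \<le> q" using J by simp
  then show ?thesis using False s by (simp add: pos_le_divide_eq)
qed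

lemma deriv_eq_0_outside:
  fixes \<psi> :: "real \<Rightarrow> real"
  assumes "\<And>t. t < s1 \<or> s2 < t \<Longrightarrow> \<psi> t = 0" "t < s1 \<or> s2 < t"
  shows "deriv \<psi> t = 0"
proof -
  have "(\<psi> has_real_derivative 0) (at t)"
    by (rule has_field_derivative_transform_within_open[of "\<lambda>_. 0" _ _ "{..<s1} \<union> {s2<..}"])
       (use assms in auto)
  then show ?thesis by (rule DERIV_imp_deriv)
qed

text \<open>Every degree \<open>j\<close> bounds the constant; no knowledge of which degree attains
  the minimum is required.\<close>

lemma optimal_constant:
  assumes R: "R > 0" and n: "CARD('n::finite) \<ge> 2"
    and hr: "\<And>f. f \<in> C0_infty (ball (0::real^'n) R - {0}) \<Longrightarrow> hardy_rellich C R \<gamma> N \<eta> f"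
  shows "C \<le> alpha CARD('n) \<gamma> j"
proof -
  let ?n = "real CARD('n)"
  define a where "a = (4 - ?n - \<gamma>) / 2"
  define b where "b = a + ?n - 2"
  have a: "2 * a = 4 - ?n - \<gamma>" by (simp add: a_def)
  define m where "m = sph_eigenvalue CARD('n) j"
  obtain Y :: "'n pfun" and v :: "real^'n" where Y: "euler Y = 0" "sph_lap Y = - m *\<^sub>R Y"
    "norm v = 1" "\<And>r. r > 0 \<Longrightarrow> Rep_pfun Y (r *\<^sub>R v) = 1"
    using spherical_harmonic_exists[OF n, of j] unfolding m_def by metis
  have YY: "euler (Y * Y) = 0" by (simp add: euler_simps Y(1))
  \<comment> \<open>Support in [-3, -1], to the left of 0, places \<psi>(\<epsilon> ln(r/R)) in the
    annulus R e^(-3/\<epsilon>) <= r <= R e^(-1/\<epsilon>), inside the ball for every \<epsilon> >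
    0.\<close>
  obtain \<psi> where \<psi>: "elem_smooth \<psi>" "\<psi> (-2) = 1" "\<And>t. t \<le> -3 \<or> -1 \<le> t \<Longrightarrow> \<psi> t = 0"
    using elem_cutoff[of "-2" "-2"] by (smt (verit))
  define \<psi>1 where "\<psi>1 = deriv \<psi>"
  define \<psi>2 where "\<psi>2 = deriv \<psi>1"
  have el: "elem_smooth \<psi>" "elem_smooth \<psi>1" "elem_smooth \<psi>2"
    using \<psi>(1) by (auto simp: \<psi>1_def \<psi>2_def elem_smooth_deriv)
  have s0: "\<psi> t = 0" if "t < -3 \<or> -1 < t" for t using that \<psi>(3) by auto
  have s1: "\<psi>1 t = 0" if "t < -3 \<or> -1 < t" for t
    unfolding \<psi>1_def by (rule deriv_eq_0_outside[OF s0 that])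
  have s2: "\<psi>2 t = 0" if "t < -3 \<or> -1 < t" for t
    unfolding \<psi>2_def by (rule deriv_eq_0_outside[OF s1 that])
  \<comment> \<open>The profile rises from 0 at -4 to 1 at -2, so its derivative is nonzero
    somewhere between. This makes \<open>J \<psi>1\<close> positive, as the degenerate case of
    \<open>test_inequality\<close> needs.\<close>
  have "\<exists>z>-4. z < -2 \<and> \<psi> (-2) - \<psi> (-4) = (-2 - -4) * \<psi>1 z"
    by (rule MVT2) (auto simp: \<psi>1_def elem_smooth_deriv \<psi>(1))
  then obtain z where z: "\<psi>1 z \<noteq> 0" using \<psi>(2,3) by force
  define J where "J k = I (rad (\<lambda>t. k (1 * t + 0) * k (1 * t + 0)) * (Y * Y))" for k
  have J_pos: "J k > 0" if "elem_smooth k" "\<And>t. t < -3 \<or> -1 < t \<Longrightarrow> k t = 0" "k t0 \<noteq> 0" for k t0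
  proof -
    have k2: "elem_smooth (\<lambda>t. k (1 * t + 0) * k (1 * t + 0))" using that(1) by (intro elem_mult elem_affine)
    have "annular (rad (\<lambda>t. k (1 * t + 0) * k (1 * t + 0)) :: 'n pfun)"
      by (rule annular_rad[OF k2, of "-4" 0]) (use that(2) in auto)
    then show ?thesis unfolding J_def
    proof (intro I_pos[where x="exp t0 *\<^sub>R v"])
      show "0 < Rep_pfun (rad (\<lambda>t. k (1 * t + 0) * k (1 * t + 0)) * (Y * Y)) (exp t0 *\<^sub>R v)"
        using that(3) Y(3,4) by (auto simp: Rep_pfun_simps Rep_rad[OF k2, simplified] zero_less_mult_iff)
    qed (auto simp: Rep_pfun_simps Rep_rad[OF k2, simplified] intro: annular_mult)
  qed
  have ineq: "C * (\<epsilon>\<^sup>2 * J \<psi>1 + (a\<^sup>2 + m) * J \<psi>)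
     \<le> \<epsilon> ^ 4 * J \<psi>2 + (a\<^sup>2 + b\<^sup>2 + 2 * m) * (\<epsilon>\<^sup>2 * J \<psi>1) + (a * b - m)\<^sup>2 * J \<psi>"
    if e: "\<epsilon> > 0" for \<epsilon>
  proof -
    define d where "d = - (\<epsilon> * ln R)"
    define T where "T k = (\<lambda>t. k (\<epsilon> * t + d))" for k :: "real \<Rightarrow> real"
    have Tel: "elem_smooth (T k)" if "elem_smooth k" for k
      unfolding T_def by (rule elem_affine[OF that])
    have Td: "deriv (T k) = (\<lambda>t. \<epsilon> * T (deriv k) t)" if "elem_smooth k" for k
    proof (rule ext, rule DERIV_imp_deriv)
      fix t show "(T k has_real_derivative \<epsilon> * T (deriv k) t) (at t)"
        unfolding T_def
        by (rule DERIV_chain2[OF elem_smooth_deriv(2)[OF that], THEN DERIV_cong])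
           (auto intro!: derivative_eq_intros)
    qed
    define g :: "'n pfun" where "g = rad (T \<psi>) * Y"
    have eg: "euler g = \<epsilon> *\<^sub>R (rad (T \<psi>1) * Y)"
      unfolding g_def using el
      by (simp add: euler_simps Y(1) euler_rad Tel Td rad_scaleR \<psi>1_def elem_smooth_deriv)
    have eeg: "euler (euler g) = \<epsilon>\<^sup>2 *\<^sub>R (rad (T \<psi>2) * Y)"
      unfolding eg using el
      by (simp add: euler_simps Y(1) euler_rad Tel Td rad_scaleR \<psi>2_def elem_smooth_deriv power2_eq_square)
    have sg: "sph_lap g = - m *\<^sub>R g"
      unfolding g_def by (simp add: sph_lap_rot_const(1)[OF rot_rad[OF Tel[OF el(1)]]] Y(2))
    \<comment> \<open>All integrals share the factor 1/\<epsilon> from the change of variable, which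
      cancels at the end; each Euler derivative of g contributes its own factor \<epsilon>.\<close>
    have scale: "I ((rad (T k) * Y) * (rad (T k) * Y)) = J k / \<epsilon>"
      if "elem_smooth k" "\<And>t. t < -3 \<or> -1 < t \<Longrightarrow> k t = 0" for k
    proof -
      have k2: "elem_smooth (\<lambda>t. k t * k t)" using that(1) by (intro elem_mult)
      have "J k = \<epsilon> * I (rad (\<lambda>t. k (\<epsilon> * t + d) * k (\<epsilon> * t + d)) * (Y * Y))"
        unfolding J_def by (rule I_rad_scale[OF k2 _ YY e, of "-4" 0]) (use that(2) in auto)
      also have "rad (\<lambda>t. k (\<epsilon> * t + d) * k (\<epsilon> * t + d)) * (Y * Y) = (rad (T k) * Y) * (rad (T k) * Y)"
        unfolding rad_mult[OF Tel[OF that(1)] Tel[OF that(1)], unfolded T_def] T_def by (simp add: mult_ac)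
      finally show ?thesis using e by simp
    qed
    define u where "u = rpow a * g"
    have supp: "R * exp (-3 / \<epsilon>) \<le> norm x \<and> norm x \<le> R * exp (-1 / \<epsilon>)" if "Rep_pfun g x \<noteq> 0" for x
    proof -
      have x: "x \<noteq> 0" "T \<psi> (ln (norm x)) \<noteq> 0"
        using that by (auto simp: g_def Rep_pfun_simps Rep_rad[OF Tel[OF el(1)]])
      then have "-3 \<le> \<epsilon> * ln (norm x) + d" "\<epsilon> * ln (norm x) + d \<le> -1"
        using s0[of "\<epsilon> * ln (norm x) + d"] by (auto simp: T_def not_less[symmetric])
      then have "ln R + -3 / \<epsilon> \<le> ln (norm x)" "ln (norm x) \<le> ln R + -1 / \<epsilon>"
        using e by (auto simp: d_def field_simps)
      then have "exp (ln R + -3 / \<epsilon>) \<le> norm x" "norm x \<le> exp (ln R + -1 / \<epsilon>)"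
        using x by (metis exp_le_cancel_iff exp_ln zero_less_norm_iff)+
      then show ?thesis unfolding exp_add using R by simp
    qed
    have lim: "0 < R * exp (-3 / \<epsilon>)" "R * exp (-1 / \<epsilon>) < R" using R e by auto
    have supp_u: "R * exp (-3 / \<epsilon>) \<le> norm x \<and> norm x \<le> R * exp (-1 / \<epsilon>)" if "Rep_pfun u x \<noteq> 0" for x
      using supp that by (simp add: u_def Rep_pfun_simps)
    have ann: "annular g" using supp lim by (auto simp: annular_def)
    define h where "h = euler g + a *\<^sub>R g"
    define L where "L = euler (euler g) + (a + b) *\<^sub>R euler g + (a * b) *\<^sub>R g + sph_lap g"
    note ps = power_substitution[OF u_def a b_def h_def L_def]
    note en = eigenfunction_energies[OF ann sg h_def L_def]
    have "(\<lambda>x. complex_of_real (Rep_pfun u x)) \<in> C0_infty (ball 0 R - {0})"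
      using lim supp_u by (rule pfun_C0_infty)
    then have "hardy_rellich C R \<gamma> N \<eta> (\<lambda>x. complex_of_real (Rep_pfun u x))" by (rule hr)
    with lim supp_u have "C * I (rpow (\<gamma> - 2 + ?n) * (\<Sum>i\<in>UNIV. D i u * D i u))
        \<le> I (rpow (\<gamma> + ?n) * (lap u * lap u))"
      by (rule hardy_rellich_real_test)
    then have "C * I (h * h + sph_energy g) \<le> I (L * L)" unfolding ps .
    moreover have "I (g * g) = J \<psi> / \<epsilon>"
      unfolding g_def by (rule scale[OF el(1) s0])
    moreover have "I (euler g * euler g) = \<epsilon>\<^sup>2 * (J \<psi>1 / \<epsilon>)"
      unfolding eg using scale[OF el(2) s1] by (simp add: I_scaleR power2_eq_square)
    moreover have "I (euler (euler g) * euler (euler g)) = \<epsilon> ^ 4 * (J \<psi>2 / \<epsilon>)"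
      unfolding eeg using scale[OF el(3) s2] by (simp add: I_scaleR power2_eq_square power4_eq_xxxx)
    ultimately have "C * (\<epsilon>\<^sup>2 * (J \<psi>1 / \<epsilon>) + (a\<^sup>2 + m) * (J \<psi> / \<epsilon>))
       \<le> \<epsilon> ^ 4 * (J \<psi>2 / \<epsilon>) + (a\<^sup>2 + b\<^sup>2 + 2 * m) * (\<epsilon>\<^sup>2 * (J \<psi>1 / \<epsilon>)) + (a * b - m)\<^sup>2 * (J \<psi> / \<epsilon>)"
      unfolding en by simp
    then have "(C * (\<epsilon>\<^sup>2 * J \<psi>1 + (a\<^sup>2 + m) * J \<psi>)) / \<epsilon>
       \<le> (\<epsilon> ^ 4 * J \<psi>2 + (a\<^sup>2 + b\<^sup>2 + 2 * m) * (\<epsilon>\<^sup>2 * J \<psi>1) + (a * b - m)\<^sup>2 * J \<psi>) / \<epsilon>"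
      by (simp add: add_divide_distrib distrib_left)
    then show ?thesis using e by (simp add: divide_le_cancel)
  qed
  have m0: "m = 0 \<longleftrightarrow> j = 0" "m \<ge> 0"
    using sph_eigenvalue_pos[OF n, of j] by (cases "j = 0"; auto simp: m_def sph_eigenvalue_def)+
  have z0: "a\<^sup>2 + m = 0 \<Longrightarrow> a = 0 \<and> m = 0"
    using m0(2) by (simp add: add_nonneg_eq_0_iff)
  have concl: "if a\<^sup>2 + m = 0 then C \<le> a\<^sup>2 + b\<^sup>2 + 2 * m else C \<le> (a * b - m)\<^sup>2 / (a\<^sup>2 + m)"
  proof (rule test_inequality[OF ineq])
    show "0 < J \<psi>" using J_pos[OF el(1) s0, of "-2"] \<psi>(2) by simp
    show "0 < J \<psi>1" by (rule J_pos[OF el(2) s1 z])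
    show "0 \<le> a\<^sup>2 + m" using m0(2) by simp
    show "(a * b - m)\<^sup>2 = 0" if "a\<^sup>2 + m = 0" using z0[OF that] by simp
  qed
  note alpha = alpha_substitution[OF a b_def, folded m_def]
  \<comment> \<open>For j = 0 both branches of \<open>concl\<close> give b^2: as (ab)^2 / a^2 when a
    is nonzero, and as a^2 + b^2 when a = 0.\<close>
  show ?thesis
  proof (cases "j = 0")
    case True
    then show ?thesis
      using concl alpha(1) m0 z0 by (cases "a = 0") (auto simp: power_mult_distrib)
  next
    case False
    then have "a\<^sup>2 + m \<noteq> 0" using z0 m0(1) by blast
    then show ?thesis
      using concl alpha_substitution(2)[OF a b_def False] by (simp add: m_def power2_commute)
  qed
qed

theorem theorem2p3:
  fixes R \<gamma> \<eta> :: real and N :: nat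
  assumes "R > 0" and "N \<ge> 1" and "CARD('n::finite) \<ge> 2" and "\<eta> \<ge> iter_exp N * R"
  shows "(\<forall>f \<in> C0_infty (ball (0::real^'n) R - {0}).
            hardy_rellich (A_const CARD('n) \<gamma>) R \<gamma> N \<eta> f)
       \<and> (\<not> (CARD('n) = 2 \<and> \<gamma> = 2) \<and> \<not> (CARD('n) = 3 \<and> \<gamma> = 1) \<longrightarrow>
            \<not> (\<exists>C > A_const CARD('n) \<gamma>. \<forall>f \<in> C0_infty (ball (0::real^'n) R - {0}).
                  hardy_rellich C R \<gamma> N \<eta> f))"
proof (intro conjI impI ballI notI)
  show "hardy_rellich (A_const CARD('n) \<gamma>) R \<gamma> N \<eta> f"
    if "f \<in> C0_infty (ball (0::real^'n) R - {0})" for f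
    by (rule hardy_rellich_inequality[OF assms that])
  assume "\<exists>C > A_const CARD('n) \<gamma>. \<forall>f \<in> C0_infty (ball (0::real^'n) R - {0}). hardy_rellich C R \<gamma> N \<eta> f"
  then obtain C where C: "C > A_const CARD('n) \<gamma>"
    "\<And>f. f \<in> C0_infty (ball (0::real^'n) R - {0}) \<Longrightarrow> hardy_rellich C R \<gamma> N \<eta> f" by blast
  obtain j where "A_const CARD('n) \<gamma> = alpha CARD('n) \<gamma> j"
    using A_const_attained[OF assms(3)] by blast
  then show False using C(1) optimal_constant[OF assms(1,3) C(2), of j] by simp
qed

end
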